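(* Let $\mathcal{A}$ be an arrangement of $n$ pseudolines in $\mathbb{P}^2(\mathbb{R})$ whose characteristic polynomial $\chi(\mathcal{A},t)$ has only real roots. Then: (a) If $m(\mathcal{A})\leq 4$, then $n\leq 19$. (b) If $m(\mathcal{A})\leq 5$, then $n\leq 185$.
   Context: An arrangement of pseudolines is a finite set $\mathcal{A}=\{\ell_1,\dots,\ell_n\}$ of $n\geq 3$ smooth closed curves in $\mathbb{P}^2(\mathbb{R})$ that do not intersect themselves, any two distinct of which meet transversally in exactly one point, and which do not all pass through a common point. The weight of a point is the number of pseudolines through it; $t_i$ is the number of points of weight exactly $i$; the multiplicity $m(\mathcal{A})$ is the largest $j$ with $t_j>0$. The intersection lattice $L$ consists of $\emptyset$ (rank $0$), the singletons $\{i\}$ (rank $1$), the sets $I_v=\{i: v\in\ell_i\}$ for points $v$ with $|I_v|\ge 2$ (rank $2$), and $\{1,\dots,n\}$ (rank $3$), ordered by inclusion; $\chi(\mathcal{A},t)=\sum_{X\in L}\mu(\emptyset,X)\,t^{3-\operatorname{rank}(X)}$ with $\mu$ the Möbius function of $L$. *)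

theory Defs
  imports "HOL-Analysis.Analysis" "HOL-Computational_Algebra.Polynomial"
begin

typedef rp2 = "{L :: (real ^ 3) set. subspace L \<and> dim L = 1}"
proof
  show "span {axis 1 1 :: real ^ 3} \<in> {L. subspace L \<and> dim L = 1}"
    by (simp add: dim_span axis_eq_0_iff)
qed

text \<open>The standard affine charts. The \<open>k\<close>-th chart sends \<open>[x]\<close> to the representative
  \<open>x / x $ k\<close> in the affine plane \<open>x $ k = 1\<close>, which is kept inside \<open>real ^ 3\<close> instead of
  being identified with \<open>real ^ 2\<close> by dropping the constant coordinate.\<close>

definition chart_dom :: "3 \<Rightarrow> rp2 set" where
  "chart_dom k = {p. \<exists>x \<in> Rep_rp2 p. x $ k \<noteq> 0}"

definition chart :: "3 \<Rightarrow> rp2 \<Rightarrow> real ^ 3" where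
  "chart k p = (THE x. x \<in> Rep_rp2 p \<and> x $ k = 1)"

text \<open>\<open>D m\<close> is the \<open>m\<close>-th derivative of \<open>f\<close>; only used for open \<open>S\<close>.\<close>

definition smooth_real_on :: "real set \<Rightarrow> (real \<Rightarrow> 'a :: real_normed_vector) \<Rightarrow> bool" where
  "smooth_real_on S f \<longleftrightarrow> (\<exists>D :: nat \<Rightarrow> real \<Rightarrow> 'a. (\<forall>t \<in> S. D 0 t = f t) \<and>
     (\<forall>m. \<forall>t \<in> S. (D m has_vector_derivative D (Suc m) t) (at t)))"

text \<open>Openness of the preimages of the chart domains, together with continuity of the chart
  expressions, is continuity of \<open>c\<close>.\<close>

definition smooth_map :: "(real \<Rightarrow> rp2) \<Rightarrow> bool" where
  "smooth_map c \<longleftrightarrow> (\<forall>k. open (c -` chart_dom k) \<and>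
     smooth_real_on (c -` chart_dom k) (\<lambda>t. chart k (c t)))"

definition velocity :: "3 \<Rightarrow> (real \<Rightarrow> rp2) \<Rightarrow> real \<Rightarrow> real ^ 3" where
  "velocity k c t = vector_derivative (\<lambda>s. chart k (c s)) (at t)"

text \<open>\<open>c\<close> is a regular parametrization of \<open>C\<close> by the circle \<open>\<real>/\<int>\<close>: the last condition says
  both that \<open>c\<close> is 1-periodic and that it is injective on the circle.\<close>

definition parametrizes :: "(real \<Rightarrow> rp2) \<Rightarrow> rp2 set \<Rightarrow> bool" where
  "parametrizes c C \<longleftrightarrow> C = range c \<and> smooth_map c \<and>
     (\<forall>k t. c t \<in> chart_dom k \<longrightarrow> velocity k c t \<noteq> 0) \<and>
     (\<forall>s t. c s = c t \<longleftrightarrow> s - t \<in> \<int>)"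

definition smooth_simple_closed_curve :: "rp2 set \<Rightarrow> bool" where
  "smooth_simple_closed_curve C \<longleftrightarrow> (\<exists>c. parametrizes c C)"

text \<open>The tangent lines at \<open>p\<close> together span the 2-dimensional tangent plane. For smooth simple
  closed curves this depends neither on the chart nor on the parametrizations.\<close>

definition transversal_at :: "rp2 \<Rightarrow> rp2 set \<Rightarrow> rp2 set \<Rightarrow> bool" where
  "transversal_at p C D \<longleftrightarrow> (\<exists>c d s t k. parametrizes c C \<and> parametrizes d D \<and>
     c s = p \<and> d t = p \<and> p \<in> chart_dom k \<and> dim {velocity k c s, velocity k d t} = 2)"

definition pseudoline_arrangement :: "nat \<Rightarrow> (nat \<Rightarrow> rp2 set) \<Rightarrow> bool" where
  "pseudoline_arrangement n l \<longleftrightarrow> n \<ge> 3 \<and> inj_on l {1..n} \<and>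
     (\<forall>i \<in> {1..n}. smooth_simple_closed_curve (l i)) \<and>
     (\<forall>i \<in> {1..n}. \<forall>j \<in> {1..n}. i \<noteq> j \<longrightarrow>
        (\<exists>p. l i \<inter> l j = {p} \<and> transversal_at p (l i) (l j))) \<and>
     (\<Inter>i \<in> {1..n}. l i) = {}"

definition lines_through :: "nat \<Rightarrow> (nat \<Rightarrow> rp2 set) \<Rightarrow> rp2 \<Rightarrow> nat set" where
  "lines_through n l v = {i \<in> {1..n}. v \<in> l i}"

definition weight :: "nat \<Rightarrow> (nat \<Rightarrow> rp2 set) \<Rightarrow> rp2 \<Rightarrow> nat" where
  "weight n l v = card (lines_through n l v)"

text \<open>There are infinitely many points of weight 0 and of weight 1, so that \<open>t_num\<close> is 0 there by
  the convention for \<open>card\<close>. This does not affect the maximum below: an arrangement has points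
  of weight at least 2, and only finitely many of them.\<close>

definition t_num :: "nat \<Rightarrow> (nat \<Rightarrow> rp2 set) \<Rightarrow> nat \<Rightarrow> nat" where
  "t_num n l i = card {v. weight n l v = i}"

definition arr_multiplicity :: "nat \<Rightarrow> (nat \<Rightarrow> rp2 set) \<Rightarrow> nat" where
  "arr_multiplicity n l = Max {j. t_num n l j > 0}"

definition intersection_lattice :: "nat \<Rightarrow> (nat \<Rightarrow> rp2 set) \<Rightarrow> nat set set" where
  "intersection_lattice n l =
     {{}} \<union> {{i} | i. i \<in> {1..n}} \<union>
     {lines_through n l v | v. card (lines_through n l v) \<ge> 2} \<union> {{1..n}}"

definition lattice_rank :: "nat \<Rightarrow> nat set \<Rightarrow> nat" where
  "lattice_rank n X =
     (if X = {} then 0 else if card X = 1 then 1 else if X = {1..n} then 3 else 2)"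

text \<open>The Moebius function of a finite family \<open>L\<close> of finite sets ordered by inclusion. The
  finiteness guard only serves termination.\<close>

function moebius :: "'a set set \<Rightarrow> 'a set \<Rightarrow> 'a set \<Rightarrow> int" where
  "moebius L X Y =
     (if X = Y then 1
      else if X \<subset> Y \<and> finite Y then - (\<Sum>Z \<in> {Z \<in> L. X \<subseteq> Z \<and> Z \<subset> Y}. moebius L X Z)
      else 0)"
  by pat_completeness auto
termination
  by (relation "Wellfounded.measure (\<lambda>(L, X, Y). card Y)") (auto intro: psubset_card_mono)

declare moebius.simps [simp del]

definition characteristic_poly :: "nat \<Rightarrow> (nat \<Rightarrow> rp2 set) \<Rightarrow> int poly" where
  "characteristic_poly n l = (\<Sum>X \<in> intersection_lattice n l.
     monom (moebius (intersection_lattice n l) {} X) (3 - lattice_rank n X))"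

definition only_real_roots :: "int poly \<Rightarrow> bool" where
  "only_real_roots p \<longleftrightarrow> (\<forall>z :: complex. poly (map_poly of_int p) z = 0 \<longrightarrow> z \<in> \<real>)"

end

(* The characteristic polynomial has only real roots iff 4 b <= n^2 + 2 n - 3, where b is the sum
   of w - 1 over the crossing points of weight w. Two inequalities between the numbers t_i bound b
   from below: Melchior's inequality t_2 >= 3 + t_4 + 2 t_5 (if m <= 5), which alone gives (a), and
   4 t_2 + t_3 >= 16 + 4 t_4 + 9 t_5, which holds unless all lines but one are concurrent. Both
   count the boundary edges of the faces. The second one uses that a triangle with two vertices of
   weight 2 has a neighbour across the edge joining them that is not a triangle, so that the
   excess of corners at double points is paid by the larger faces.

   The curves are lifted to the sphere. By the Jordan curve theorem each closed lift has two sides,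
   and a single transversal crossing per pair forces every lift to be antiperiodic. A face is
   represented by its vector of sides, and its boundary by the darts it contains, so that the only
   topology needed is the behaviour of the sides along the curves and in a small neighbourhood of
   a vertex, where a crossing curve passes from one side to the other as its tangent does. The
   number of faces is bounded from below by adding one curve at a time; Euler's formula is not
   needed. *)

theory Submission
  imports Defs
begin

section \<open>Counting faces of a spherical arrangement\<close>

text \<open>A pseudoline does not separate the projective plane, so faces cannot be named by sides
  there; on the sphere they can, at the price of doubling every count. Both inequalities compare the
  number of boundary edges with the number of faces and need the latter only from below, for which
  distinct sign vectors are enough. The second inequality is forced by (b). Let P = n (n - 1), the
  sum of w (w - 1) over the points. For weights up to 5, 4 b - P = 2 t_2 + 2 t_3 - 4 t_5, and
  Melchior makes this at least 6 + 2 t_3 + 2 t_4. Real roots give 4 b - P \<le> 3 n - 3, which does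
  not bound n if t_3 and t_4 are small and t_2 is about 2 t_5. Raising the ratio of t_2 to t_5 from
  2 to 9/4 yields 50 P + 384 \<le> 196 b, a gain in the leading term that bounds n. For weights up
  to 4 Melchior itself yields 8 P + 36 \<le> 28 b.\<close>

lemma not_Ints_between:
  fixes d :: real assumes "0 < d" "d < 1" shows "d \<notin> \<int>" "- d \<notin> \<int>"
proof -
  show a: "d \<notin> \<int>" using assms by (auto elim!: Ints_cases)
  show "-d \<notin> \<int>" using a by (metis Ints_minus minus_minus)
qed

type_synonym 'a slot = "nat \<times> 'a \<times> int \<times> int"

definition param :: "(nat \<Rightarrow> real \<Rightarrow> 'a) \<Rightarrow> nat \<Rightarrow> 'a \<Rightarrow> real" where
  "param g i x = (SOME t. g i t = x)"

text \<open>The side of curve \<open>k\<close> that curve \<open>i\<close> enters when it runs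
  forward through a common point \<open>x\<close>. Crossings with \<open>k\<close> recur after each
  unit of parameter, so any offset in (0, 1) gives the same sign as 1/2.\<close>

definition cross_sign :: "(nat \<Rightarrow> real \<Rightarrow> 'a) \<Rightarrow> (nat \<Rightarrow> 'a \<Rightarrow> int) \<Rightarrow> nat \<Rightarrow> nat \<Rightarrow> 'a \<Rightarrow> int" where
  "cross_sign g \<sigma> k i x = \<sigma> k (g i (param g i x + 1/2))"

text \<open>All that the counting needs, free of topology. Parameters have period 2 and a shift by 1
  stands for the antipode. Only \<open>sector\<close> speaks of the order around a vertex: on side
  \<open>s\<close> of the dart \<open>(i, \<eta>)\<close> there is a neighbouring dart
  \<open>(j, \<eta>')\<close>, where being neighbours means that every further curve through
  \<open>x\<close> has both darts on the same side.\<close>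

locale spherical_arrangement =
  fixes n :: nat and g :: "nat \<Rightarrow> real \<Rightarrow> 'a" and \<sigma> :: "nat \<Rightarrow> 'a \<Rightarrow> int"
  assumes period: "\<And>i s t. i \<in> {1..n} \<Longrightarrow> g i s = g i t \<longleftrightarrow> (\<exists>m::int. s - t = 2 * of_int m)"
    and sign_range: "\<And>i x. \<sigma> i x \<in> {-1, 0, 1}"
    and sign_zero: "\<And>i x. i \<in> {1..n} \<Longrightarrow> \<sigma> i x = 0 \<longleftrightarrow> x \<in> range (g i)"
    and cross: "\<And>i j. i \<in> {1..n} \<Longrightarrow> j \<in> {1..n} \<Longrightarrow> i \<noteq> j \<Longrightarrow>
       \<exists>b. \<forall>t. \<sigma> j (g i t) = 0 \<longleftrightarrow> t - b \<in> \<int>"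
    and anti: "\<And>i j t. i \<in> {1..n} \<Longrightarrow> j \<in> {1..n} \<Longrightarrow> \<sigma> j (g i (t + 1)) = - \<sigma> j (g i t)"
    and sign_const: "\<And>i j a b. i \<in> {1..n} \<Longrightarrow> j \<in> {1..n} \<Longrightarrow> a \<le> b \<Longrightarrow>
       (\<forall>t\<in>{a..b}. \<sigma> j (g i t) \<noteq> 0) \<Longrightarrow> \<sigma> j (g i a) = \<sigma> j (g i b)"
    and not_concurrent: "\<And>x. \<exists>i\<in>{1..n}. \<sigma> i x \<noteq> 0"
    and sector: "\<And>i x \<eta> s. i \<in> {1..n} \<Longrightarrow> \<sigma> i x = 0 \<Longrightarrow> \<exists>j\<in>{1..n}. j \<noteq> i \<and> \<sigma> j x = 0 \<Longrightarrow>
       \<eta> \<in> {-1, 1} \<Longrightarrow> s \<in> {-1, 1} \<Longrightarrow>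
       \<exists>j\<in>{1..n}. j \<noteq> i \<and> \<sigma> j x = 0 \<and> (\<exists>\<eta>'\<in>{-1,1}. \<eta>' * cross_sign g \<sigma> i j x = s \<and>
         (\<forall>k\<in>{1..n}. k \<noteq> i \<longrightarrow> k \<noteq> j \<longrightarrow> \<sigma> k x = 0 \<longrightarrow>
            \<eta>' * cross_sign g \<sigma> k j x = \<eta> * cross_sign g \<sigma> k i x))"
begin

definition lines_at :: "'a \<Rightarrow> nat set" where
  "lines_at x = {i \<in> {1..n}. \<sigma> i x = 0}"

definition vertices :: "'a set" where
  "vertices = {x. card (lines_at x) \<ge> 2}"

abbreviation cs where "cs \<equiv> cross_sign g \<sigma>"
abbreviation par where "par \<equiv> param g"

lemma finite_lines_at [simp]: "finite (lines_at x)"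
  by (simp add: lines_at_def)

lemma param: "i \<in> {1..n} \<Longrightarrow> \<sigma> i x = 0 \<Longrightarrow> g i (par i x) = x"
  unfolding param_def using sign_zero[of i x] by (metis (mono_tags, lifting) rangeE someI)

lemma vertexI: "i \<in> {1..n} \<Longrightarrow> j \<in> {1..n} \<Longrightarrow> i \<noteq> j \<Longrightarrow> \<sigma> i x = 0 \<Longrightarrow> \<sigma> j x = 0 \<Longrightarrow> x \<in> vertices"
proof -
  assume a: "i \<in> {1..n}" "j \<in> {1..n}" "i \<noteq> j" "\<sigma> i x = 0" "\<sigma> j x = 0"
  have "{i,j} \<subseteq> lines_at x" using a by (auto simp: lines_at_def)
  then have "card {i,j} \<le> card (lines_at x)" by (intro card_mono) auto
  then show ?thesis using a by (simp add: vertices_def)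
qed

lemma vertexD: "x \<in> vertices \<Longrightarrow> \<exists>j\<in>{1..n}. j \<noteq> i \<and> \<sigma> j x = 0"
proof (rule ccontr)
  assume x: "x \<in> vertices" and "\<not> ?thesis"
  then have "lines_at x \<subseteq> {i}" by (auto simp: lines_at_def)
  then have "card (lines_at x) \<le> card {i}" by (intro card_mono) auto
  then show False using x by (simp add: vertices_def)
qed

lemma sign_on_self [simp]: "i \<in> {1..n} \<Longrightarrow> \<sigma> i (g i t) = 0"
  using sign_zero by auto

lemma cross_Ints:
  assumes "i \<in> {1..n}" "j \<in> {1..n}" "i \<noteq> j" "\<sigma> j (g i s) = 0"
  shows "\<sigma> j (g i t) = 0 \<longleftrightarrow> t - s \<in> \<int>"
proof -
  obtain b where b: "\<And>t. \<sigma> j (g i t) = 0 \<longleftrightarrow> t - b \<in> \<int>" using cross[OF assms(1-3)] by blast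
  have "s - b \<in> \<int>" using b assms(4) by simp
  then have "t - b \<in> \<int> \<longleftrightarrow> t - s \<in> \<int>"
    using Ints_add[of "t - s" "s - b"] Ints_diff[of "t - b" "s - b"] by auto
  then show ?thesis using b by simp
qed

lemma sign_const_gen:
  assumes "i \<in> {1..n}" "j \<in> {1..n}" "\<And>t. t \<in> {min a b..max a b} \<Longrightarrow> \<sigma> j (g i t) \<noteq> 0"
  shows "\<sigma> j (g i a) = \<sigma> j (g i b)"
proof (cases "a \<le> b")
  case True
  then show ?thesis using assms sign_const[OF assms(1,2) True] by (simp add: min_def max_def)
next
  case False
  then show ?thesis using assms sign_const[OF assms(1,2), of b a] by (simp add: min_def max_def)
qed

lemma sign_after:
  assumes "i \<in> {1..n}" "k \<in> {1..n}" "k \<noteq> i" "\<sigma> k (g i t) = 0" "0 < d" "d < 1" "0 < e" "e < 1"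
  shows "\<sigma> k (g i (t + d)) = \<sigma> k (g i (t + e))"
proof (rule sign_const_gen[OF assms(1,2)])
  fix s assume "s \<in> {min (t+d) (t+e)..max (t+d) (t+e)}"
  then have "0 < s - t" "s - t < 1" using assms by auto
  then show "\<sigma> k (g i s) \<noteq> 0" using cross_Ints[of i k t s] assms not_Ints_between by auto
qed

text \<open>A shift by 1 carries the stretch before \<open>t\<close> onto the stretch after it and
  reverses the sign, so a crossing changes sides without any local argument.\<close>

lemma sign_before:
  assumes "i \<in> {1..n}" "k \<in> {1..n}" "k \<noteq> i" "\<sigma> k (g i t) = 0" "0 < d" "d < 1" "0 < e" "e < 1"
  shows "\<sigma> k (g i (t - d)) = - \<sigma> k (g i (t + e))"
proof -
  have "\<sigma> k (g i (t - d + 1)) = - \<sigma> k (g i (t - d))" by (rule anti) fact+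
  moreover have "\<sigma> k (g i (t + (1 - d))) = \<sigma> k (g i (t + e))"
    by (rule sign_after) (use assms in auto)
  ultimately show ?thesis by (simp add: algebra_simps)
qed

lemma period_sign:
  assumes "i \<in> {1..n}" "g i s = g i t"
  shows "g i (s + e) = g i (t + e)"
  using period[OF assms(1)] assms(2) by (metis add_diff_cancel_right)

lemma cs_eq:
  assumes "i \<in> {1..n}" "k \<in> {1..n}" "k \<noteq> i" "\<sigma> k x = 0" "g i t = x" "0 < e" "e < 1"
  shows "cs k i x = \<sigma> k (g i (t + e))"
proof -
  have "g i (par i x) = x" using param[of i x] sign_on_self[of i t] assms by simp
  then have "g i (par i x + 1/2) = g i (t + 1/2)" using period_sign assms by metis
  then show ?thesis unfolding cross_sign_def using sign_after[of i k t "1/2" e] assms by simp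
qed

lemma cs_values:
  assumes "i \<in> {1..n}" "k \<in> {1..n}" "k \<noteq> i" "\<sigma> k x = 0" "\<sigma> i x = 0"
  shows "cs k i x \<in> {-1, 1}"
proof -
  have "g i (par i x) = x" using assms param by simp
  then have "\<sigma> k (g i (par i x + 1/2)) \<noteq> 0"
    using cross_Ints[of i k "par i x" "par i x + 1/2"] assms not_Ints_between[of "1/2"] by auto
  then show ?thesis unfolding cross_sign_def using sign_range by blast
qed

text \<open>The tope, in the sense of oriented matroids, of the face that touches the dart from side
  \<open>s\<close>: curves through \<open>x\<close> are read as the dart leaves \<open>x\<close>,
  its own curve is replaced by \<open>s\<close>. The value 0 outside \<open>{1..n}\<close> makes
  equality of topes plain equality of functions.\<close>

definition tope :: "'a slot \<Rightarrow> nat \<Rightarrow> int" where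
  "tope = (\<lambda>(i, x, \<eta>, s) k. if k \<notin> {1..n} then 0 else if k = i then s
     else if \<sigma> k x = 0 then \<eta> * cs k i x else \<sigma> k x)"

text \<open>The sign that a dart sees on leaving \<open>x\<close> persists until the next crossing
  with \<open>k\<close>, so it may be read anywhere on the edge. This is how the two ends of an edge
  are compared.\<close>

lemma tope_dart:
  assumes "i \<in> {1..n}" "k \<in> {1..n}" "k \<noteq> i" "g i t = x" "\<eta> \<in> {-1, 1}" "0 < e" "e < 1"
    and nz: "\<And>e'. 0 < e' \<Longrightarrow> e' \<le> e \<Longrightarrow> \<sigma> k (g i (t + of_int \<eta> * e')) \<noteq> 0"
  shows "tope (i, x, \<eta>, s) k = \<sigma> k (g i (t + of_int \<eta> * e))"
proof (cases "\<sigma> k x = 0")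
  case True
  have c: "cs k i x = \<sigma> k (g i (t + e))" by (rule cs_eq) (use assms True in auto)
  have "\<eta> * cs k i x = \<sigma> k (g i (t + of_int \<eta> * e))"
  proof (cases "\<eta> = 1")
    case True then show ?thesis using c by simp
  next
    case False
    then have \<eta>: "\<eta> = -1" using assms by auto
    have "\<sigma> k (g i (t - e)) = - \<sigma> k (g i (t + e))" by (rule sign_before) (use assms True in auto)
    then show ?thesis using c \<eta> by simp
  qed
  then show ?thesis using assms True by (simp add: tope_def)
next
  case False
  have "\<sigma> k (g i t) = \<sigma> k (g i (t + of_int \<eta> * e))"
  proof (rule sign_const_gen[OF assms(1,2)])
    fix r assume r: "r \<in> {min t (t + of_int \<eta> * e)..max t (t + of_int \<eta> * e)}"
    show "\<sigma> k (g i r) \<noteq> 0"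
    proof (cases "r = t")
      case True then show ?thesis using False assms by simp
    next
      case rt: False
      have "r = t + of_int \<eta> * (of_int \<eta> * (r - t))" "0 < of_int \<eta> * (r - t)" "of_int \<eta> * (r - t) \<le> e"
        using r rt assms(5,6) by auto
      then show ?thesis using nz by metis
    qed
  qed
  then show ?thesis using False assms by (simp add: tope_def)
qed

text \<open>The bound \<open>d < 1\<close> can be met because some curve avoids the point
  \<open>g i t\<close> and so crosses \<open>i\<close> strictly within the next unit of parameter.
  It keeps an edge from joining two common points of the same two curves.\<close>

definition is_gap :: "nat \<Rightarrow> real \<Rightarrow> int \<Rightarrow> real \<Rightarrow> bool" where
  "is_gap i t \<eta> d \<longleftrightarrow> 0 < d \<and> d < 1 \<and> g i (t + of_int \<eta> * d) \<in> vertices \<and>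
     (\<forall>e\<in>{0<..<d}. \<forall>k\<in>{1..n}. k \<noteq> i \<longrightarrow> \<sigma> k (g i (t + of_int \<eta> * e)) \<noteq> 0)"

lemma vertex_on:
  assumes "i \<in> {1..n}" "g i t \<in> vertices"
  obtains j where "j \<in> {1..n}" "j \<noteq> i" "\<sigma> j (g i t) = 0"
  using vertexD[OF assms(2), of i] by blast

lemma gap_ex:
  assumes i: "i \<in> {1..n}" and \<eta>: "\<eta> \<in> {-1, 1}" and v: "g i t \<in> vertices"
  shows "\<exists>d. is_gap i t \<eta> d"
proof -
  define Q where "Q = {d \<in> {0<..<1::real}. \<exists>k\<in>{1..n}. k \<noteq> i \<and> \<sigma> k (g i (t + of_int \<eta> * d)) = 0}"
  have "finite {d \<in> {0<..<1::real}. \<sigma> k (g i (t + of_int \<eta> * d)) = 0}" if k: "k \<in> {1..n}" "k \<noteq> i" for k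
  proof -
    have "d = d'" if d: "d \<in> {0<..<1::real}" "\<sigma> k (g i (t + of_int \<eta> * d)) = 0"
      "d' \<in> {0<..<1::real}" "\<sigma> k (g i (t + of_int \<eta> * d')) = 0" for d d'
    proof -
      have "of_int \<eta> * d' - of_int \<eta> * d \<in> \<int>"
        using cross_Ints[of i k "t + of_int \<eta> * d" "t + of_int \<eta> * d'"] i k d by simp
      then have "d' - d \<in> \<int>" using \<eta> Ints_minus[of "d - d'"] by auto
      then obtain z where "d' - d = of_int z" by (elim Ints_cases)
      moreover have "\<bar>d' - d\<bar> < 1" using d by auto
      ultimately have "z = 0" by linarith
      then show ?thesis using \<open>d' - d = of_int z\<close> by simp
    qed
    then have "\<exists>d0. {d \<in> {0<..<1::real}. \<sigma> k (g i (t + of_int \<eta> * d)) = 0} \<subseteq> {d0}" by blast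
    then show ?thesis by (meson finite.emptyI finite.insertI finite_subset)
  qed
  then have "finite (\<Union>k\<in>{1..n}-{i}. {d \<in> {0<..<1::real}. \<sigma> k (g i (t + of_int \<eta> * d)) = 0})" by auto
  then have fin: "finite Q" by (rule rev_finite_subset) (auto simp: Q_def)
  obtain k where k: "k \<in> {1..n}" "\<sigma> k (g i t) \<noteq> 0" using not_concurrent by blast
  then have ki: "k \<noteq> i" by auto
  obtain b where b: "\<And>t. \<sigma> k (g i t) = 0 \<longleftrightarrow> t - b \<in> \<int>" using cross[OF i k(1)] ki by blast
  \<comment> \<open>The crossings with \<open>k\<close> form the class of \<open>b\<close> modulo 1;
    \<open>frac\<close> picks the first one at or after \<open>t\<close> in direction
    \<open>\<eta>\<close>. It is not at \<open>t\<close> because \<open>k\<close> avoids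
    \<open>g i t\<close>.\<close>
  define d where "d = frac (of_int \<eta> * (b - t))"
  have e: "of_int \<eta> * (of_int \<eta> * x) = (x::real)" for x using \<eta> by auto
  have "t + of_int \<eta> * d - b = - of_int (\<eta> * \<lfloor>of_int \<eta> * (b - t)\<rfloor>)"
    unfolding d_def frac_def by (simp add: right_diff_distrib e del: minus_mult_left)
  then have 0: "\<sigma> k (g i (t + of_int \<eta> * d)) = 0" using b by (metis Ints_minus Ints_of_int)
  have "d \<noteq> 0" using 0 k by auto
  then have "d \<in> Q" using 0 k ki by (auto simp: Q_def d_def frac_lt_1)
  then have "Q \<noteq> {}" by auto
  then have m: "Min Q \<in> Q" "\<And>e. e \<in> Q \<Longrightarrow> Min Q \<le> e" using fin by auto
  have "is_gap i t \<eta> (Min Q)"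
    unfolding is_gap_def
  proof (intro conjI ballI impI)
    show "0 < Min Q" "Min Q < 1" using m(1) by (auto simp: Q_def)
    show "g i (t + of_int \<eta> * Min Q) \<in> vertices" 
    proof -
      obtain k where "k\<in>{1..n}" "k \<noteq> i" "\<sigma> k (g i (t + of_int \<eta> * Min Q)) = 0"
        using m(1) unfolding Q_def by blast
      then show ?thesis using vertexI[of i k] i by simp
    qed
    fix e k assume "e \<in> {0<..<Min Q}" "k \<in> {1..n}" "k \<noteq> i"
    then show "\<sigma> k (g i (t + of_int \<eta> * e)) \<noteq> 0" using m by (force simp: Q_def)
  qed
  then show ?thesis ..
qed

lemma gap_unique:
  assumes i: "i \<in> {1..n}" and "is_gap i t \<eta> d" "is_gap i t \<eta> d'"
  shows "d = d'"
proof -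
  have "\<not> d < d'" if g: "is_gap i t \<eta> d" "is_gap i t \<eta> d'" for d d'
  proof
    assume "d < d'"
    moreover obtain j where "j \<in> {1..n}" "j \<noteq> i" "\<sigma> j (g i (t + of_int \<eta> * d)) = 0"
      using g(1) vertex_on[OF i] unfolding is_gap_def by metis
    ultimately show False using g by (auto simp: is_gap_def)
  qed
  then show ?thesis using assms by (meson linorder_less_linear)
qed

lemma gap_shift:
  assumes "i \<in> {1..n}" "g i s = g i t" "is_gap i s \<eta> d"
  shows "is_gap i t \<eta> d"
  using assms(3) period_sign[OF assms(1,2)] unfolding is_gap_def by simp

lemma gap_reverse:
  assumes i: "i \<in> {1..n}" "\<eta> \<in> {-1,1}" and v: "g i t \<in> vertices" and g: "is_gap i t \<eta> d"
  shows "is_gap i (t + of_int \<eta> * d) (- \<eta>) d"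
  unfolding is_gap_def
proof (intro conjI ballI impI)
  show "0 < d" "d < 1" using g by (auto simp: is_gap_def)
  show "g i (t + of_int \<eta> * d + of_int (- \<eta>) * d) \<in> vertices" using v by simp
  fix e k assume "e \<in> {0<..<d}" "k \<in> {1..n}" "k \<noteq> i"
  then have "\<sigma> k (g i (t + of_int \<eta> * (d - e))) \<noteq> 0" using g by (auto simp: is_gap_def)
  then show "\<sigma> k (g i (t + of_int \<eta> * d + of_int (- \<eta>) * e)) \<noteq> 0" by (simp add: algebra_simps)
qed

definition gap :: "nat \<Rightarrow> int \<Rightarrow> 'a \<Rightarrow> real" where
  "gap i \<eta> x = (SOME d. is_gap i (par i x) \<eta> d)"

lemma gapI:
  assumes "i \<in> {1..n}" "\<eta> \<in> {-1,1}" "x \<in> vertices" "g i t = x"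
  shows "is_gap i t \<eta> (gap i \<eta> x)"
proof -
  have p: "g i (par i x) = x" using param[of i x] sign_on_self[of i t] assms by simp
  then have "is_gap i (par i x) \<eta> (gap i \<eta> x)"
    unfolding gap_def
    using someI_ex[OF gap_ex[of i \<eta> "par i x"]] assms by simp
  then show ?thesis using gap_shift[of i "par i x" t] assms p by simp
qed

text \<open>A slot \<open>(i, x, \<eta>, s)\<close> is the dart leaving the vertex \<open>x\<close> along the line \<open>i\<close> in direction \<open>\<eta>\<close>,
  together with its side \<open>s\<close>. Each boundary edge of a face gives two slots, one per end; \<open>other_end\<close>
  passes along the edge and \<open>turn\<close> around the vertex, both within the face.\<close>

definition slots :: "('a slot) set" where
  "slots = {(i, x, \<eta>, s). i \<in> {1..n} \<and> x \<in> vertices \<and> \<sigma> i x = 0 \<and> \<eta> \<in> {-1,1} \<and> s \<in> {-1,1}}"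

definition other_end :: "'a slot \<Rightarrow> 'a slot" where
  "other_end = (\<lambda>(i, x, \<eta>, s). (i, g i (par i x + of_int \<eta> * gap i \<eta> x), -\<eta>, s))"

definition flip :: "'a slot \<Rightarrow> 'a slot" where
  "flip = (\<lambda>(i, x, \<eta>, s). (i, x, \<eta>, -s))"

definition line_of :: "'a slot \<Rightarrow> nat" where "line_of = fst"
definition vertex_of :: "'a slot \<Rightarrow> 'a" where "vertex_of a = fst (snd a)"

lemma line_of_simp [simp]: "line_of (i, x, \<eta>, s) = i" and vertex_of_simp [simp]: "vertex_of (i, x, \<eta>, s)
    = x"
  by (simp_all add: line_of_def vertex_of_def)

lemma other_end_eq:
  assumes "(i, x, \<eta>, s) \<in> slots" "g i t = x" "is_gap i t \<eta> d"
  shows "other_end (i, x, \<eta>, s) = (i, g i (t + of_int \<eta> * d), -\<eta>, s)"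
proof -
  have i: "i \<in> {1..n}" "\<eta> \<in> {-1,1}" "x \<in> vertices" "\<sigma> i x = 0" using assms by (auto simp: slots_def)
  have "is_gap i t \<eta> (gap i \<eta> x)" using gapI i assms by blast
  then have "gap i \<eta> x = d" using gap_unique i assms by blast
  moreover have "g i (par i x) = g i t" using param[of i x] i assms by simp
  ultimately show ?thesis unfolding other_end_def
    using period_sign[OF i(1), of "par i x" t "of_int \<eta> * d"] by simp
qed

lemma other_end_ex:
  assumes "(i, x, \<eta>, s) \<in> slots" "g i t = x"
  shows "\<exists>d. is_gap i t \<eta> d \<and> other_end (i, x, \<eta>, s) = (i, g i (t + of_int \<eta> * d), -\<eta>, s)"
proof -
  have "is_gap i t \<eta> (gap i \<eta> x)" using assms gapI by (auto simp: slots_def)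
  then show ?thesis using other_end_eq assms by blast
qed

lemma slot_param:
  assumes "(i, x, \<eta>, s) \<in> slots" shows "\<exists>t. g i t = x"
  using assms param[of i x] by (auto simp: slots_def)

lemma other_end_slot: "a \<in> slots \<Longrightarrow> other_end a \<in> slots"
proof -
  assume a: "a \<in> slots"
  obtain i x \<eta> s where ax [simp]: "a = (i, x, \<eta>, s)" by (cases a)
  obtain t where t: "g i t = x" using slot_param[of i x \<eta> s] a by auto
  obtain d where d: "is_gap i t \<eta> d" "other_end (i, x, \<eta>, s) = (i, g i (t + of_int \<eta> * d), -\<eta>, s)"
    using other_end_ex[OF a[unfolded ax] t] by auto
  then show ?thesis using a by (auto simp: slots_def is_gap_def)
qed

lemma tope_outside [simp]: "k \<notin> {1..n} \<Longrightarrow> tope a k = 0"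
  unfolding tope_def by (cases a) auto

text \<open>Both ends read their signs at the midpoint of the edge, \<open>d/2\<close> away from
  either vertex.\<close>

lemma other_end_tope: "a \<in> slots \<Longrightarrow> tope (other_end a) = tope a"
proof -
  assume a: "a \<in> slots"
  obtain i x \<eta> s where ax [simp]: "a = (i, x, \<eta>, s)" by (cases a)
  have i: "i \<in> {1..n}" "\<eta> \<in> {-1,1}" using a by (auto simp: slots_def)
  obtain t where t: "g i t = x" using slot_param[of i x \<eta> s] a by auto
  obtain d where d: "is_gap i t \<eta> d" "other_end a = (i, g i (t + of_int \<eta> * d), -\<eta>, s)"
    using other_end_ex[OF a[unfolded ax] t] by auto
  have d0: "0 < d" "d < 1" using d by (auto simp: is_gap_def)
  show ?thesis
  proof
    fix k
    consider "k \<notin> {1..n}" | "k = i" | "k \<in> {1..n}" "k \<noteq> i" by blast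
    then show "tope (other_end a) k = tope a k"
    proof cases
      case 1 then show ?thesis by simp
    next
      case 2 then show ?thesis unfolding d(2) by (simp add: tope_def)
    next
      case 3
      have "tope (i, x, \<eta>, s) k = \<sigma> k (g i (t + of_int \<eta> * (d/2)))"
        by (rule tope_dart) (use 3 i t d0 d(1) in \<open>auto simp: is_gap_def\<close>)
      moreover have "tope (i, g i (t + of_int \<eta> * d), -\<eta>, s) k
        = \<sigma> k (g i (t + of_int \<eta> * d + of_int (-\<eta>) * (d/2)))"
      proof (rule tope_dart)
        fix e' assume "0 < e'" "e' \<le> d/2"
        then have "\<sigma> k (g i (t + of_int \<eta> * (d - e'))) \<noteq> 0" using d(1) 3 d0 by (auto simp: is_gap_def)
        then show "\<sigma> k (g i (t + of_int \<eta> * d + of_int (-\<eta>) * e')) \<noteq> 0" by (simp add: algebra_simps)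
      qed (use 3 i d0 in auto)
      ultimately show ?thesis unfolding d(2) by (simp add: algebra_simps)
    qed
  qed
qed

lemma other_end_involution: "a \<in> slots \<Longrightarrow> other_end (other_end a) = a"
proof -
  assume a: "a \<in> slots"
  obtain i x \<eta> s where ax [simp]: "a = (i, x, \<eta>, s)" by (cases a)
  have i: "i \<in> {1..n}" "\<eta> \<in> {-1,1}" "x \<in> vertices" using a by (auto simp: slots_def)
  obtain t where t: "g i t = x" using slot_param[of i x \<eta> s] a by auto
  obtain d where d: "is_gap i t \<eta> d" "other_end a = (i, g i (t + of_int \<eta> * d), -\<eta>, s)"
    using other_end_ex[OF a[unfolded ax] t] by auto
  have "other_end (i, g i (t + of_int \<eta> * d), -\<eta>, s)
     = (i, g i (t + of_int \<eta> * d + of_int (-\<eta>) * d), -(-\<eta>), s)"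
  proof (rule other_end_eq)
    show "(i, g i (t + of_int \<eta> * d), -\<eta>, s) \<in> slots" using other_end_slot[OF a] d by simp
    show "is_gap i (t + of_int \<eta> * d) (- \<eta>) d" using gap_reverse i t d by blast
  qed simp
  then show ?thesis using d t by simp
qed

lemma other_end_line [simp]: "line_of (other_end a) = line_of a"
  by (cases a) (simp add: other_end_def)

lemma other_end_ne: "a \<in> slots \<Longrightarrow> other_end a \<noteq> a"
  by (cases a) (auto simp: other_end_def slots_def)

lemma common_vertex_Ints:
  assumes "i \<in> {1..n}" "j \<in> {1..n}" "i \<noteq> j" "\<sigma> j (g i s) = 0" "\<sigma> j (g i t) = 0"
  shows "t - s \<in> \<int>"
  using cross_Ints assms by blast

text \<open>Two curves meet only at parameters that differ by an integer, while an edge is shorter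
  than 1. This is what makes faces at least triangles.\<close>

lemma other_end_not_common:
  assumes a: "a \<in> slots" and j: "j \<in> {1..n}" "j \<noteq> line_of a" "\<sigma> j (vertex_of a) = 0"
  shows "\<sigma> j (vertex_of (other_end a)) \<noteq> 0"
proof -
  obtain i x \<eta> s where ax [simp]: "a = (i, x, \<eta>, s)" by (cases a)
  have i: "i \<in> {1..n}" "\<eta> \<in> {-1,1}" "x \<in> vertices" using a by (auto simp: slots_def)
  obtain t where t: "g i t = x" using slot_param[of i x \<eta> s] a by auto
  obtain d where d: "is_gap i t \<eta> d" "other_end a = (i, g i (t + of_int \<eta> * d), -\<eta>, s)"
    using other_end_ex[OF a[unfolded ax] t] by auto
  have "of_int \<eta> * d \<notin> \<int>" using d i not_Ints_between[of d] by (auto simp: is_gap_def)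
  then show ?thesis using cross_Ints[of i j t "t + of_int \<eta> * d"] d j i t by auto
qed

lemma turn_ex:
  assumes "a \<in> slots"
  shows "\<exists>b\<in>slots. line_of b \<noteq> line_of a \<and> vertex_of b = vertex_of a \<and> tope b = tope a"
proof -
  obtain i x \<eta> s where ax [simp]: "a = (i, x, \<eta>, s)" by (cases a)
  have i: "i \<in> {1..n}" "\<eta> \<in> {-1,1}" "x \<in> vertices" "\<sigma> i x = 0" "s \<in> {-1,1}"
    using assms by (auto simp: slots_def)
  obtain j \<eta>' where j: "j \<in> {1..n}" "j \<noteq> i" "\<sigma> j x = 0" "\<eta>' \<in> {-1,1}" "\<eta>' * cs i j x = s"
    "\<And>k. k\<in>{1..n} \<Longrightarrow> k \<noteq> i \<Longrightarrow> k \<noteq> j \<Longrightarrow> \<sigma> k x = 0 \<Longrightarrow> \<eta>' * cs k j x = \<eta> * cs k i x"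
    using sector[of i x \<eta> s] vertexD i by metis
  \<comment> \<open>The new slot lies on that side of \<open>j\<close> into which the dart of
    \<open>a\<close> points; \<open>sector\<close> makes all remaining signs agree.\<close>
  define b where "b = (j, x, \<eta>', \<eta> * cs j i x)"
  have "\<eta> * cs j i x \<in> {-1,1}" using cs_values[of i j x] i j by auto
  then have "b \<in> slots" using i j by (auto simp: slots_def b_def)
  moreover have "tope b = tope a"
  proof
    fix k
    show "tope b k = tope a k" using i j by (auto simp: tope_def b_def)
  qed
  ultimately show ?thesis using j by (intro bexI[of _ b]) (auto simp: b_def)
qed

definition turn :: "'a slot \<Rightarrow> 'a slot" where
  "turn a = (SOME b. b \<in> slots \<and> line_of b \<noteq> line_of a \<and> vertex_of b = vertex_of a \<and> tope b = tope a)"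

lemma turn:
  assumes "a \<in> slots"
  shows "turn a \<in> slots" "line_of (turn a) \<noteq> line_of a" "vertex_of (turn a) = vertex_of a"
    "tope (turn a) = tope a"
  unfolding turn_def using someI_ex[of "\<lambda>b. b \<in> slots \<and> line_of b \<noteq> line_of a \<and>
      vertex_of b = vertex_of a \<and> tope b = tope a"]
    turn_ex[OF assms] by blast+

text \<open>The crossings of two curves form one residue class modulo 1, hence at most two points
  modulo the period 2.\<close>

lemma finite_vertices: "finite vertices"
proof -
  have "\<exists>B. finite B \<and> (\<forall>x. \<sigma> i x = 0 \<longrightarrow> \<sigma> j x = 0 \<longrightarrow> x \<in> B)" if ij: "i \<in> {1..n}" "j \<in> {1..n}" "i \<noteq> j" for i j
  proof -
    obtain b where b: "\<And>t. \<sigma> j (g i t) = 0 \<longleftrightarrow> t - b \<in> \<int>" using cross[OF ij] by blast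
    have "x \<in> {g i b, g i (b + 1)}" if x: "\<sigma> i x = 0" "\<sigma> j x = 0" for x
    proof -
      obtain t where t: "x = g i t" using sign_zero x ij by blast
      then obtain z where z: "t - b = of_int z" using b x by (auto elim: Ints_cases)
      consider m where "z = 2 * m" | m where "z = 2 * m + 1" by (meson evenE oddE)
      then show ?thesis
      proof cases
        case 1
        then have "g i t = g i b" using period[of i t b] z ij by auto
        then show ?thesis using t by simp
      next
        case 2
        then have "t - (b + 1) = 2 * of_int m" using z by simp
        then have "g i t = g i (b + 1)" using period[of i t "b+1"] ij by auto
        then show ?thesis using t by simp
      qed
    qed
    then show ?thesis by (intro exI[of _ "{g i b, g i (b + 1)}"]) auto
  qed
  then obtain B where B: "\<And>i j. i \<in> {1..n} \<Longrightarrow> j \<in> {1..n} \<Longrightarrow> i \<noteq> j \<Longrightarrow> finite (B i j) \<and> (\<forall>x. \<sigma> i x = 0 \<longrightarrow>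
      \<sigma> j x = 0 \<longrightarrow> x \<in> B i j)"
    by metis
  have "vertices \<subseteq> (\<Union>i\<in>{1..n}. \<Union>j\<in>{1..n}-{i}. B i j)"
  proof
    fix x assume x: "x \<in> vertices"
    obtain i where i: "i \<in> {1..n}" "\<sigma> i x = 0" using vertexD[OF x] by blast
    obtain j where j: "j \<in> {1..n}" "j \<noteq> i" "\<sigma> j x = 0" using vertexD[OF x, of i] by blast
    then show "x \<in> (\<Union>i\<in>{1..n}. \<Union>j\<in>{1..n}-{i}. B i j)" using B[of i j] i by blast
  qed
  then show ?thesis by (rule finite_subset) (use B in auto)
qed

lemma slots_eq: "slots = (\<lambda>((x, i), \<eta>, s). (i, x, \<eta>, s)) ` ((SIGMA x:vertices. lines_at x) \<times> ({-1,1} \<times>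
    {-1,1}))"
  by (force simp: slots_def lines_at_def)

lemma finite_slots: "finite slots"
  unfolding slots_eq using finite_vertices by (intro finite_imageI finite_cartesian_product
      finite_SigmaI) auto

text \<open>Per curve through a vertex, two directions times two sides. Counted from the edges, each
  edge gives four slots as well: two ends times two sides.\<close>

lemma card_slots: "card slots = 4 * (\<Sum>x\<in>vertices. card (lines_at x))"
proof -
  have "card slots = card ((SIGMA x:vertices. lines_at x) \<times> ({-1,1::int} \<times> {-1,1::int}))"
    unfolding slots_eq by (intro card_image inj_onI) auto
  then show ?thesis by (simp add: card_cartesian_product card_SigmaI finite_vertices)
qed

lemma card_slots_simple:
  "card {a \<in> slots. card (lines_at (vertex_of a)) = 2} = 8 * card {x \<in> vertices. card (lines_at x) = 2}"
proof -
  have "{a \<in> slots. card (lines_at (vertex_of a)) = 2} = (\<lambda>((x, i), \<eta>, s). (i, x, \<eta>, s)) `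
     ((SIGMA x:{x \<in> vertices. card (lines_at x) = 2}. lines_at x) \<times> ({-1,1} \<times> {-1,1}))"
    by (force simp: slots_def lines_at_def)
  then have "card {a \<in> slots. card (lines_at (vertex_of a)) = 2}
     = card ((SIGMA x:{x \<in> vertices. card (lines_at x) = 2}. lines_at x) \<times> ({-1,1::int} \<times> {-1,1::int}))"
    by (simp only:) (intro card_image inj_onI, auto)
  then show ?thesis by (simp add: card_cartesian_product card_SigmaI finite_vertices)
qed

definition topes :: "(nat \<Rightarrow> int) set" where "topes = tope ` slots"

lemma finite_topes: "finite topes" by (simp add: topes_def finite_slots)

text \<open>Each boundary edge is counted once per end, so cardinality 6 stands for a triangle and 8
  for a quadrilateral.\<close>

definition boundary :: "(nat \<Rightarrow> int) \<Rightarrow> ('a slot) set" where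
  "boundary T = {a \<in> slots. tope a = T}"

lemma finite_boundary [simp]: "finite (boundary T)" by (simp add: boundary_def finite_slots)

text \<open>The edge of \<open>a\<close> and the edges that follow it at its two ends, each with
  both of its slots.\<close>

definition six :: "'a slot \<Rightarrow> ('a slot) set" where
  "six a = {a, turn a, other_end a, turn (other_end a), other_end (turn a), other_end (turn (other_end a))}"

lemma slot_line: "a \<in> slots \<Longrightarrow> line_of a \<in> {1..n}" "a \<in> slots \<Longrightarrow> \<sigma> (line_of a) (vertex_of a) = 0"
  by (auto simp: slots_def)

text \<open>Otherwise a second curve would pass through both ends of the edge, against
  \<open>other_end_not_common\<close>. Hence the three edges in \<open>six\<close> lie on three
  different curves.\<close>

lemma far_line_ne:
  assumes a: "a \<in> slots"
  shows "line_of (turn a) \<noteq> line_of (turn (other_end a))"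
proof
  assume eq: "line_of (turn a) = line_of (turn (other_end a))"
  have o: "other_end a \<in> slots" using other_end_slot a .
  have "\<sigma> (line_of (turn a)) (vertex_of (other_end a)) \<noteq> 0"
    by (rule other_end_not_common[OF a]) (use turn[OF a] slot_line in \<open>metis\<close>)+
  moreover have "\<sigma> (line_of (turn (other_end a))) (vertex_of (other_end a)) = 0"
    using turn[OF o] slot_line by metis
  ultimately show False using eq by simp
qed

lemma six_boundary:
  assumes a: "a \<in> slots" shows "six a \<subseteq> boundary (tope a)"
proof -
  have o: "other_end a \<in> slots" "tope (other_end a) = tope a" using other_end_slot other_end_tope a by auto
  have r: "turn a \<in> slots" "tope (turn a) = tope a" using turn[OF a] by auto
  have ro: "turn (other_end a) \<in> slots" "tope (turn (other_end a)) = tope a" using turn[OF o(1)] o by auto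
  show ?thesis using a o r ro other_end_slot other_end_tope unfolding six_def boundary_def by auto
qed

lemma card_six:
  assumes a: "a \<in> slots" shows "card (six a) = 6"
proof -
  have o: "other_end a \<in> slots" using other_end_slot a by auto
  have r: "turn a \<in> slots" using turn[OF a] by auto
  have ro: "turn (other_end a) \<in> slots" using turn[OF o(1)] o by auto
  have l: "line_of (turn a) \<noteq> line_of a" "line_of (turn (other_end a)) \<noteq> line_of a"
    "line_of (turn a) \<noteq> line_of (turn (other_end a))"
    using turn[OF a] turn[OF o] far_line_ne[OF a] by auto
  have n: "other_end a \<noteq> a" "other_end (turn a) \<noteq> turn a" "other_end (turn (other_end a)) \<noteq> turn
      (other_end a)"
    using other_end_ne a r ro by auto
  have "distinct [a, turn a, other_end a, turn (other_end a), other_end (turn a), other_end (turn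
      (other_end a))]"
    by (unfold distinct.simps list.set, simp only: insert_iff empty_iff de_Morgan_disj simp_thms, intro
        conjI)
      (metis l n other_end_line)+
  then have "card (set [a, turn a, other_end a, turn (other_end a), other_end (turn a), other_end (turn
      (other_end a))]) = 6"
    by (subst distinct_card) auto
  then show ?thesis by (simp add: six_def)
qed

lemma card_boundary_ge: "T \<in> topes \<Longrightarrow> card (boundary T) \<ge> 6"
  using card_six six_boundary card_mono[OF finite_boundary] unfolding topes_def by (metis imageE)

text \<open>\<open>other_end\<close> preserves the face and reverses the direction
  \<open>\<eta>\<close>, so it matches the slots of direction 1 with those of direction -1.\<close>

lemma even_card_boundary: "even (card (boundary T))"
proof -
  define P where "P e = {a \<in> boundary T. fst (snd (snd a)) = e}" for e :: int
  have dir: "fst (snd (snd (other_end a))) = - fst (snd (snd a))" for a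
    by (cases a) (simp add: other_end_def)
  have "bij_betw other_end (P 1) (P (-1))"
  proof (rule bij_betw_byWitness[where f' = other_end])
    show "\<forall>a\<in>P 1. other_end (other_end a) = a" "\<forall>a\<in>P (-1). other_end (other_end a) = a"
      using other_end_involution by (auto simp: P_def boundary_def)
    show "other_end ` P 1 \<subseteq> P (-1)" "other_end ` P (-1) \<subseteq> P 1"
      using other_end_slot other_end_tope dir by (auto simp: P_def boundary_def)
  qed
  then have "card (P 1) = card (P (-1))" by (rule bij_betw_same_card)
  moreover have "boundary T = P 1 \<union> P (-1)" by (auto simp: P_def boundary_def slots_def)
  moreover have "card (P 1 \<union> P (-1)) = card (P 1) + card (P (-1))"
    by (rule card_Un_disjoint) (auto simp: P_def)
  ultimately show ?thesis by simp
qed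

text \<open>The counted slots are grouped by their topes; the hypothesis on \<open>R\<close> ensures
  that only faces without counted slots are left out of the sum.\<close>

lemma sum_boundary:
  assumes "\<And>a. a \<in> slots \<Longrightarrow> Q a \<Longrightarrow> R (tope a)"
  shows "(\<Sum>T\<in>{T\<in>topes. R T}. card {a \<in> boundary T. Q a}) = card {a \<in> slots. Q a}"
proof -
  have "(\<Sum>T\<in>{T\<in>topes. R T}. sum (\<lambda>_. 1::nat) {a \<in> {a \<in> slots. Q a}. tope a = T}) = sum (\<lambda>_. 1) {a \<in>
      slots. Q a}"
    by (rule sum.group) (use assms finite_slots finite_topes in \<open>auto simp: topes_def\<close>)
  moreover have "{a \<in> {a \<in> slots. Q a}. tope a = T} = {a \<in> boundary T. Q a}" for T
      by (auto simp: boundary_def)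
  ultimately show ?thesis by simp
qed

lemma sum_card_boundary: "(\<Sum>T\<in>topes. card (boundary T)) = card slots"
  using sum_boundary[of "\<lambda>_. True" "\<lambda>_. True"] by simp

text \<open>The familiar 3 F \<le> 2 E, as there are four slots per edge.\<close>

lemma melchior_topes: "6 * card topes \<le> card slots"
proof -
  have "(\<Sum>T\<in>topes. 6) \<le> (\<Sum>T\<in>topes. card (boundary T))" by (intro sum_mono card_boundary_ge)
  then show ?thesis using sum_card_boundary by simp
qed

section \<open>A lower bound for the number of faces\<close>

definition truncate :: "nat \<Rightarrow> (nat \<Rightarrow> int) \<Rightarrow> nat \<Rightarrow> int" where
  "truncate m T = (\<lambda>k. if k \<le> m then T k else 0)"

definition new_vertices :: "nat \<Rightarrow> 'a set" where
  "new_vertices m = {x \<in> vertices. \<sigma> m x = 0 \<and> (\<exists>j\<in>{1..<m}. \<sigma> j x = 0)}"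

lemma tope_values: "a \<in> slots \<Longrightarrow> k \<in> {1..n} \<Longrightarrow> tope a k \<in> {-1, 1}"
proof -
  assume a: "a \<in> slots" and k: "k \<in> {1..n}"
  obtain i x \<eta> s where ax: "a = (i, x, \<eta>, s)" by (cases a)
  have i: "i \<in> {1..n}" "\<sigma> i x = 0" "\<eta> \<in> {-1,1}" "s \<in> {-1,1}" using a ax by (auto simp: slots_def)
  have "k \<noteq> i \<Longrightarrow> \<sigma> k x = 0 \<Longrightarrow> cs k i x \<in> {-1,1}" using cs_values i k by blast
  moreover have "\<sigma> k x \<in> {-1,0,1}" by (rule sign_range)
  ultimately show ?thesis using i k ax unfolding tope_def by auto
qed

text \<open>Curve \<open>j\<close> passes through \<open>y\<close>, so its sign along
  \<open>m\<close> changes there, and its preceding crossing with \<open>m\<close> is a full unit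
  earlier, at or before \<open>t\<close>. So the edge leaving \<open>x\<close> sees the sign before
  \<open>y\<close>, and the edge leaving \<open>y\<close> the sign after it.\<close>

lemma truncate_distinct:
  assumes m: "m \<in> {1..n}" and t: "g m t = x" "g m t' = y" "t < t'" "t' \<le> t + 1"
    and j: "j \<in> {1..<m}" "\<sigma> j y = 0"
  shows "tope (m, x, 1, s) j \<noteq> tope (m, y, 1, s') j"
proof -
  have j': "j \<in> {1..n}" "j \<noteq> m" using j m by auto
  have y: "tope (m, y, 1, s') j = \<sigma> j (g m (t' + 1/2))"
    using cs_eq[of m j y t' "1/2"] m j j' t by (simp add: tope_def)
  have nz: "\<sigma> j (g m (t' + 1/2)) \<noteq> 0"
    using cross_Ints[of m j t' "t' + 1/2"] m j j' t not_Ints_between[of "1/2"] by simp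
  have b: "\<sigma> j (g m (t' - 1/2)) = - \<sigma> j (g m (t' + 1/2))"
    using sign_before[of m j t' "1/2" "1/2"] m j j' t by simp
  have "tope (m, x, 1, s) j = \<sigma> j (g m (t' - 1/2))"
  proof (cases "\<sigma> j x = 0")
    case True
    then have "t' - t \<in> \<int>" using common_vertex_Ints[of m j t t'] m j j' t by simp
    then have "t' = t + 1" using t not_Ints_between[of "t' - t"] by fastforce
    then show ?thesis using cs_eq[of m j x t "1/2"] m j j' t True by (simp add: tope_def add.commute)
  next
    case False
    have "t' \<noteq> t + 1" using cross_Ints[of m j t' t] False m j j' t by auto
    then have d: "0 < t' - t" "t' - t < 1" using t by auto
    have "\<sigma> j (g m (t' - (t' - t))) = - \<sigma> j (g m (t' + 1/2))"
      by (rule sign_before) (use m j j' t d in auto)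
    then show ?thesis using False b m j j' t by (simp add: tope_def)
  qed
  then show ?thesis using y nz b by simp
qed

lemma inj_truncate_tope:
  assumes m: "m \<in> {1..n}"
  shows "inj_on (\<lambda>x. truncate (m - 1) (tope (m, x, 1, 1))) (new_vertices m)"
proof (rule inj_onI, rule ccontr)
  fix x y assume x: "x \<in> new_vertices m" and y: "y \<in> new_vertices m" and ne: "x \<noteq> y"
    and eq: "truncate (m - 1) (tope (m, x, 1, 1)) = truncate (m - 1) (tope (m, y, 1, 1))"
  have eq': "tope (m, x, 1, 1) j = tope (m, y, 1, 1) j" if "j \<in> {1..<m}" for j
  proof -
    have "j \<le> m - 1" using that by auto
    then show ?thesis using fun_cong[OF eq, of j] by (simp add: truncate_def)
  qed
  obtain jx where jx: "jx \<in> {1..<m}" "\<sigma> jx x = 0" using x by (auto simp: new_vertices_def)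
  obtain jy where jy: "jy \<in> {1..<m}" "\<sigma> jy y = 0" using y by (auto simp: new_vertices_def)
  define t where "t = par m x"
  define t' where "t' = par m y"
  have t: "g m t = x" "g m t' = y" using param[OF m] x y by (auto simp: new_vertices_def t_def t'_def)
  \<comment> \<open>The forward distance from \<open>x\<close> to \<open>y\<close> on a closed curve
    of length 2. One of the two arcs between them has length at most 1, and
    \<open>truncate_distinct\<close> applies either to the arc from \<open>x\<close> to
    \<open>y\<close> or to the one from \<open>y\<close> back to \<open>x\<close>.\<close>
  define r where "r = 2 * frac ((t' - t) / 2)"
  have r: "0 \<le> r" "r < 2" using frac_ge_0[of "(t'-t)/2"] frac_lt_1[of "(t'-t)/2"] by (auto simp: r_def)
  have "t + r - t' = 2 * of_int (- \<lfloor>(t' - t) / 2\<rfloor>)" by (simp add: r_def frac_def field_simps)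
  then have u: "g m (t + r) = y" using period[OF m, of "t + r" t'] t by metis
  have "r \<noteq> 0" using u t ne by auto
  have x2: "g m (t + 2) = x" using period[OF m, of "t + 2" t] t
      by (metis add_diff_cancel_left' mult.right_neutral of_int_1)
  show False
  proof (cases "r \<le> 1")
    case True
    then show False using truncate_distinct[OF m t(1) u, of jy 1 1] eq' jy r \<open>r \<noteq> 0\<close> by auto
  next
    case False
    then show False using truncate_distinct[OF m u x2, of jx 1 1] eq' jx r by auto
  qed
qed

lemma truncate_tope_upd:
  assumes "m \<in> {1..n}"
  shows "truncate m (tope (m, x, \<eta>, s)) = (truncate (m - 1) (tope (m, x, \<eta>, 1)))(m := s)"
  using assms by (auto simp: truncate_def tope_def fun_eq_iff)

text \<open>Forgetting the sign at \<open>m\<close> lowers the number of vectors by the number of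
  those that extend with both signs, by inclusion-exclusion. The set \<open>E\<close> names some of
  these.\<close>

lemma card_truncate_step:
  assumes m: "m \<in> {1..n}"
    and E: "\<And>f. f \<in> E \<Longrightarrow> f m = 0 \<and> f(m := 1) \<in> truncate m ` topes \<and> f(m := -1) \<in> truncate m ` topes"
  shows "card (truncate (m - 1) ` topes) + card E \<le> card (truncate m ` topes)"
proof -
  define A where "A s = {f \<in> truncate m ` topes. f m = s}" for s
  define z where "z f = f(m := 0::int)" for f :: "nat \<Rightarrow> int"
  have fin: "finite (truncate m ` topes)" "finite (A s)" for s using finite_topes by (auto simp: A_def)
  have "f m \<in> {-1, 1}" if f: "f \<in> truncate m ` topes" for f
  proof -
    obtain a where "a \<in> slots" "f = truncate m (tope a)" using f unfolding topes_def by blast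
    then show ?thesis using tope_values[of a m] m by (simp add: truncate_def)
  qed
  then have un: "truncate m ` topes = A 1 \<union> A (-1)" by (auto simp: A_def)
  have card: "card (truncate m ` topes) = card (A 1) + card (A (-1))"
    unfolding un by (rule card_Un_disjoint) (use fin in \<open>auto simp: A_def\<close>)
  have inj: "inj_on z (A s)" for s
  proof (rule inj_onI)
    fix f h assume f: "f \<in> A s" "h \<in> A s" "z f = z h"
    then have "(z f)(m := s) = (z h)(m := s)" by simp
    moreover have "f m = s" "h m = s" using f by (auto simp: A_def)
    then have "(z f)(m := s) = f" "(z h)(m := s) = h" by (auto simp: z_def)
    ultimately show "f = h" by simp
  qed
  have "truncate (m - 1) T = z (truncate m T)" for T using m by (auto simp: truncate_def z_def fun_eq_iff)
  then have "truncate (m - 1) ` topes = z ` truncate m ` topes" by (auto simp: image_image)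
  then have zu: "truncate (m - 1) ` topes = z ` A 1 \<union> z ` A (-1)" unfolding un image_Un .
  have "E \<subseteq> z ` A 1 \<inter> z ` A (-1)"
  proof
    fix f assume f: "f \<in> E"
    have "f = z (f(m := 1))" "f = z (f(m := -1))" using E[OF f] by (auto simp: z_def)
    moreover have "f(m := 1) \<in> A 1" "f(m := -1) \<in> A (-1)" using E[OF f] by (auto simp: A_def)
    ultimately show "f \<in> z ` A 1 \<inter> z ` A (-1)" by blast
  qed
  then have "card E \<le> card (z ` A 1 \<inter> z ` A (-1))" by (intro card_mono) (use fin in auto)
  moreover have "card (z ` A 1) + card (z ` A (-1)) = card (z ` A 1 \<union> z ` A (-1)) + card (z ` A 1 \<inter> z `
      A (-1))"
    by (rule card_Un_Int) (use fin in auto)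
  ultimately show ?thesis unfolding zu using card by (simp add: card_image[OF inj])
qed

lemma slot_forward: "m \<in> {1..n} \<Longrightarrow> x \<in> vertices \<Longrightarrow> \<sigma> m x = 0 \<Longrightarrow> s \<in> {-1,1} \<Longrightarrow> (m, x, 1, s) \<in> slots"
  by (auto simp: slots_def)

text \<open>Curve \<open>m\<close> is closed, so its new vertices cut it into as many arcs, and each
  arc splits an old face in two. An arc is represented by its first edge in forward
  direction.\<close>

lemma card_truncate_new:
  assumes m: "m \<in> {1..n}"
  shows "card (truncate (m - 1) ` topes) + card (new_vertices m) \<le> card (truncate m ` topes)"
proof -
  let ?g = "\<lambda>x. truncate (m - 1) (tope (m, x, 1, 1))"
  have "card (truncate (m - 1) ` topes) + card (?g ` new_vertices m) \<le> card (truncate m ` topes)"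
  proof (rule card_truncate_step[OF m])
    fix f assume "f \<in> ?g ` new_vertices m"
    then obtain x where x: "x \<in> new_vertices m" "f = ?g x" by blast
    have "truncate m (tope (m, x, 1, s)) \<in> truncate m ` topes" if "s \<in> {-1,1}" for s
      using slot_forward[OF m _ _ that] x(1) by (auto simp: new_vertices_def topes_def)
    then show "f m = 0 \<and> f(m := 1) \<in> truncate m ` topes \<and> f(m := -1) \<in> truncate m ` topes"
      using x(2) m unfolding truncate_tope_upd[OF m] by (auto simp: truncate_def)
  qed
  then show ?thesis unfolding card_image[OF inj_truncate_tope[OF m]] .
qed

lemma n_pos: "1 \<in> {1..n}"
  using not_concurrent[of undefined] by auto

lemma line_has_vertex:
  assumes i: "i \<in> {1..n}" shows "\<exists>x\<in>vertices. \<sigma> i x = 0"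
proof -
  obtain k where k: "k \<in> {1..n}" "\<sigma> k (g i 0) \<noteq> 0" using not_concurrent by blast
  then have ki: "k \<noteq> i" using i by auto
  obtain b where "\<And>t. \<sigma> k (g i t) = 0 \<longleftrightarrow> t - b \<in> \<int>" using cross[OF i k(1)] ki by blast
  then have "\<sigma> k (g i b) = 0" by simp
  then have "g i b \<in> vertices" using vertexI[of i k] i k ki by simp
  then show ?thesis using i by (intro bexI[of _ "g i b"]) simp_all
qed

lemma card_truncate_topes:
  "1 \<le> m \<Longrightarrow> m \<le> n \<Longrightarrow> 2 + (\<Sum>k=1..m. card (new_vertices k)) \<le> card (truncate m ` topes)"
proof (induction m rule: nat_induct_at_least)
  case base
  obtain x where x: "x \<in> vertices" "\<sigma> 1 x = 0" using line_has_vertex[OF n_pos] by blast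
  have sl: "(1, x, 1, s) \<in> slots" if "s \<in> {-1,1}" for s using slot_forward[OF n_pos x that] .
  have c0: "truncate 0 T = (\<lambda>_. 0)" if "T \<in> topes" for T using that by (auto simp: truncate_def topes_def)
  have "tope (1, x, 1, 1) \<in> topes" using sl by (auto simp: topes_def)
  then have c: "truncate 0 ` topes = {\<lambda>_. 0}" using c0 by (intro set_eqI iffI) (force simp: image_iff)+
  \<comment> \<open>Without curves the zero vector is the only face; any vertex on curve 1 shows
    that both of its signs occur. This gives the 2 in the bound.\<close>
  have "card (truncate (1 - 1) ` topes) + card {\<lambda>_::nat. 0::int} \<le> card (truncate 1 ` topes)"
  proof (rule card_truncate_step[OF n_pos])
    fix f :: "nat \<Rightarrow> int" assume f: "f \<in> {\<lambda>_. 0}"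
    have "f(1 := s) = truncate 1 (tope (1, x, 1, s))" if "s \<in> {-1,1}" for s
      using f n_pos by (auto simp: truncate_def tope_def fun_eq_iff)
    moreover have "tope (1, x, 1, s) \<in> topes" if "s \<in> {-1,1}" for s using sl[OF that]
        by (auto simp: topes_def)
    ultimately show "f 1 = 0 \<and> f(1 := 1) \<in> truncate 1 ` topes \<and> f(1 := -1) \<in> truncate 1 ` topes"
      using f by auto
  qed
  moreover have "new_vertices 1 = {}" by (auto simp: new_vertices_def)
  ultimately show ?case using c by simp
next
  case (Suc m)
  have "card (truncate (Suc m - 1) ` topes) + card (new_vertices (Suc m)) \<le> card (truncate (Suc m) ` topes)"
    by (rule card_truncate_new) (use Suc in auto)
  then show ?case using Suc by simp
qed

text \<open>At a vertex of weight w every curve but the one of least index finds an earlier curve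
  there, so the vertex is new w - 1 times.\<close>

lemma card_topes_ge: "2 + (\<Sum>x\<in>vertices. card (lines_at x) - 1) \<le> card topes"
proof -
  have "truncate n T = T" if "T \<in> topes" for T using that by (auto simp: truncate_def topes_def fun_eq_iff)
  then have "truncate n ` topes = topes" by force
  moreover have "2 + (\<Sum>k=1..n. card (new_vertices k)) \<le> card (truncate n ` topes)"
    using card_truncate_topes[of n] n_pos by simp
  moreover have "(\<Sum>k=1..n. card {x \<in> vertices. \<sigma> k x = 0 \<and> (\<exists>j\<in>{1..<k}. \<sigma> j x = 0)})
      = (\<Sum>x\<in>vertices. card (lines_at x) - 1)"
  proof (rule sum_multicount_gen[OF _ finite_vertices], simp, intro ballI)
    fix x assume x: "x \<in> vertices"
    then have ne: "lines_at x \<noteq> {}" by (auto simp: vertices_def)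
    let ?m = "Min (lines_at x)"
    have m: "?m \<in> lines_at x" "\<And>j. j \<in> lines_at x \<Longrightarrow> ?m \<le> j" using ne by auto
    have "{k \<in> {1..n}. \<sigma> k x = 0 \<and> (\<exists>j\<in>{1..<k}. \<sigma> j x = 0)} = lines_at x - {?m}"
    proof (intro set_eqI iffI)
      fix k assume "k \<in> {k \<in> {1..n}. \<sigma> k x = 0 \<and> (\<exists>j\<in>{1..<k}. \<sigma> j x = 0)}"
      then obtain j where k: "k \<in> {1..n}" "\<sigma> k x = 0" "j \<in> {1..<k}" "\<sigma> j x = 0" by blast
      then have "j \<in> lines_at x" by (auto simp: lines_at_def)
      then have "?m \<le> j" using m by blast
      then have "k \<noteq> ?m" using k by auto
      then show "k \<in> lines_at x - {?m}" using k by (simp add: lines_at_def)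
    next
      fix k assume k: "k \<in> lines_at x - {?m}"
      then have "?m < k" using m(2)[of k] by (simp add: order_less_le)
      then show "k \<in> {k \<in> {1..n}. \<sigma> k x = 0 \<and> (\<exists>j\<in>{1..<k}. \<sigma> j x = 0)}"
        using k m(1) unfolding lines_at_def by auto
    qed
    then show "card {k \<in> {1..n}. \<sigma> k x = 0 \<and> (\<exists>j\<in>{1..<k}. \<sigma> j x = 0)} = card (lines_at x) - 1"
      using m(1) by simp
  qed
  ultimately show ?thesis by (simp add: new_vertices_def)
qed

section \<open>Triangles and double points\<close>

lemma other_end_vertex_ne: "a \<in> slots \<Longrightarrow> vertex_of (other_end a) \<noteq> vertex_of a"
proof
  assume a: "a \<in> slots" and eq: "vertex_of (other_end a) = vertex_of a"
  obtain i x \<eta> s where "a = (i, x, \<eta>, s)" by (cases a)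
  then have "vertex_of a \<in> vertices" using a by (auto simp: slots_def)
  then obtain j where "j \<in> {1..n}" "j \<noteq> line_of a" "\<sigma> j (vertex_of a) = 0" using vertexD by blast
  then show False using other_end_not_common[OF a] eq by simp
qed

text \<open>Along the edge of \<open>a\<close>, around its far end, and along the next edge. In a
  triangle this slot sits at the vertex opposite to the edge of \<open>a\<close>.\<close>

abbreviation third :: "'a slot \<Rightarrow> 'a slot" where
  "third a \<equiv> other_end (turn (other_end a))"

lemma triangle_boundary:
  assumes a: "a \<in> slots" and tri: "card (boundary (tope a)) = 6"
  shows "boundary (tope a) = six a"
  by (rule card_subset_eq[OF finite_boundary six_boundary[OF a], symmetric]) (simp add: card_six[OF a] tri)

text \<open>The face has no slots besides \<open>six a\<close>, so turning at \<open>third a\<close>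
  must give one of them; vertices and lines rule out all but
  \<open>other_end (turn a)\<close>.\<close>

lemma triangle_closes:
  assumes a: "a \<in> slots" and tri: "card (boundary (tope a)) = 6"
  shows "vertex_of (third a) = vertex_of (other_end (turn a))"
proof -
  have o: "other_end a \<in> slots" using other_end_slot a by auto
  note ro = turn[OF o]
  note r = turn[OF a]
  have t: "third a \<in> slots" using other_end_slot ro by auto
  note d = turn[OF t]
  define k where "k = line_of (turn (other_end a))"
  have lt: "line_of (third a) = k" by (simp add: k_def)
  have "tope (turn (third a)) = tope a" using d other_end_tope[OF ro(1)] ro other_end_tope[OF a] by simp
  then have mem: "turn (third a) \<in> six a"
    using triangle_boundary[OF a tri] d(1) by (auto simp: boundary_def)
  have k: "k \<in> {1..n}" "k \<noteq> line_of a" "\<sigma> k (vertex_of (other_end a)) = 0" "\<sigma> k (vertex_of (third a)) = 0"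
    using slot_line[OF ro(1)] slot_line[OF t] ro lt unfolding k_def by auto
  have ne1: "vertex_of (third a) \<noteq> vertex_of a"
    using other_end_not_common[OF a k(1,2)] k by auto
  have ne2: "vertex_of (third a) \<noteq> vertex_of (other_end a)"
    using other_end_vertex_ne[OF ro(1)] ro by simp
  have l: "line_of (turn (third a)) \<noteq> k" using d lt by simp
  from mem consider "turn (third a) = a" | "turn (third a) = turn a" | "turn (third a) = other_end a"
    | "turn (third a) = turn (other_end a)" | "turn (third a) = other_end (turn a)" | "turn (third a) =
        third a"
    unfolding six_def by blast
  then show ?thesis
  proof cases
    case 1 then show ?thesis using ne1 d by simp
  next
    case 2 then show ?thesis using ne1 d r by simp
  next
    case 3 then show ?thesis using ne2 d by simp
  next
    case 4 then show ?thesis using l k_def by simp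
  next
    case 5 then show ?thesis using d by simp
  next
    case 6 then show ?thesis using l lt by simp
  qed
qed

definition simple_slot :: "'a slot \<Rightarrow> bool" where
  "simple_slot a \<longleftrightarrow> card (lines_at (vertex_of a)) = 2"

text \<open>A triangle has two slots at each vertex, and any two of its vertices are joined by an
  edge. So if no edge has double points at both ends, at most one vertex is a double point.\<close>

lemma simple_edge_ex:
  assumes tri: "card (boundary T) = 6" and c: "card {a \<in> boundary T. simple_slot a} > 2"
  shows "\<exists>a\<in>boundary T. simple_slot a \<and> simple_slot (other_end a)"
proof (rule ccontr)
  assume neg: "\<not> ?thesis"
  have "{a \<in> boundary T. simple_slot a} \<noteq> {}" using c by force
  then obtain a where aT: "a \<in> boundary T" "simple_slot a" by blast
  then have a: "a \<in> slots" "tope a = T" by (auto simp: boundary_def)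
  have o: "other_end a \<in> slots" using other_end_slot a by auto
  note r = turn[OF a(1)] and ro = turn[OF o]
  have six: "boundary T = six a" using triangle_boundary a tri by blast
  have rT: "turn a \<in> boundary T" "simple_slot (turn a)" using r a aT
      by (auto simp: boundary_def simple_slot_def)
  have n1: "\<not> simple_slot (other_end a)" using neg aT by blast
  have n2: "\<not> simple_slot (other_end (turn a))" using neg rT by blast
  have n3: "\<not> simple_slot (third a)" using n2 triangle_closes[OF a(1)] a tri by (simp add: simple_slot_def)
  have n4: "\<not> simple_slot (turn (other_end a))" using n1 ro by (simp add: simple_slot_def)
  have "{a \<in> boundary T. simple_slot a} \<subseteq> {a, turn a}" using six n1 n2 n3 n4 by (auto simp: six_def)
  then have "card {a \<in> boundary T. simple_slot a} \<le> card {a, turn a}" by (intro card_mono) auto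
  also have "\<dots> \<le> 2" by (simp add: card_insert_if)
  finally show False using c by simp
qed

lemma flip_slot [simp]: "flip a \<in> slots \<longleftrightarrow> a \<in> slots"
  by (cases a) (auto simp: flip_def slots_def)

lemma flip_flip [simp]: "flip (flip a) = a"
  by (cases a) (simp add: flip_def)

lemma flip_simps [simp]: "line_of (flip a) = line_of a" "vertex_of (flip a) = vertex_of a"
  "other_end (flip a) = flip (other_end a)"
  by (cases a; simp add: flip_def other_end_def)+

lemma turn_simple:
  assumes a: "a \<in> slots" and s: "simple_slot a" and j: "j \<in> lines_at (vertex_of a)" "j \<noteq> line_of a"
  shows "line_of (turn a) = j"
proof (rule ccontr)
  assume ne: "line_of (turn a) \<noteq> j"
  have "line_of (turn a) \<in> lines_at (vertex_of a)" "line_of a \<in> lines_at (vertex_of a)"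
    using slot_line[OF turn(1)[OF a]] slot_line[OF a] turn(3)[OF a] by (auto simp: lines_at_def)
  then have "{line_of a, line_of (turn a), j} \<subseteq> lines_at (vertex_of a)" using j by auto
  then have "card {line_of a, line_of (turn a), j} \<le> card (lines_at (vertex_of a))"
      by (intro card_mono) auto
  moreover have "card {line_of a, line_of (turn a), j} = 3" using ne j turn(2)[OF a] by auto
  ultimately show False using s by (simp add: simple_slot_def)
qed

text \<open>Suppose that the faces on both sides are triangles. At each end of the edge only one
  further curve is available, so both triangles are bounded by \<open>i\<close>, \<open>j\<close>
  and \<open>k\<close>, and both apices are common points of \<open>j\<close> and \<open>k\<close>.
  They turn out to be antipodal: \<open>j\<close> runs from one to the other, half a period, with
  the double point \<open>x\<close> as its only vertex in between. So every curve other than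
  \<open>i\<close> and \<open>j\<close> has to cross \<open>j\<close> at an apex, and all curves but
  \<open>i\<close> are concurrent, against \<open>small\<close>.\<close>

lemma simple_edge_neighbour:
  assumes a: "a \<in> slots" and s: "simple_slot a" "simple_slot (other_end a)"
    and small: "\<And>x. card (lines_at x) + 2 \<le> n"
    and tri: "card (boundary (tope a)) = 6"
  shows "card (boundary (tope (flip a))) \<noteq> 6"
proof
  assume tri': "card (boundary (tope (flip a))) = 6"
  have o: "other_end a \<in> slots" and f: "flip a \<in> slots" using other_end_slot a by auto
  then have fo: "other_end (flip a) \<in> slots" by simp
  obtain i x \<eta> s0 where ax: "a = (i, x, \<eta>, s0)" by (cases a)
  have i: "i \<in> {1..n}" "s0 \<in> {-1,1}" "\<sigma> i x = 0" using a ax by (auto simp: slots_def)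
  note r = turn[OF a] and ro = turn[OF o] and rf = turn[OF f] and rfo = turn[OF fo]
  obtain j \<eta>1 s1 where j: "turn a = (j, x, \<eta>1, s1)" using r(3) ax by (cases "turn a") auto
  have jj: "j \<in> {1..n}" "j \<noteq> i" "\<sigma> j x = 0" "\<eta>1 \<in> {-1,1}" using r j ax by (auto simp: slots_def)
  have "line_of (turn (flip a)) = j"
    by (rule turn_simple) (use f s jj ax in \<open>auto simp: simple_slot_def lines_at_def\<close>)
  then obtain \<eta>2 s2 where j2: "turn (flip a) = (j, x, \<eta>2, s2)" using rf(3) ax
      by (cases "turn (flip a)") auto
  have "\<eta>2 \<in> {-1,1}" using rf(1) j2 by (auto simp: slots_def)
  have "\<eta>1 * cs i j x = s0" using fun_cong[OF r(4), of i] i jj unfolding j unfolding ax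
      by (simp add: tope_def)
  moreover have "\<eta>2 * cs i j x = - s0" using fun_cong[OF rf(4), of i] i jj unfolding j2 unfolding ax
      by (simp add: flip_def tope_def)
  ultimately have \<eta>2: "\<eta>2 = - \<eta>1" using i \<open>\<eta>2 \<in> {-1,1}\<close> jj by auto
  define k where "k = line_of (turn (other_end a))"
  have k: "k \<in> {1..n}" "k \<noteq> i" "\<sigma> k (vertex_of (other_end a)) = 0"
    using slot_line[OF ro(1)] ro ax by (auto simp: k_def)
  have k2: "line_of (turn (other_end (flip a))) = k"
    by (rule turn_simple[OF fo]) (use s k ax in \<open>auto simp: simple_slot_def lines_at_def\<close>)
  have kj: "k \<noteq> j" using far_line_ne[OF a] by (simp add: k_def j)
  obtain t where t: "g j t = x" using param[OF jj(1,3)] by blast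
  obtain d1 where d1: "is_gap j t \<eta>1 d1" "other_end (turn a) = (j, g j (t + of_int \<eta>1 * d1), -\<eta>1, s1)"
    using other_end_ex[of j x \<eta>1 s1 t] r(1) t j by auto
  obtain d2 where d2: "is_gap j t \<eta>2 d2" "other_end (turn (flip a)) = (j, g j (t + of_int \<eta>2 * d2), -\<eta>2,
      s2)"
    using other_end_ex[of j x \<eta>2 s2 t] rf(1) t j2 by auto
  have "third a \<in> slots" "third (flip a) \<in> slots" using other_end_slot ro rfo by auto
  then have z: "\<sigma> k (g j (t + of_int \<eta>1 * d1)) = 0" "\<sigma> k (g j (t + of_int \<eta>2 * d2)) = 0"
    using slot_line(2)[of "third a"] slot_line(2)[of "third (flip a)"] k2
      triangle_closes[OF a tri] triangle_closes[OF f tri'] d1(2) d2(2) unfolding k_def by auto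
  \<comment> \<open>Both apices are common points of \<open>j\<close> and \<open>k\<close>; their
    distance \<open>d1 + d2\<close> along \<open>j\<close> is therefore an integer, and it lies
    strictly between 0 and 2.\<close>
  have "(t + of_int \<eta>1 * d1) - (t + of_int \<eta>2 * d2) \<in> \<int>"
    using common_vertex_Ints[OF jj(1) k(1) kj[symmetric] z(2) z(1)] .
  then have "of_int \<eta>1 * (d1 + d2) \<in> \<int>" by (simp add: \<eta>2 algebra_simps)
  then have "d1 + d2 \<in> \<int>" using jj(4) Ints_minus[of "- d1 - d2"] by (auto simp: add.commute)
  then obtain w where w: "d1 + d2 = of_int w" by (elim Ints_cases)
  have d01: "0 < d1" "d1 < 1" "0 < d2" "d2 < 1" using d1 d2 by (auto simp: is_gap_def)
  then have "0 < w" "w < 2" using w by linarith+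
  then have "w = 1" by simp
  then have d12: "d2 = 1 - d1" using w by simp
  have "m \<in> lines_at (g j (t + of_int \<eta>1 * d1))" if m: "m \<in> {1..n}" "m \<noteq> i" for m
  proof (cases "m = j")
    case True
    then show ?thesis using jj by (simp add: lines_at_def)
  next
    case False
    have nz: "\<sigma> m (g j t) \<noteq> 0"
    proof
      assume "\<sigma> m (g j t) = 0"
      then have "line_of (turn a) = m"
        by (intro turn_simple[OF a]) (use t s m ax in \<open>auto simp: lines_at_def\<close>)
      then show False using False j by simp
    qed
    obtain b where b: "\<And>t. \<sigma> m (g j t) = 0 \<longleftrightarrow> t - b \<in> \<int>" using cross[OF jj(1) m(1)] False by blast
    have e: "of_int \<eta>1 * (of_int \<eta>1 * y) = (y::real)" for y using jj(4) by auto
    define d where "d = frac (of_int \<eta>1 * (b - t))"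
    have "t + of_int \<eta>1 * d - b = - of_int (\<eta>1 * \<lfloor>of_int \<eta>1 * (b - t)\<rfloor>)"
      unfolding d_def frac_def by (simp add: right_diff_distrib e del: minus_mult_left)
    then have 0: "\<sigma> m (g j (t + of_int \<eta>1 * d)) = 0" using b by (metis Ints_minus Ints_of_int)
    have d0: "0 < d" "d < 1"
    proof -
      have "d \<noteq> 0" using nz 0 by auto
      moreover have "0 \<le> d" "d < 1" unfolding d_def by (simp_all add: frac_lt_1)
      ultimately show "0 < d" "d < 1" by auto
    qed
    \<comment> \<open>Curve \<open>m\<close> crosses \<open>j\<close> at distance \<open>d\<close>
      in direction \<open>\<eta>1\<close> and, by the shift by 1, at distance \<open>1 - d\<close>
      in the other direction. The gaps \<open>d1\<close> and \<open>1 - d1\<close> contain no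
      crossing inside, which leaves only \<open>d = d1\<close>.\<close>
    have "(t + of_int \<eta>2 * (1 - d)) - (t + of_int \<eta>1 * d) = of_int \<eta>2" by (simp add: \<eta>2 algebra_simps)
    then have "\<sigma> m (g j (t + of_int \<eta>2 * (1 - d))) = 0"
      using cross_Ints[OF jj(1) m(1) _ 0, of "t + of_int \<eta>2 * (1 - d)"] False by auto
    then have "\<not> 1 - d < d2" using d2(1) d0 m False by (auto simp: is_gap_def)
    moreover have "\<not> d < d1" using d1(1) 0 d0 m False by (auto simp: is_gap_def)
    ultimately have "d = d1" using d12 by simp
    then show ?thesis using 0 m by (simp add: lines_at_def)
  qed
  then have "{1..n} - {i} \<subseteq> lines_at (g j (t + of_int \<eta>1 * d1))" by blast
  then have "card ({1..n} - {i}) \<le> card (lines_at (g j (t + of_int \<eta>1 * d1)))" by (intro card_mono) auto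
  then have "n - 1 \<le> card (lines_at (g j (t + of_int \<eta>1 * d1)))" using i by simp
  then show False using small[of "g j (t + of_int \<eta>1 * d1)"] i by auto
qed

text \<open>Discharging. A triangle keeps two slots at double points for free. If it has more, which
  is at most six, some edge of it has double points at both ends, the face across that edge is
  larger, and this face pays two units for each of the two slots of the edge. A larger face thus
  carries at most \<open>K\<close> slots of its own and pays at most \<open>2 * K\<close>, in total
  \<open>3 * K\<close>.\<close>

lemma simple_vertex_bound:
  assumes small: "\<And>x. card (lines_at x) + 2 \<le> n"
  shows "8 * card {x \<in> vertices. card (lines_at x) = 2} + 64 * card topes \<le> 11 * card slots"
proof -
  define K where "K T = card (boundary T)" for T
  define big where "big T \<longleftrightarrow> K T > 6" for T
  define B where "B T = card {a \<in> boundary T. big (tope (flip a))}" for T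
  have K6: "K T \<ge> 6" if "T \<in> topes" for T using card_boundary_ge that by (simp add: K_def)
  have local_bound: "card {a \<in> boundary T. simple_slot a} \<le> (if big T then K T else 2 + 2 * B T)"
    if T: "T \<in> topes" for T
  proof (cases "big T \<or> card {a \<in> boundary T. simple_slot a} \<le> 2")
    case True
    then show ?thesis by (auto simp: K_def intro!: card_mono)
  next
    case False
    then have 6: "card (boundary T) = 6" using K6[OF T] by (simp add: big_def K_def)
    then obtain a where aT: "a \<in> boundary T" "simple_slot a" "simple_slot (other_end a)"
      using simple_edge_ex[of T] False by (meson not_le)
    then have a: "a \<in> slots" "tope a = T" by (auto simp: boundary_def)
    have o: "other_end a \<in> slots" "tope (other_end a) = T" using other_end_slot other_end_tope a by auto
    have f: "flip a \<in> slots" "tope (flip a) \<in> topes" using a by (auto simp: topes_def)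
    have "K (tope (flip a)) \<noteq> 6" using simple_edge_neighbour[OF a(1) aT(2,3) small] 6 a by (simp add: K_def)
    then have b: "big (tope (flip a))" using K6[OF f(2)] by (simp add: big_def)
    have "tope (flip (other_end a)) = tope (flip a)" using other_end_tope[OF f(1)] by simp
    then have "{a, other_end a} \<subseteq> {a \<in> boundary T. big (tope (flip a))}" using b aT o
        by (auto simp: boundary_def)
    then have "card {a, other_end a} \<le> B T" unfolding B_def by (intro card_mono) auto
    moreover have "card {a, other_end a} = 2" using other_end_ne[OF a(1)] by auto
    moreover have "card {a \<in> boundary T. simple_slot a} \<le> 6" unfolding 6[symmetric]
        by (intro card_mono) auto
    ultimately show ?thesis using False by simp
  qed
  have flipped: "(\<Sum>T\<in>topes. B T) = (\<Sum>T\<in>topes. if big T then K T else 0)"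
  proof -
    have "(\<Sum>T\<in>topes. B T) = card {a \<in> slots. big (tope (flip a))}"
      using sum_boundary[of "\<lambda>a. big (tope (flip a))" "\<lambda>_. True"] by (simp add: B_def)
    also have "\<dots> = card {a \<in> slots. big (tope a)}"
      by (rule bij_betw_same_card[of flip], rule bij_betw_byWitness[where f' = flip]) auto
    also have "\<dots> = (\<Sum>T\<in>{T \<in> topes. big T}. card {a \<in> boundary T. big (tope a)})"
      using sum_boundary[of "\<lambda>a. big (tope a)" big] by simp
    also have "\<dots> = (\<Sum>T\<in>{T \<in> topes. big T}. K T)"
    proof (rule sum.cong[OF refl])
      fix T assume "T \<in> {T \<in> topes. big T}"
      then have "{a \<in> boundary T. big (tope a)} = boundary T" by (auto simp: boundary_def)
      then show "card {a \<in> boundary T. big (tope a)} = K T" by (simp add: K_def)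
    qed
    also have "\<dots> = (\<Sum>T\<in>topes. if big T then K T else 0)"
      by (simp add: sum.inter_filter finite_topes)
    finally show ?thesis .
  qed
  have "8 * card {x \<in> vertices. card (lines_at x) = 2} = (\<Sum>T\<in>topes. card {a \<in> boundary T. simple_slot a})"
    using sum_boundary[of simple_slot "\<lambda>_. True"] card_slots_simple by (simp add: simple_slot_def)
  also have "\<dots> \<le> (\<Sum>T\<in>topes. (if big T then K T else 2) + 2 * B T)"
    using local_bound by (intro sum_mono) (fastforce split: if_splits)
  also have "\<dots> = (\<Sum>T\<in>topes. (if big T then 3 * K T else 2))"
  proof -
    have "(\<Sum>T\<in>topes. (if big T then K T else 2) + 2 * B T) =
      (\<Sum>T\<in>topes. if big T then K T else 2) + 2 * (\<Sum>T\<in>topes. if big T then K T else 0)"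
      using flipped by (simp add: sum.distrib sum_distrib_left[symmetric])
    also have "\<dots> = (\<Sum>T\<in>topes. (if big T then K T else 2) + 2 * (if big T then K T else 0))"
      by (simp only: sum.distrib sum_distrib_left)
    also have "\<dots> = (\<Sum>T\<in>topes. (if big T then 3 * K T else 2))"
      by (intro sum.cong) auto
    finally show ?thesis .
  qed
  finally have 1: "8 * card {x \<in> vertices. card (lines_at x) = 2} \<le> (\<Sum>T\<in>topes. (if big T then 3 * K T
      else 2))" .
  \<comment> \<open>The weights 11 and 64 are fixed by equality for triangles, 2 + 64 = 11 * 6, and
    for quadrilaterals, 3 * 8 + 64 = 11 * 8. The value 7 would violate the bound and is excluded by
    parity.\<close>
  have "(\<Sum>T\<in>topes. (if big T then 3 * K T else 2) + 64) \<le> (\<Sum>T\<in>topes. 11 * K T)"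
  proof (intro sum_mono)
    fix T assume "T \<in> topes"
    then have "K T \<ge> 6" "even (K T)" using K6 even_card_boundary by (auto simp: K_def)
    then have "K T = 6 \<or> K T \<ge> 8" by (cases "K T = 7") auto
    then show "(if big T then 3 * K T else 2) + 64 \<le> 11 * K T" by (auto simp: big_def)
  qed
  then have "(\<Sum>T\<in>topes. (if big T then 3 * K T else 2)) + 64 * card topes \<le> 11 * card slots"
    using sum_card_boundary by (simp add: sum.distrib K_def sum_distrib_left[symmetric])
  then show ?thesis using 1 by simp
qed

end

section \<open>Regular curves on the sphere and their sides\<close>

text \<open>Lifts of regular simple closed curves of the projective plane with period 1. The axiom
  \<open>simple\<close> leaves open whether the lift closes up after one unit or reaches the
  antipode; for pseudolines the crossings will decide this.\<close>

locale regular_sphere_curve =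
  fixes g g' :: "real \<Rightarrow> real ^ 3"
  assumes unit [simp]: "\<And>t. norm (g t) = 1"
    and deriv: "\<And>t. (g has_vector_derivative g' t) (at t)"
    and cont_deriv: "continuous_on UNIV g'"
    and regular: "\<And>t. g' t \<noteq> 0"
    and simple: "\<And>s t. g s = g t \<or> g s = - g t \<longleftrightarrow> s - t \<in> \<int>"
begin

lemma cont: "continuous_on S g"
  using deriv by (meson continuous_at_imp_continuous_on has_vector_derivative_continuous)

lemma isCont: "isCont g t"
  using deriv has_vector_derivative_continuous by blast

lemma nonzero [simp]: "g t \<noteq> 0"
  using unit[of t] by (metis norm_zero zero_neq_one)

lemma inner_self [simp]: "g t \<bullet> g t = 1"
  by (simp add: dot_square_norm)

lemma orthogonal_deriv: "g t \<bullet> g' t = 0"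
proof -
  have "((\<lambda>t. g t \<bullet> g t) has_vector_derivative (g t \<bullet> g' t + g' t \<bullet> g t)) (at t)"
    by (rule bounded_bilinear.has_vector_derivative[OF bounded_bilinear_inner deriv deriv])
  moreover have "((\<lambda>t. g t \<bullet> g t) has_vector_derivative 0) (at t)" by simp
  ultimately have "g t \<bullet> g' t + g' t \<bullet> g t = 0" by (rule vector_derivative_unique_at)
  then show ?thesis by (simp add: inner_commute)
qed

text \<open>On one period around \<open>s0\<close>, the part of the curve away from
  \<open>s0\<close> and the whole antipodal arc form a compact set that misses
  \<open>g s0\<close>.\<close>

lemma near_param:
  assumes "\<eta> > 0"
  shows "\<exists>r>0. \<forall>x. dist x (g s0) < r \<and> (\<exists>s. x = g s \<or> x = - g s) \<longrightarrow> (\<exists>s'. \<bar>s' - s0\<bar> < \<eta> \<and> x = g s')"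
proof -
  define I where "I = {s0 - 1/2..s0 + 1/2}"
  define C where "C = g ` (I - ball s0 \<eta>) \<union> uminus ` g ` I"
  have I: "s = s0" if s: "s \<in> I" "s - s0 \<in> \<int>" for s
  proof -
    obtain z where z: "s - s0 = of_int z" using s(2) by (elim Ints_cases)
    have "s0 - 1/2 \<le> s" "s \<le> s0 + 1/2" using s(1) by (auto simp: I_def)
    then have "z = 0" using z by linarith
    then show ?thesis using z by simp
  qed
  have "compact C" unfolding C_def I_def
    by (intro compact_Un compact_continuous_image cont compact_diff continuous_intros) auto
  then have "open (- C)" by (simp add: compact_imp_closed open_Compl)
  moreover have "g s0 \<in> - C"
  proof
    assume "g s0 \<in> C"
    then obtain s where s: "s \<in> I" "(g s = g s0 \<and> s \<notin> ball s0 \<eta>) \<or> g s = - g s0" unfolding C_def by auto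
    then have ss: "s = s0" using I simple by blast
    then have "g s0 = - g s0" using s assms by auto
    from arg_cong[OF this, of "\<lambda>x. x \<bullet> g s0"] show False by simp
  qed
  ultimately obtain r where r: "r > 0" "ball (g s0) r \<subseteq> - C" using open_contains_ball by blast
  have "\<exists>s'. \<bar>s' - s0\<bar> < \<eta> \<and> x = g s'" if x: "dist x (g s0) < r" "x = g s \<or> x = - g s" for x s
  proof -
    define s' where "s' = s - of_int (round (s - s0))"
    have s': "s' \<in> I" using of_int_round_abs_le[of "s - s0"] unfolding s'_def I_def
        by (auto simp: abs_if split: if_splits)
    have "g s' = g s \<or> g s' = - g s" using simple[of s' s] by (simp add: s'_def)
    then have xs: "x = g s' \<or> x = - g s'" using x(2) by auto
    have xC: "x \<notin> C" using r(2) x(1) by (auto simp: dist_commute)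
    then have "x = g s'" using xs s' by (auto simp: C_def)
    moreover have "s' \<in> ball s0 \<eta>" using xC s' \<open>x = g s'\<close> by (auto simp: C_def)
    ultimately show ?thesis by (auto simp: dist_real_def abs_minus_commute)
  qed
  then show ?thesis using r(1) by blast
qed

text \<open>The central projection \<open>sgn\<close> extends \<open>near_param\<close> to a
  neighbourhood in the ambient space, where cones and segments are available.\<close>

lemma near_param_sgn:
  assumes "\<eta> > 0"
  shows "\<exists>r>0. \<forall>y. dist y (g s0) < r \<longrightarrow> y \<noteq> 0 \<and>
    ((\<exists>s. sgn y = g s \<or> sgn y = - g s) \<longrightarrow> (\<exists>s'. \<bar>s' - s0\<bar> < \<eta> \<and> sgn y = g s'))"
proof -
  obtain r1 where r1: "r1 > 0" "\<And>x. dist x (g s0) < r1 \<Longrightarrow> (\<exists>s. x = g s \<or> x = - g s) \<Longrightarrow>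
      \<exists>s'. \<bar>s' - s0\<bar> < \<eta> \<and> x = g s'"
    using near_param[OF assms, of s0] by blast
  have "isCont sgn (g s0)" unfolding isCont_def by (intro tendsto_sgn tendsto_ident_at) simp
  then obtain r2 where r2: "r2 > 0" "\<And>y. dist y (g s0) < r2 \<Longrightarrow> dist (sgn y) (sgn (g s0)) < r1"
    using r1(1) unfolding continuous_at_eps_delta by blast
  have "sgn (g s0) = g s0" by (simp add: sgn_div_norm)
  moreover have "y \<noteq> 0" if "dist y (g s0) < 1" for y using that by auto
  ultimately show ?thesis using r1 r2 by (intro exI[of _ "min r2 1"]) auto
qed

abbreviation normal :: "real \<Rightarrow> real ^ 3" where "normal t \<equiv> cross3 (g t) (g' t)"

lemma normal_inner [simp]:
  "g t \<bullet> normal t = 0" "normal t \<bullet> g t = 0" "g' t \<bullet> normal t = 0" "normal t \<bullet> g' t = 0"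
  by (simp_all add: dot_cross_self)

lemma norm_normal: "norm (normal t) = norm (g' t)"
proof -
  have "(norm (normal t))\<^sup>2 = (norm (g' t))\<^sup>2" using norm_cross[of "g t" "g' t"]
      by (simp add: orthogonal_deriv)
  then show ?thesis by simp
qed

text \<open>To first order \<open>g\<close> moves along \<open>g' s0\<close>, so near
  \<open>s0\<close> its normal component stays below any given multiple of the tangential
  one.\<close>

lemma tangent_cone:
  assumes "\<kappa> > 0"
  shows "\<exists>\<eta>>0. \<forall>s. \<bar>s - s0\<bar> < \<eta> \<longrightarrow> \<bar>g s \<bullet> normal s0\<bar> \<le> \<kappa> * \<bar>g s \<bullet> g' s0\<bar>"
proof -
  let ?u = "g' s0" and ?w = "normal s0"
  define L where "L = norm ?u"
  have L: "L > 0" using regular by (simp add: L_def)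
  \<comment> \<open>The bound \<open>L/2\<close> preserves half of the tangential component
    \<open>|s - s0| * L * L\<close>; the bound \<open>\<kappa> * L / 2\<close> keeps the normal
    error below \<open>\<kappa>\<close> times that half.\<close>
  define e where "e = min (L/2) (\<kappa> * L / 2)"
  have e: "e > 0" "e \<le> L/2" "e \<le> \<kappa> * L / 2" using L assms by (auto simp: e_def)
  have "(g has_derivative (\<lambda>h. h *\<^sub>R ?u)) (at s0)" using deriv by (simp add: has_vector_derivative_def)
  then obtain \<eta> where \<eta>: "\<eta> > 0" "\<And>s. \<bar>s - s0\<bar> < \<eta> \<Longrightarrow> norm (g s - g s0 - (s - s0) *\<^sub>R ?u) \<le> e * \<bar>s - s0\<bar>"
    unfolding has_derivative_at_alt using e(1) by (auto simp: real_norm_def)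
  have "\<bar>g s \<bullet> ?w\<bar> \<le> \<kappa> * \<bar>g s \<bullet> ?u\<bar>" if s: "\<bar>s - s0\<bar> < \<eta>" for s
  proof -
    define R where "R = g s - g s0 - (s - s0) *\<^sub>R ?u"
    have R: "norm R \<le> e * \<bar>s - s0\<bar>" using \<eta>(2)[OF s] by (simp add: R_def)
    have g: "g s = g s0 + (s - s0) *\<^sub>R ?u + R" by (simp add: R_def)
    have "g s \<bullet> ?w = R \<bullet> ?w" unfolding g by (simp add: inner_add_left)
    also have "\<bar>\<dots>\<bar> \<le> norm R * L" using Cauchy_Schwarz_ineq2[of R ?w] by (simp add: norm_normal L_def)
    also have "\<dots> \<le> e * \<bar>s - s0\<bar> * L" using R L by (intro mult_right_mono) auto
    finally have 1: "\<bar>g s \<bullet> ?w\<bar> \<le> e * \<bar>s - s0\<bar> * L" .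
    have "g s \<bullet> ?u = (s - s0) * L\<^sup>2 + R \<bullet> ?u"
      unfolding g by (simp add: inner_add_left orthogonal_deriv L_def dot_square_norm)
    moreover have "\<bar>R \<bullet> ?u\<bar> \<le> e * \<bar>s - s0\<bar> * L"
      using order.trans[OF Cauchy_Schwarz_ineq2[of R ?u] mult_right_mono[OF R norm_ge_zero]]
          by (simp add: L_def)
    ultimately have "\<bar>g s \<bullet> ?u\<bar> \<ge> \<bar>(s - s0) * L\<^sup>2\<bar> - e * \<bar>s - s0\<bar> * L" by linarith
    moreover have "\<bar>(s - s0) * L\<^sup>2\<bar> = \<bar>s - s0\<bar> * L * L" by (simp add: abs_mult power2_eq_square)
    moreover have "e * (\<bar>s - s0\<bar> * L) \<le> L/2 * (\<bar>s - s0\<bar> * L)" using e L by (intro mult_right_mono) auto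
    ultimately have 2: "\<bar>g s \<bullet> ?u\<bar> \<ge> \<bar>s - s0\<bar> * L * (L/2)" by (simp add: algebra_simps)
    have "e * (\<bar>s - s0\<bar> * L) \<le> \<kappa> * L / 2 * (\<bar>s - s0\<bar> * L)" using e L by (intro mult_right_mono) auto
    also have "\<dots> = \<kappa> * (\<bar>s - s0\<bar> * L * (L/2))" by simp
    also have "\<dots> \<le> \<kappa> * \<bar>g s \<bullet> ?u\<bar>" using 2 assms by (intro mult_left_mono) auto
    finally show ?thesis using 1 by (simp add: algebra_simps)
  qed
  then show ?thesis using \<eta>(1) by blast
qed

text \<open>In central projection onto the tangent plane of the sphere at \<open>g s0\<close> the
  quotient is, up to scale, the coordinate along the tangent. Its derivative has the sign of
  \<open>D\<close>, which is positive at \<open>s0\<close> and, by continuity of \<open>g'\<close>,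
  near it.\<close>

lemma slope_injective:
  "\<exists>\<eta>>0. \<forall>s s'. \<bar>s - s0\<bar> < \<eta> \<longrightarrow> \<bar>s' - s0\<bar> < \<eta> \<longrightarrow> g s \<bullet> g s0 > 0 \<and>
     ((g s \<bullet> g' s0) / (g s \<bullet> g s0) = (g s' \<bullet> g' s0) / (g s' \<bullet> g s0) \<longrightarrow> s = s')"
proof -
  let ?u = "g' s0" and ?v = "g s0"
  define D where "D s = (g' s \<bullet> ?u) * (g s \<bullet> ?v) - (g s \<bullet> ?u) * (g' s \<bullet> ?v)" for s
  have "isCont g' t" for t using cont_deriv by (simp add: continuous_on_eq_continuous_at)
  then have "isCont D s0" "isCont (\<lambda>s. g s \<bullet> ?v) s0" unfolding D_def
      by (auto intro!: continuous_intros isCont)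
  moreover have "D s0 > 0" by (simp add: D_def regular orthogonal_deriv)
  ultimately have "\<forall>\<^sub>F s in at s0. D s > 0" "\<forall>\<^sub>F s in at s0. g s \<bullet> ?v > 0"
    unfolding isCont_def by (auto intro!: order_tendstoD)
  then have "\<forall>\<^sub>F s in at s0. D s > 0 \<and> g s \<bullet> ?v > 0" by (rule eventually_conj)
  then obtain \<eta> where \<eta>: "\<eta> > 0" "\<And>s. s \<noteq> s0 \<Longrightarrow> dist s s0 < \<eta> \<Longrightarrow> D s > 0 \<and> g s \<bullet> ?v > 0"
    unfolding eventually_at by auto
  have pos: "D s > 0 \<and> g s \<bullet> ?v > 0" if "\<bar>s - s0\<bar> < \<eta>" for s
    using \<eta>(2)[of s] that \<open>D s0 > 0\<close> by (cases "s = s0") (auto simp: dist_real_def)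
  have mono: "(g s \<bullet> ?u) / (g s \<bullet> ?v) < (g s' \<bullet> ?u) / (g s' \<bullet> ?v)"
    if s: "\<bar>s - s0\<bar> < \<eta>" "\<bar>s' - s0\<bar> < \<eta>" "s < s'" for s s'
  proof (rule DERIV_pos_imp_increasing[OF s(3), of "\<lambda>x. (g x \<bullet> ?u) / (g x \<bullet> ?v)"])
    fix x assume "s \<le> x" "x \<le> s'"
    then have x: "\<bar>x - s0\<bar> < \<eta>" using s by auto
    have in_der: "((\<lambda>x. g x \<bullet> a) has_real_derivative (g' x \<bullet> a)) (at x)" for a
    proof -
      have "((\<lambda>x. g x \<bullet> a) has_vector_derivative (g' x \<bullet> a)) (at x)"
        by (rule bounded_linear.has_vector_derivative[OF bounded_linear_inner_left deriv])
      then show ?thesis by (simp add: has_real_derivative_iff_has_vector_derivative)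
    qed
    have "((\<lambda>x. (g x \<bullet> ?u) / (g x \<bullet> ?v)) has_real_derivative
        ((g' x \<bullet> ?u) * (g x \<bullet> ?v) - (g x \<bullet> ?u) * (g' x \<bullet> ?v)) / ((g x \<bullet> ?v) * (g x \<bullet> ?v))) (at x)"
      by (rule DERIV_divide[OF in_der in_der]) (use pos[OF x] in auto)
    moreover have "((g' x \<bullet> ?u) * (g x \<bullet> ?v) - (g x \<bullet> ?u) * (g' x \<bullet> ?v)) / ((g x \<bullet> ?v) * (g x \<bullet> ?v)) > 0"
      using pos[OF x] by (auto simp: D_def)
    ultimately show "\<exists>y. ((\<lambda>x. (g x \<bullet> ?u) / (g x \<bullet> ?v)) has_real_derivative y) (at x) \<and> 0 < y" by blast
  qed
  have "s = s'" if "\<bar>s - s0\<bar> < \<eta>" "\<bar>s' - s0\<bar> < \<eta>" "(g s \<bullet> ?u) / (g s \<bullet> ?v) = (g s' \<bullet> ?u) / (g s' \<bullet> ?v)"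
      for s s'
    using mono[OF that(1,2)] mono[OF that(2,1)] that(3) by (cases s s' rule: linorder_cases) auto
  then show ?thesis using \<eta>(1) pos by blast
qed

end

text \<open>At distance \<open>h\<close> from \<open>t0\<close> the component along \<open>u\<close>
  is at most \<open>h * M\<close> and the one along \<open>w\<close> at least
  \<open>h * D / 2\<close> in absolute value; \<open>\<kappa> = D / (4 * M)\<close> separates them,
  for all radii \<open>r\<close> at once.\<close>

lemma enter_cone:
  fixes \<rho> :: "real \<Rightarrow> real ^ 3"
  assumes \<rho>: "\<rho> t0 = v" "(\<rho> has_vector_derivative d) (at t0)"
    and orth: "v \<bullet> u = 0" "v \<bullet> w = 0" and dw: "d \<bullet> w \<noteq> 0"
  shows "\<exists>\<kappa>>0. \<forall>r>0. \<exists>\<epsilon>>0. \<forall>t. t \<noteq> t0 \<and> \<bar>t - t0\<bar> < \<epsilon> \<longrightarrow>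
    dist (\<rho> t) v < r \<and> \<kappa> * \<bar>\<rho> t \<bullet> u\<bar> < sgn ((t - t0) * (d \<bullet> w)) * (\<rho> t \<bullet> w)"
proof -
  define D where "D = \<bar>d \<bullet> w\<bar>"
  define M where "M = norm d * norm u + norm u + 1"
  have D: "D > 0" using dw by (simp add: D_def)
  have M: "M > 0" by (simp add: M_def add_nonneg_pos)
  have wn: "norm w > 0" using dw by auto
  define e where "e = min 1 (D / (2 * norm w))"
  have e: "e > 0" "e \<le> 1" "e * norm w \<le> D / 2"
    using D wn by (auto simp: e_def min_def field_simps)
  have "(\<rho> has_derivative (\<lambda>h. h *\<^sub>R d)) (at t0)" using \<rho>(2) by (simp add: has_vector_derivative_def)
  then obtain \<eta> where \<eta>: "\<eta> > 0" "\<And>t. \<bar>t - t0\<bar> < \<eta> \<Longrightarrow> norm (\<rho> t - \<rho> t0 - (t - t0) *\<^sub>R d) \<le> e * \<bar>t - t0\<bar>"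
    unfolding has_derivative_at_alt using e(1) by (auto simp: real_norm_def)
  define \<kappa> where "\<kappa> = D / (4 * M)"
  have \<kappa>: "\<kappa> > 0" using D M by (simp add: \<kappa>_def)
  have "\<exists>\<epsilon>>0. \<forall>t. t \<noteq> t0 \<and> \<bar>t - t0\<bar> < \<epsilon> \<longrightarrow>
    dist (\<rho> t) v < r \<and> \<kappa> * \<bar>\<rho> t \<bullet> u\<bar> < sgn ((t - t0) * (d \<bullet> w)) * (\<rho> t \<bullet> w)" if r: "r > 0" for r
  proof -
    define \<epsilon> where "\<epsilon> = min \<eta> (r / (norm d + 1))"
    have nd: "norm d + 1 > 0" by (simp add: add_nonneg_pos)
    have "\<epsilon> > 0" using \<eta> r nd by (simp add: \<epsilon>_def)
    moreover have "dist (\<rho> t) v < r \<and> \<kappa> * \<bar>\<rho> t \<bullet> u\<bar> < sgn ((t - t0) * (d \<bullet> w)) * (\<rho> t \<bullet> w)"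
      if t: "t \<noteq> t0" "\<bar>t - t0\<bar> < \<epsilon>" for t
    proof
      define h where "h = \<bar>t - t0\<bar>"
      have h: "h > 0" "h < \<eta>" "h < r / (norm d + 1)" using t by (auto simp: h_def \<epsilon>_def)
      define R where "R = \<rho> t - v - (t - t0) *\<^sub>R d"
      have R: "norm R \<le> e * h" using \<eta>(2)[of t] h \<rho>(1) by (simp add: R_def h_def)
      have Rh: "norm R \<le> h" using R e h by (meson mult_left_le_one_le order.trans less_imp_le)
      have eq: "\<rho> t = v + (t - t0) *\<^sub>R d + R" by (simp add: R_def)
      have "dist (\<rho> t) v = norm ((t - t0) *\<^sub>R d + R)" by (simp add: dist_norm eq)
      also have "\<dots> \<le> h * norm d + norm R" using norm_triangle_ineq[of "(t - t0) *\<^sub>R d" R]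
          by (simp add: h_def)
      also have "\<dots> \<le> h * (norm d + 1)" using Rh by (simp add: algebra_simps)
      also have "\<dots> < r" using h(3) nd by (simp add: pos_less_divide_eq)
      finally show "dist (\<rho> t) v < r" .
      have "\<rho> t \<bullet> u = (t - t0) * (d \<bullet> u) + R \<bullet> u" by (simp add: eq inner_add_left orth)
      then have "\<bar>\<rho> t \<bullet> u\<bar> \<le> h * \<bar>d \<bullet> u\<bar> + \<bar>R \<bullet> u\<bar>"
        by (metis abs_mult abs_triangle_ineq h_def)
      also have "\<dots> \<le> h * (norm d * norm u) + h * norm u"
        using Cauchy_Schwarz_ineq2[of d u] Cauchy_Schwarz_ineq2[of R u] h Rh
          order.trans[OF Cauchy_Schwarz_ineq2[of R u] mult_right_mono[OF Rh norm_ge_zero]]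
        by (intro add_mono mult_left_mono) auto
      also have "\<dots> \<le> h * M" using h by (simp add: M_def algebra_simps)
      finally have "\<kappa> * \<bar>\<rho> t \<bullet> u\<bar> \<le> \<kappa> * (h * M)" using \<kappa> by (intro mult_left_mono) auto
      also have "\<dots> = h * D / 4" using M by (simp add: \<kappa>_def)
      also have "\<dots> < h * D / 2" using h D by simp
      also have "\<dots> \<le> sgn ((t - t0) * (d \<bullet> w)) * (\<rho> t \<bullet> w)"
      proof -
        let ?s = "sgn ((t - t0) * (d \<bullet> w))"
        have s: "?s * ((t - t0) * (d \<bullet> w)) = h * D"
          unfolding h_def D_def abs_mult[symmetric] by (simp add: sgn_mult_abs abs_sgn mult.commute)
        have "\<bar>?s * (R \<bullet> w)\<bar> \<le> \<bar>R \<bullet> w\<bar>" by (simp add: abs_mult sgn_if)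
        also have "\<dots> \<le> norm R * norm w" by (rule Cauchy_Schwarz_ineq2)
        also have "\<dots> \<le> e * h * norm w" using R by (intro mult_right_mono) auto
        also have "\<dots> \<le> h * D / 2" using mult_left_mono[OF e(3), of h] h by (simp add: algebra_simps)
        finally have "\<bar>?s * (R \<bullet> w)\<bar> \<le> h * D / 2" .
        moreover have "?s * (\<rho> t \<bullet> w) = h * D + ?s * (R \<bullet> w)"
          unfolding s[symmetric] eq by (simp add: inner_add_left orth distrib_left)
        ultimately show ?thesis by linarith
      qed
      finally show "\<kappa> * \<bar>\<rho> t \<bullet> u\<bar> < sgn ((t - t0) * (d \<bullet> w)) * (\<rho> t \<bullet> w)" .
    qed
    ultimately show ?thesis by blast
  qed
  then show ?thesis using \<kappa> by blast
qed

text \<open>If the tangents differed, \<open>g2\<close> would enter a cone around the normal of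
  \<open>g1\<close>, which \<open>tangent_cone\<close> keeps free of the curve. Independence of the
  parametrization matters because transversality is granted only for some pair of
  parametrizations.\<close>

lemma tangent_unique:
  assumes "regular_sphere_curve g1 g1'" "regular_sphere_curve g2 g2'"
    and sub: "\<And>t. \<exists>s. g2 t = g1 s \<or> g2 t = - g1 s" and eq: "g2 t0 = g1 s0"
  shows "g2' t0 \<bullet> cross3 (g1 s0) (g1' s0) = 0"
proof (rule ccontr)
  interpret c1: regular_sphere_curve g1 g1' by fact
  interpret c2: regular_sphere_curve g2 g2' by fact
  assume ne: "g2' t0 \<bullet> c1.normal s0 \<noteq> 0"
  have "\<exists>\<kappa>>0. \<forall>r>0. \<exists>\<epsilon>>0. \<forall>t. t \<noteq> t0 \<and> \<bar>t - t0\<bar> < \<epsilon> \<longrightarrow> dist (g2 t) (g1 s0) < r \<and>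
      \<kappa> * \<bar>g2 t \<bullet> g1' s0\<bar> < sgn ((t - t0) * (g2' t0 \<bullet> c1.normal s0)) * (g2 t \<bullet> c1.normal s0)"
    by (rule enter_cone[OF eq c2.deriv _ _ ne]) (simp_all add: c1.orthogonal_deriv)
  then obtain \<kappa> where \<kappa>: "\<kappa> > 0" "\<And>r. r > 0 \<Longrightarrow> \<exists>\<epsilon>>0. \<forall>t. t \<noteq> t0 \<and> \<bar>t - t0\<bar> < \<epsilon> \<longrightarrow> dist (g2 t) (g1 s0) < r \<and>
      \<kappa> * \<bar>g2 t \<bullet> g1' s0\<bar> < sgn ((t - t0) * (g2' t0 \<bullet> c1.normal s0)) * (g2 t \<bullet> c1.normal s0)" by blast
  obtain \<eta> where \<eta>: "\<eta> > 0" "\<And>s. \<bar>s - s0\<bar> < \<eta> \<Longrightarrow> \<bar>g1 s \<bullet> c1.normal s0\<bar> \<le> \<kappa> * \<bar>g1 s \<bullet> g1' s0\<bar>"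
    using c1.tangent_cone[OF \<kappa>(1), of s0] by blast
  obtain r where r: "r > 0" "\<And>x. dist x (g1 s0) < r \<Longrightarrow> (\<exists>s. x = g1 s \<or> x = - g1 s) \<Longrightarrow> \<exists>s'. \<bar>s' - s0\<bar> < \<eta> \<and>
      x = g1 s'"
    using c1.near_param[OF \<eta>(1), of s0] by blast
  obtain \<epsilon> where \<epsilon>: "\<epsilon> > 0" "\<And>t. t \<noteq> t0 \<Longrightarrow> \<bar>t - t0\<bar> < \<epsilon> \<Longrightarrow> dist (g2 t) (g1 s0) < r \<and>
      \<kappa> * \<bar>g2 t \<bullet> g1' s0\<bar> < sgn ((t - t0) * (g2' t0 \<bullet> c1.normal s0)) * (g2 t \<bullet> c1.normal s0)"
    using \<kappa>(2)[OF r(1)] by blast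
  define t where "t = t0 + \<epsilon> / 2"
  have t: "t \<noteq> t0" "\<bar>t - t0\<bar> < \<epsilon>" using \<epsilon>(1) by (auto simp: t_def)
  obtain s' where s': "\<bar>s' - s0\<bar> < \<eta>" "g2 t = g1 s'" using r(2)[OF _ sub] \<epsilon>(2)[OF t] by blast
  have "\<kappa> * \<bar>g2 t \<bullet> g1' s0\<bar> < \<bar>g2 t \<bullet> c1.normal s0\<bar>" using \<epsilon>(2)[OF t]
      by (auto simp: sgn_if split: if_splits)
  then show False using \<eta>(2)[OF s'(1)] s'(2) by simp
qed

section \<open>The Jordan curve theorem on the sphere\<close>

lemma sphere_not_homeomorphic_circle: "\<not> sphere (0 :: real ^ 3) 1 homeomorphic sphere (0 :: complex) 1"
proof
  assume "sphere (0 :: real ^ 3) 1 homeomorphic sphere (0 :: complex) 1"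
  then obtain f g where fg: "homeomorphism (sphere (0 :: real ^ 3) 1) (sphere (0 :: complex) 1) f g"
    unfolding homeomorphic_def by blast
  define q :: "real ^ 3" where "q = axis 1 1"
  have q: "q \<in> sphere 0 1" by (simp add: q_def norm_axis_1)
  have inj: "inj_on f (sphere 0 1)" using fg by (metis homeomorphism_def inj_on_inverseI)
  have im: "f ` sphere 0 1 = sphere 0 1" using fg by (simp add: homeomorphism_def)
  have fq: "f q \<in> sphere 0 1" using q im by blast
  have "f ` (sphere 0 1 - {q}) = sphere 0 1 - {f q}"
    using inj_on_image_set_diff[OF inj, of "sphere 0 1" "{q}"] q im by simp
  then have "homeomorphism (sphere 0 1 - {q}) (sphere 0 1 - {f q}) f g"
    by (intro homeomorphism_of_subsets[OF fg]) auto
  then have "(sphere 0 1 - {q}) homeomorphic (sphere 0 1 - {f q})" unfolding homeomorphic_def by blast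
  moreover have "(sphere 0 1 - {q}) homeomorphic (UNIV :: complex set)"
    by (rule homeomorphic_punctured_sphere_affine) (use q in \<open>auto simp: aff_dim_UNIV\<close>)
  moreover have "(sphere 0 1 - {f q}) homeomorphic (UNIV :: real set)"
    by (rule homeomorphic_punctured_sphere_affine) (use fq in \<open>auto simp: aff_dim_UNIV\<close>)
  \<comment> \<open>Removing a point leaves a plane on one side and a line on the other, which
    differ by invariance of dimension.\<close>
  ultimately have "(UNIV :: complex set) homeomorphic (UNIV :: real set)"
    by (meson homeomorphic_sym homeomorphic_trans)
  then show False by (simp add: homeomorphic_UNIV_UNIV)
qed

lemma simple_loop_on_sphere_not_onto:
  fixes f :: "real \<Rightarrow> real ^ 3"
  assumes "simple_path f" "pathfinish f = pathstart f"
  shows "path_image f \<noteq> sphere 0 1"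
  using homeomorphic_simple_path_image_circle[OF assms zero_less_one, of 0]
      sphere_not_homeomorphic_circle by metis

text \<open>The planar theorem is transported along a homeomorphism of the plane with the sphere
  punctured at a point \<open>q\<close> off the curve. The puncture joins the outside, which remains
  open because the curve and its inside form a compact set.\<close>

lemma Jordan_sphere:
  fixes f :: "real \<Rightarrow> real ^ 3"
  assumes f: "simple_path f" "pathfinish f = pathstart f" and sub: "path_image f \<subseteq> sphere 0 1"
  obtains A B where "openin (top_of_set (sphere 0 1)) A" "openin (top_of_set (sphere 0 1)) B"
    "A \<inter> B = {}" "A \<union> B = sphere 0 1 - path_image f"
    "path_image f \<subseteq> closure A" "path_image f \<subseteq> closure B"
proof -
  let ?S = "sphere (0 :: real ^ 3) 1"
  let ?P = "path_image f"
  obtain q where q: "q \<in> ?S" "q \<notin> ?P" using simple_loop_on_sphere_not_onto[OF f] sub by blast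
  have "(?S - {q}) homeomorphic (UNIV :: complex set)"
    by (rule homeomorphic_punctured_sphere_affine) (use q in \<open>auto simp: aff_dim_UNIV\<close>)
  then obtain h g where hg: "homeomorphism (?S - {q}) (UNIV :: complex set) h g"
      unfolding homeomorphic_def by blast
  have ch: "continuous_on (?S - {q}) h" and cg: "continuous_on UNIV g"
    and gh: "\<And>x. x \<in> ?S - {q} \<Longrightarrow> g (h x) = x" and hg': "\<And>y. h (g y) = y"
    and gS: "\<And>y. g y \<in> ?S - {q}"
    using hg unfolding homeomorphism_def by blast+
  have Psub: "?P \<subseteq> ?S - {q}" using q sub by blast
  define c where "c = h \<circ> f"
  have inj: "inj_on h ?P" using gh Psub by (metis inj_on_def subsetD)
  have sc: "simple_path c" unfolding c_def
    by (rule simple_path_continuous_image[OF f(1) continuous_on_subset[OF ch Psub] inj])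
  have lc: "pathfinish c = pathstart c" using f(2) by (simp add: c_def pathfinish_def pathstart_def)
  have ic: "path_image c = h ` ?P" by (simp add: c_def path_image_compose)
  define In where "In = inside (path_image c)"
  define Out where "Out = outside (path_image c)"
  have J: "open In" "open Out" "bounded In" "In \<inter> Out = {}" "In \<union> Out = - path_image c"
    "frontier In = path_image c" "frontier Out = path_image c"
    using Jordan_inside_outside[OF sc lc] by (auto simp: In_def Out_def)
  have op: "openin (top_of_set ?S) (g ` U)" if "open U" for U
  proof -
    have "openin (top_of_set (?S - {q})) ((?S - {q}) \<inter> h -` U)"
        by (rule continuous_openin_preimage_gen[OF ch that])
    moreover have "(?S - {q}) \<inter> h -` U = g ` U" using gS hg' gh by (force simp: image_iff)
    moreover have "openin (top_of_set ?S) (?S - {q})" by (rule openin_delete) simp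
    ultimately show ?thesis by (metis openin_trans)
  qed
  define A where "A = g ` In"
  define B where "B = insert q (g ` Out)"
  have closed: "path_image c \<union> In = closure In" using J(6) by (auto simp: closure_Un_frontier)
  have "compact (path_image c \<union> In)" unfolding closed using J(3) by (simp add: compact_closure)
  then have "compact (g ` (path_image c \<union> In))" by (intro compact_continuous_image
      continuous_on_subset[OF cg]) auto
  then have cl: "closed (g ` (path_image c \<union> In))" by (rule compact_imp_closed)
  have un: "path_image c \<union> In \<union> Out = UNIV" using J(5) by blast
  have ginj: "g x = g y \<longleftrightarrow> x = y" for x y using hg' by metis
  have gS': "?S - {q} = range g" using hg unfolding homeomorphism_def by blast
  have B_eq: "B = ?S - g ` (path_image c \<union> In)"
  proof (intro set_eqI iffI)
    fix x assume "x \<in> B"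
    then consider "x = q" | y where "x = g y" "y \<in> Out" by (auto simp: B_def)
    then show "x \<in> ?S - g ` (path_image c \<union> In)"
    proof cases
      case 1 then show ?thesis using q gS by auto
    next
      case 2 then show ?thesis using gS ginj J(4,5) by auto
    qed
  next
    fix x assume x: "x \<in> ?S - g ` (path_image c \<union> In)"
    show "x \<in> B"
    proof (cases "x = q")
      case False
      then obtain y where "x = g y" using x gS' by blast
      then show ?thesis using x un by (auto simp: B_def)
    qed (simp add: B_def)
  qed
  have gc: "g ` path_image c = ?P" unfolding ic image_image using gh Psub by (force simp: image_iff)
  show ?thesis
  proof
    show "openin (top_of_set ?S) A" unfolding A_def by (rule op[OF J(1)])
    show "openin (top_of_set ?S) B" unfolding B_eq Diff_eq using cl
        by (simp add: openin_open_Int open_Compl)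
    show "A \<inter> B = {}" by (auto simp: A_def B_eq)
    have "g ` (path_image c \<union> In) = ?P \<union> A" by (simp only: image_Un gc A_def)
    moreover have "A \<inter> ?P = {}" unfolding gc[symmetric] A_def using ginj J(5) by auto
    moreover have "A \<subseteq> ?S" unfolding A_def using gS by auto
    ultimately show "A \<union> B = ?S - ?P" unfolding B_eq by blast
    have closure_g: "?P \<subseteq> closure (g ` U)" if "frontier U = path_image c" for U
    proof -
      have "g ` closure U \<subseteq> closure (g ` U)"
        by (rule image_closure_subset[OF continuous_on_subset[OF cg]]) (auto simp: closure_subset)
      moreover have "path_image c \<subseteq> closure U" using that by (auto simp: frontier_def)
      ultimately show ?thesis using gc by blast
    qed
    show "?P \<subseteq> closure A" unfolding A_def by (rule closure_g[OF J(6)])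
    show "?P \<subseteq> closure B" using closure_g[OF J(7)] closure_mono[of "g ` Out" B] by (auto simp: B_def)
  qed
qed

text \<open>The last clause reflects that the curve is the frontier of both sides; it is what forces
  different signs on the two sides near a point. Which side is called positive is left open.\<close>

definition side_function :: "(real ^ 3) set \<Rightarrow> (real ^ 3 \<Rightarrow> int) \<Rightarrow> bool" where
  "side_function P \<sigma> \<longleftrightarrow> range \<sigma> \<subseteq> {-1, 0, 1} \<and> (\<forall>x. \<sigma> x = 0 \<longleftrightarrow> x \<in> P) \<and>
     (\<forall>D. connected D \<longrightarrow> D \<subseteq> sphere 0 1 - P \<longrightarrow> \<sigma> constant_on D) \<and>
     (\<forall>x\<in>P. \<forall>r>0. \<forall>s\<in>{-1,1}. \<exists>y\<in>sphere 0 1. dist y x < r \<and> \<sigma> y = s)"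

lemma side_function_ex:
  fixes f :: "real \<Rightarrow> real ^ 3"
  assumes f: "simple_path f" "pathfinish f = pathstart f" and sub: "path_image f \<subseteq> sphere 0 1"
  shows "\<exists>\<sigma>. side_function (path_image f) \<sigma>"
proof -
  let ?S = "sphere (0 :: real ^ 3) 1"
  obtain A B where AB: "openin (top_of_set ?S) A" "openin (top_of_set ?S) B"
    "A \<inter> B = {}" "A \<union> B = ?S - path_image f" "path_image f \<subseteq> closure A" "path_image f \<subseteq> closure B"
    using Jordan_sphere[OF assms] by blast
  define \<sigma> where "\<sigma> x = (if x \<in> path_image f then 0 else if x \<in> A then 1 else - 1 :: int)" for x
  have sA: "A \<subseteq> ?S - path_image f" "B \<subseteq> ?S - path_image f" using AB(4) by auto
  have conn: "\<sigma> constant_on D" if D: "connected D" "D \<subseteq> ?S - path_image f" for D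
  proof -
    have "openin (top_of_set D) (D \<inter> A)" "openin (top_of_set D) (D \<inter> B)"
    proof -
      have "?S \<inter> A = A" "?S \<inter> B = B" "D \<subseteq> ?S" using sA D(2) by auto
      then show "openin (top_of_set D) (D \<inter> A)" "openin (top_of_set D) (D \<inter> B)"
        using AB(1,2) openin_subtopology_Int_subset by metis+
    qed
    moreover have "D \<inter> A \<union> D \<inter> B = D" "(D \<inter> A) \<inter> (D \<inter> B) = {}" using AB D by auto
    ultimately have "D \<inter> A = {} \<or> D \<inter> B = {}" using D(1) unfolding connected_openin_eq by meson
    then have "D \<subseteq> B \<or> D \<subseteq> A" using D(2) AB(4) by auto
    then show ?thesis
    proof
      assume "D \<subseteq> B"
      then have "\<sigma> x = -1" if "x \<in> D" for x using that sA AB(3) by (auto simp: \<sigma>_def)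
      then show ?thesis unfolding constant_on_def by blast
    next
      assume "D \<subseteq> A"
      then have "\<sigma> x = 1" if "x \<in> D" for x using that sA by (auto simp: \<sigma>_def)
      then show ?thesis unfolding constant_on_def by blast
    qed
  qed
  have adh: "\<exists>y\<in>?S. dist y x < r \<and> \<sigma> y = s" if "x \<in> path_image f" "r > 0" "s \<in> {-1,1}" for x r s
  proof -
    have "\<exists>y\<in>A. dist y x < r" "\<exists>y\<in>B. dist y x < r"
      using AB(5,6) that(1,2) by (auto simp: closure_approachable subset_iff)
    moreover have "\<sigma> y = 1" if "y \<in> A" for y using that sA by (auto simp: \<sigma>_def)
    moreover have "\<sigma> y = -1" if "y \<in> B" for y using that sA AB(3) by (auto simp: \<sigma>_def)
    ultimately show ?thesis using that(3) sA by blast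
  qed
  have "side_function (path_image f) \<sigma>" unfolding side_function_def using conn adh by (auto simp: \<sigma>_def)
  then show ?thesis by blast
qed

section \<open>The sides of a single lifted curve and their behaviour near its points\<close>

context regular_sphere_curve
begin

text \<open>The continuous function \<open>g (t + 1) \<bullet> g t\<close> takes only the values 1
  and -1, so it is constant.\<close>

lemma antiperiodic_cases:
  obtains "\<And>t. g (t + 1) = g t" | "\<And>t. g (t + 1) = - g t"
proof -
  have c: "continuous_on UNIV (\<lambda>t. g (t + 1) \<bullet> g t)"
    by (intro continuous_intros continuous_on_compose2[OF cont]) (auto intro: cont)
  have v: "g (t + 1) = g t \<and> g (t + 1) \<bullet> g t = 1 \<or> g (t + 1) = - g t \<and> g (t + 1) \<bullet> g t = -1" for t
    using simple[of "t + 1" t] by auto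
  have "(\<lambda>t. g (t + 1) \<bullet> g t) constant_on UNIV"
  proof (rule continuous_finite_range_constant)
    show "finite (range (\<lambda>t. g (t + 1) \<bullet> g t))"
      by (rule finite_subset[of _ "{1, -1}"]) (use v in auto)
  qed (use c in auto)
  then obtain k where k: "\<And>t. g (t + 1) \<bullet> g t = k" unfolding constant_on_def by auto
  then show ?thesis using that v by (metis one_neq_neg_one)
qed

lemma antiperiodic_eq_iff:
  assumes "\<And>t. g (t + 1) = - g t"
  shows "g s = g t \<longleftrightarrow> (\<exists>m::int. s - t = 2 * of_int m)"
proof -
  have "g (t + 2) = g t" for t using assms[of "t + 1"] assms[of t] by (simp add: add.assoc)
  then have n: "g (t + 2 * real m) = g t" for t m
    by (induction m) (simp_all add: algebra_simps, metis add.assoc add.commute)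
  have p: "g (t + 2 * of_int m) = g t" for t and m :: int
  proof (cases "m \<ge> 0")
    case True then show ?thesis using n[of t "nat m"] by simp
  next
    case False then show ?thesis using n[of "t + 2 * of_int m" "nat (-m)"] by simp
  qed
  show ?thesis
  proof
    assume eq: "g s = g t"
    then obtain z where z: "s - t = of_int z" using simple by (metis Ints_cases)
    show "\<exists>m::int. s - t = 2 * of_int m"
    proof (cases "even z")
      case True
      then show ?thesis using z by (auto elim!: evenE)
    next
      case False
      then obtain m where "z = 2 * m + 1" by (elim oddE)
      then have "s = (t + 1) + 2 * of_int m" using z by simp
      then have "g s = - g t" using p assms by metis
      then have "g t \<bullet> g t = - (g t \<bullet> g t)" using eq by (metis inner_minus_left)
      then show ?thesis by simp
    qed
  next
    assume "\<exists>m::int. s - t = 2 * of_int m"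
    then obtain m :: int where "s = t + 2 * of_int m" by (metis add.commute diff_eq_eq)
    then show "g s = g t" using p by simp
  qed
qed

lemma range_loop:
  "\<exists>f. simple_path f \<and> pathfinish f = pathstart f \<and> path_image f = range g" (is ?thesis)
proof -
  \<comment> \<open>The period \<open>p\<close> will be 1 or 2, according to
    \<open>antiperiodic_cases\<close>.\<close>
  have *: ?thesis if p: "p > 0" and per: "\<And>s t. g s = g t \<longleftrightarrow> (\<exists>m::int. s - t = p * of_int m)" for p
  proof (intro exI conjI)
    let ?f = "\<lambda>t. g (p * t)"
    show "simple_path ?f"
    proof (rule simple_pathI)
      show "path ?f" unfolding path_def by (intro continuous_on_compose2[OF cont] continuous_intros) auto
      fix x y :: real assume xy: "0 \<le> x" "x < y" "y \<le> 1" "?f x = ?f y"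
      then obtain m :: int where "p * x - p * y = p * of_int m" using per by blast
      then have "p * (y - x) = p * (- of_int m)" by (simp add: algebra_simps)
      then have m: "y - x = - of_int m" using p by (metis less_irrefl mult_left_cancel)
      then have "0 < - m" "- m \<le> 1" using xy by linarith+
      then have "m = - 1" by simp
      then have "y - x = 1" using m by simp
      then show "x = 0 \<and> y = 1" using xy by auto
    qed
    show "pathfinish ?f = pathstart ?f"
      using per[of p 0] by (auto simp: pathfinish_def pathstart_def intro: exI[of _ 1])
    show "path_image ?f = range g"
    proof (intro set_eqI iffI)
      fix x assume "x \<in> range g"
      then obtain t where t: "x = g t" by blast
      have "p * frac (t / p) - t = p * of_int (- \<lfloor>t / p\<rfloor>)" using p by (simp add: frac_def field_simps)
      then have "g (p * frac (t / p)) = x" using per t by blast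
      moreover have "frac (t / p) \<in> {0..1}" using frac_lt_1[of "t/p"] by (simp add: less_imp_le)
      ultimately show "x \<in> path_image ?f" unfolding path_image_def by blast
    qed (auto simp: path_image_def)
  qed
  show ?thesis
  proof (rule antiperiodic_cases)
    assume per: "\<And>t. g (t + 1) = g t"
    have n: "g (t + real m) = g t" for t m
    proof (induction m)
      case (Suc m)
      have "g (t + real (Suc m)) = g (t + real m + 1)" by (simp add: algebra_simps)
      then show ?case using Suc per by simp
    qed simp
    have "g (t + of_int m) = g t" for t m
    proof (cases "m \<ge> 0")
      case True then show ?thesis using n[of t "nat m"] by simp
    next
      case False then show ?thesis using n[of "t + of_int m" "nat (-m)"] by simp
    qed
    then have "g s = g t \<longleftrightarrow> (\<exists>m::int. s - t = 1 * of_int m)" for s t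
      using simple[of s t] by (metis Ints_cases add.commute diff_add_cancel mult_1)
    then show ?thesis using *[of 1] by simp
  next
    assume "\<And>t. g (t + 1) = - g t"
    then have "g s = g t \<longleftrightarrow> (\<exists>m::int. s - t = 2 * of_int m)" for s t by (rule antiperiodic_eq_iff)
    then show ?thesis using *[of 2] by simp
  qed
qed

lemma range_sphere: "range g \<subseteq> sphere 0 1" by auto

lemma side_ex: "\<exists>\<sigma>. side_function (range g) \<sigma>"
  using range_loop range_sphere side_function_ex by metis

end

text \<open>To first order \<open>\<sigma>\<close> is \<open>\<delta>\<close> times the sign of the
  component along \<open>w\<close>. This is tested along differentiable curves through
  \<open>v\<close> whose velocity has such a component, so that it applies to crossing curves
  directly.\<close>

definition tangential_sides :: "(real ^ 3 \<Rightarrow> int) \<Rightarrow> int \<Rightarrow> real ^ 3 \<Rightarrow> real ^ 3 \<Rightarrow> bool" where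
  "tangential_sides \<sigma> \<delta> v w \<longleftrightarrow> (\<forall>\<rho> d t0. \<rho> t0 = v \<longrightarrow> (\<rho> has_vector_derivative d) (at t0) \<longrightarrow>
     (\<forall>t. norm (\<rho> t) = 1) \<longrightarrow> d \<bullet> w \<noteq> 0 \<longrightarrow> (\<exists>\<epsilon>>0. \<forall>t. t \<noteq> t0 \<and> \<bar>t - t0\<bar> < \<epsilon> \<longrightarrow>
       real_of_int (\<sigma> (\<rho> t)) = of_int \<delta> * sgn ((t - t0) * (d \<bullet> w))))"

lemma tangential_sidesD:
  assumes "tangential_sides \<sigma> \<delta> v w" "\<rho> t0 = v" "(\<rho> has_vector_derivative d) (at t0)"
    "\<And>t. norm (\<rho> t) = 1" "d \<bullet> w \<noteq> 0"
  shows "\<exists>\<epsilon>>0. \<forall>t. t \<noteq> t0 \<and> \<bar>t - t0\<bar> < \<epsilon> \<longrightarrow>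
    real_of_int (\<sigma> (\<rho> t)) = of_int \<delta> * sgn ((t - t0) * (d \<bullet> w))"
  using assms(1)[unfolded tangential_sides_def, rule_format, OF assms(2-5)] by simp

context regular_sphere_curve
begin

context
  fixes \<sigma> :: "real ^ 3 \<Rightarrow> int" and s0 :: real
  assumes side: "side_function (range g) \<sigma>"
begin

text \<open>One half, chosen by \<open>e\<close> as 1 or -1, of a double cone around the normal, cut
  off by a ball. Its points are taken in the ambient space, which makes it convex;
  \<open>sgn\<close> brings them back to the sphere.\<close>

definition cone :: "real \<Rightarrow> real \<Rightarrow> real \<Rightarrow> (real ^ 3) set" where
  "cone e \<kappa> r = {y. dist y (g s0) < r \<and> \<kappa> * \<bar>y \<bullet> g' s0\<bar> < e * (y \<bullet> normal s0)}"

lemma side_const: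
  assumes "connected D" "\<And>y. y \<in> D \<Longrightarrow> y \<noteq> 0 \<and> sgn y \<notin> range g" "x \<in> D" "y \<in> D"
  shows "\<sigma> (sgn x) = \<sigma> (sgn y)"
proof -
  have "connected (sgn ` D)"
    by (intro connected_continuous_image assms(1) continuous_on_sgn continuous_on_id) (use assms(2) in auto)
  moreover have "sgn ` D \<subseteq> sphere 0 1 - range g" using assms(2) by (auto simp: norm_sgn)
  ultimately have "\<sigma> constant_on sgn ` D" using side unfolding side_function_def by blast
  then show ?thesis using assms(3,4) unfolding constant_on_def by (metis imageI)
qed

lemma cone_avoids:
  assumes "\<kappa> > 0"
  shows "\<exists>r>0. \<forall>e\<in>{-1,1}. \<forall>y\<in>cone e \<kappa> r. y \<noteq> 0 \<and> sgn y \<notin> range g"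
proof -
  obtain \<eta> where \<eta>: "\<eta> > 0" "\<And>s. \<bar>s - s0\<bar> < \<eta> \<Longrightarrow> \<bar>g s \<bullet> normal s0\<bar> \<le> \<kappa> * \<bar>g s \<bullet> g' s0\<bar>"
    using tangent_cone[OF assms, of s0] by blast
  obtain r where r: "r > 0" "\<And>y. dist y (g s0) < r \<Longrightarrow> y \<noteq> 0"
    "\<And>y. dist y (g s0) < r \<Longrightarrow> (\<exists>s. sgn y = g s \<or> sgn y = - g s) \<Longrightarrow> \<exists>s'. \<bar>s' - s0\<bar> < \<eta> \<and> sgn y = g s'"
    using near_param_sgn[OF \<eta>(1), of s0] by blast
  have "y \<noteq> 0 \<and> sgn y \<notin> range g" if e: "e \<in> {-1,1}" and y: "y \<in> cone e \<kappa> r" for e y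
  proof
    have yd: "dist y (g s0) < r" using y by (simp add: cone_def)
    then show y0: "y \<noteq> 0" by (rule r(2))
    show "sgn y \<notin> range g"
    proof
      assume "sgn y \<in> range g"
      then obtain s' where s': "\<bar>s' - s0\<bar> < \<eta>" "sgn y = g s'" using r(3)[OF yd] by blast
      have "y = norm y *\<^sub>R g s'" using y0 s'(2)[symmetric] by (simp add: sgn_div_norm)
      then have "\<bar>y \<bullet> normal s0\<bar> = norm y * \<bar>g s' \<bullet> normal s0\<bar>" "\<bar>y \<bullet> g' s0\<bar> = norm y * \<bar>g s' \<bullet> g' s0\<bar>"
        by (metis abs_mult abs_norm_cancel inner_scaleR_left)+
      then have "\<bar>y \<bullet> normal s0\<bar> \<le> \<kappa> * \<bar>y \<bullet> g' s0\<bar>"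
        using mult_left_mono[OF \<eta>(2)[OF s'(1)], of "norm y"] by (simp add: algebra_simps)
      moreover have "\<kappa> * \<bar>y \<bullet> g' s0\<bar> < e * (y \<bullet> normal s0)" using y by (simp add: cone_def)
      ultimately show False using e by auto
    qed
  qed
  then show ?thesis using r(1) by blast
qed

lemma connected_cone: "\<kappa> > 0 \<Longrightarrow> connected (cone e \<kappa> r)"
proof -
  assume \<kappa>: "\<kappa> > 0"
  let ?a = "\<kappa> *\<^sub>R g' s0 - e *\<^sub>R normal s0" and ?b = "(-\<kappa>) *\<^sub>R g' s0 - e *\<^sub>R normal s0"
  have abs: "\<kappa> * \<bar>z\<bar> < c \<longleftrightarrow> \<kappa> * z < c \<and> - (\<kappa> * z) < c" for z c
    using \<kappa> abs_less_iff[of "\<kappa> * z" c] by (simp add: abs_mult)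
  have "cone e \<kappa> r = ball (g s0) r \<inter> {y. ?a \<bullet> y < 0} \<inter> {y. ?b \<bullet> y < 0}"
    by (auto simp: cone_def abs inner_diff_left inner_diff_right inner_commute dist_commute)
  then have "convex (cone e \<kappa> r)" by (simp only:) (intro convex_Int convex_ball convex_halfspace_lt)
  then show ?thesis by (rule convex_connected)
qed

lemma axis_in_cone:
  assumes "e \<in> {-1,1}" "0 < h" "h * norm (normal s0) < r"
  shows "g s0 + (e * h) *\<^sub>R normal s0 \<in> cone e \<kappa> r"
proof -
  have "normal s0 \<bullet> normal s0 > 0" using norm_normal[of s0] regular[of s0] by auto
  moreover have "e * (e * h * x) = h * x" for x using assms(1) by auto
  ultimately show ?thesis using assms by (auto simp: cone_def dist_norm inner_add_left orthogonal_deriv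
      abs_mult)
qed

lemma normal_pos: "norm (normal s0) > 0"
  using norm_normal[of s0] regular[of s0] by simp

text \<open>Cones of all widths share points of the normal axis close to \<open>g s0\<close>, so
  their signs agree and \<open>a\<close> can be chosen independently of
  \<open>\<kappa>\<close>.\<close>

lemma side_ex_local:
  "\<exists>a::real \<Rightarrow> int. \<forall>\<kappa>>0. \<exists>r>0. \<forall>e\<in>{-1,1}. \<forall>y\<in>cone e \<kappa> r. y \<noteq> 0 \<and> sgn y \<notin> range g \<and> \<sigma> (sgn y) = a e"
proof -
  obtain r1 where r1: "r1 > 0" "\<And>e y. e \<in> {-1,1} \<Longrightarrow> y \<in> cone e 1 r1 \<Longrightarrow> y \<noteq> 0 \<and> sgn y \<notin> range g"
    using cone_avoids[of 1] by auto
  define N where "N = norm (normal s0)"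
  have N: "N > 0" using normal_pos by (simp add: N_def)
  define pt where "pt e h = g s0 + (e * h) *\<^sub>R normal s0" for e h
  define a where "a e = \<sigma> (sgn (pt e (r1 / (2 * N))))" for e
  have "\<exists>r>0. \<forall>e\<in>{-1,1}. \<forall>y\<in>cone e \<kappa> r. y \<noteq> 0 \<and> sgn y \<notin> range g \<and> \<sigma> (sgn y) = a e" if \<kappa>: "\<kappa> > 0" for \<kappa>
  proof -
    obtain r where r: "r > 0" "\<And>e y. e \<in> {-1,1} \<Longrightarrow> y \<in> cone e \<kappa> r \<Longrightarrow> y \<noteq> 0 \<and> sgn y \<notin> range g"
      using cone_avoids[OF \<kappa>] by auto
    have "\<sigma> (sgn y) = a e" if e: "e \<in> {-1,1}" and y: "y \<in> cone e \<kappa> r" for e y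
    proof -
      define h where "h = min r r1 / (2 * N)"
      have h: "0 < h" "h * N < r" "h * N < r1" using r(1) r1(1) N by (auto simp: h_def)
      have p1: "pt e h \<in> cone e \<kappa> r" "pt e h \<in> cone e 1 r1"
        using axis_in_cone[OF e] h unfolding pt_def N_def by auto
      have p2: "pt e (r1 / (2 * N)) \<in> cone e 1 r1"
        unfolding pt_def by (rule axis_in_cone[OF e]) (use r1(1) N in \<open>auto simp: N_def\<close>)
      have "\<sigma> (sgn y) = \<sigma> (sgn (pt e h))"
        by (rule side_const[OF connected_cone[OF \<kappa>] r(2)[OF e] y p1(1)])
      also have "\<dots> = a e" unfolding a_def
        by (rule side_const[OF connected_cone[of 1] r1(2)[OF e] p1(2) p2]) simp
      finally show ?thesis .
    qed
    then show ?thesis using r by blast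
  qed
  then show ?thesis by blast
qed

text \<open>Moving from \<open>x\<close> along the normal direction meets the curve at most once near \<open>g s0\<close>,
  so one of the two ways leads into a cone.\<close>

lemma reach_cone:
  "\<exists>r>0. \<forall>x. dist x (g s0) < r \<and> sgn x \<notin> range g \<longrightarrow>
     (\<exists>e\<in>{-1,1}. \<exists>y\<in>cone e 1 R. \<sigma> (sgn x) = \<sigma> (sgn y))" if R0: "R0 > 0" "R0 \<le> R"
proof -
  let ?v = "g s0" and ?u = "g' s0" and ?w = "normal s0"
  define N where "N = norm ?w"
  have N: "N > 0" using normal_pos by (simp add: N_def)
  have Nu: "norm ?u = N" by (simp add: N_def norm_normal)
  obtain \<eta> where \<eta>: "\<eta> > 0" "\<And>s. \<bar>s - s0\<bar> < \<eta> \<Longrightarrow> g s \<bullet> ?v > 0"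
    "\<And>s s'. \<bar>s - s0\<bar> < \<eta> \<Longrightarrow> \<bar>s' - s0\<bar> < \<eta> \<Longrightarrow>
      (g s \<bullet> ?u) / (g s \<bullet> ?v) = (g s' \<bullet> ?u) / (g s' \<bullet> ?v) \<Longrightarrow> s = s'"
    using slope_injective[of s0] by blast
  obtain r1 where r1: "r1 > 0" "\<And>y. dist y ?v < r1 \<Longrightarrow> y \<noteq> 0"
    "\<And>y. dist y ?v < r1 \<Longrightarrow> sgn y \<in> range g \<Longrightarrow> \<exists>s'. \<bar>s' - s0\<bar> < \<eta> \<and> sgn y = g s'"
    using near_param_sgn[OF \<eta>(1), of s0] by blast
  define Q where "Q = min R0 r1"
  have Q: "Q > 0" "Q \<le> R" "Q \<le> r1" using r1(1) R0 by (auto simp: Q_def)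
  define H where "H = Q / (2 * N)"
  have H: "H > 0" "H * N = Q / 2" using Q N by (auto simp: H_def)
  have "\<exists>e\<in>{-1,1}. \<exists>y\<in>cone e 1 R. \<sigma> (sgn x) = \<sigma> (sgn y)" if x: "dist x ?v < Q / 4" "sgn x \<notin> range g" for x
  proof -
    have mv: "dist (x + \<theta> *\<^sub>R ?w) ?v < Q" if "\<bar>\<theta>\<bar> \<le> H" for \<theta>
    proof -
      have "\<bar>\<theta>\<bar> * N \<le> Q / 2" using mult_right_mono[OF that, of N] H N by simp
      moreover have "dist (x + \<theta> *\<^sub>R ?w) ?v \<le> dist x ?v + \<bar>\<theta>\<bar> * N"
        using norm_triangle_ineq[of "x - ?v" "\<theta> *\<^sub>R ?w"] by (simp add: dist_norm N_def algebra_simps)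
      ultimately show ?thesis using x Q by simp
    qed
    have top: "x + (e * H) *\<^sub>R ?w \<in> cone e 1 R" if e: "e \<in> {-1,1}" for e
    proof -
      have ee: "e * (e * z) = z" for z using e by auto
      have d: "dist (x + (e * H) *\<^sub>R ?w) ?v < R" using mv[of "e * H"] e H Q by auto
      have 1: "\<bar>(x - ?v) \<bullet> a\<bar> < Q / 4 * N" if "norm a = N" for a
      proof -
        have "\<bar>(x - ?v) \<bullet> a\<bar> \<le> norm (x - ?v) * N" using Cauchy_Schwarz_ineq2[of "x - ?v" a] that by simp
        also have "\<dots> < Q / 4 * N" using x(1) N by (intro mult_strict_right_mono) (auto simp: dist_norm)
        finally show ?thesis .
      qed
      have "(x + (e * H) *\<^sub>R ?w) \<bullet> ?u = (x - ?v) \<bullet> ?u"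
        by (simp add: inner_add_left inner_diff_left orthogonal_deriv)
      moreover have "e * ((x + (e * H) *\<^sub>R ?w) \<bullet> ?w) = e * ((x - ?v) \<bullet> ?w) + H * N * N"
        by (simp add: inner_add_left inner_diff_left distrib_left ee N_def dot_square_norm
            power2_eq_square mult.assoc)
      moreover have "e * ((x - ?v) \<bullet> ?w) \<ge> - \<bar>(x - ?v) \<bullet> ?w\<bar>" using e by auto
      moreover have "H * N * N = Q / 2 * N" using H by simp
      ultimately have "\<bar>(x + (e * H) *\<^sub>R ?w) \<bullet> ?u\<bar> < e * ((x + (e * H) *\<^sub>R ?w) \<bullet> ?w)"
        using 1[of ?u, OF Nu] 1[of ?w, OF N_def[symmetric]] by linarith
      then show ?thesis using d by (simp add: cone_def)
    qed
    have seg: "\<sigma> (sgn x) = \<sigma> (sgn (x + (e * H) *\<^sub>R ?w))"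
      if e: "e \<in> {-1,1}" and av: "\<And>\<theta>. 0 \<le> \<theta> \<Longrightarrow> \<theta> \<le> H \<Longrightarrow> sgn (x + (e * \<theta>) *\<^sub>R ?w) \<notin> range g" for e
    proof (rule side_const)
      let ?D = "(\<lambda>\<theta>. x + (e * \<theta>) *\<^sub>R ?w) ` {0..H}"
      show "connected ?D" by (intro connected_continuous_image continuous_intros) auto
      show "y \<noteq> 0 \<and> sgn y \<notin> range g" if "y \<in> ?D" for y
      proof -
        obtain \<theta> where \<theta>: "0 \<le> \<theta>" "\<theta> \<le> H" "y = x + (e * \<theta>) *\<^sub>R ?w" using \<open>y \<in> ?D\<close> by auto
        have "dist y ?v < r1" using mv[of "e * \<theta>"] \<theta> e Q by auto
        then show ?thesis using r1(2) av \<theta> by blast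
      qed
      show "x \<in> ?D" using H by (intro image_eqI[of _ _ 0]) auto
      show "x + (e * H) *\<^sub>R ?w \<in> ?D" using H by auto
    qed
    show ?thesis
    proof (rule ccontr)
      assume neg: "\<not> ?thesis"
      have "\<exists>\<theta>. 0 \<le> \<theta> \<and> \<theta> \<le> H \<and> sgn (x + (e * \<theta>) *\<^sub>R ?w) \<in> range g" if e: "e \<in> {-1,1}" for e
        using seg[OF e] top[OF e] neg e by blast
      from this[of 1] this[of "-1"] obtain \<theta>1 \<theta>2 where \<theta>:
        "0 \<le> \<theta>1" "\<theta>1 \<le> H" "sgn (x + \<theta>1 *\<^sub>R ?w) \<in> range g"
        "0 \<le> \<theta>2" "\<theta>2 \<le> H" "sgn (x + (-\<theta>2) *\<^sub>R ?w) \<in> range g" by auto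
      define y1 where "y1 = x + \<theta>1 *\<^sub>R ?w"
      define y2 where "y2 = x + (-\<theta>2) *\<^sub>R ?w"
      have near: "dist y1 ?v < r1" "dist y2 ?v < r1"
        using mv[of \<theta>1] mv[of "-\<theta>2"] \<theta> Q unfolding y1_def y2_def by auto
      obtain s1 where s1: "\<bar>s1 - s0\<bar> < \<eta>" "sgn y1 = g s1" using r1(3)[OF near(1)] \<theta> y1_def by blast
      obtain s2 where s2: "\<bar>s2 - s0\<bar> < \<eta>" "sgn y2 = g s2" using r1(3)[OF near(2)] \<theta> y2_def by blast
      have n: "norm y1 > 0" "norm y2 > 0" using near r1(2) by auto
      have y: "y1 = norm y1 *\<^sub>R g s1" "y2 = norm y2 *\<^sub>R g s2"
        using n s1(2)[symmetric] s2(2)[symmetric] by (simp_all add: sgn_div_norm)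
      \<comment> \<open>Moving along the normal changes neither the tangential nor the radial
        component. So both hits have the same slope and by \<open>slope_injective\<close> the same
        parameter.\<close>
      have u: "y1 \<bullet> ?u = y2 \<bullet> ?u" "y1 \<bullet> ?v = y2 \<bullet> ?v" by (simp_all add: y1_def y2_def inner_add_left
          inner_diff_left)
      have q: "(y1 \<bullet> ?u) / (y1 \<bullet> ?v) = (g s1 \<bullet> ?u) / (g s1 \<bullet> ?v)" "(y2 \<bullet> ?u) / (y2 \<bullet> ?v) = (g s2 \<bullet> ?u) /
          (g s2 \<bullet> ?v)"
        using n by (subst (1 2) y, simp)+
      have ss: "s1 = s2" using \<eta>(3)[OF s1(1) s2(1)] q u by simp
      have "norm y1 * (g s1 \<bullet> ?v) = norm y2 * (g s1 \<bullet> ?v)" using u(2) y ss by (metis inner_scaleR_left)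
      then have "norm y1 = norm y2" using \<eta>(2)[OF s1(1)] by simp
      then have "y1 = y2" using y ss by metis
      then have "(\<theta>1 + \<theta>2) *\<^sub>R ?w = 0" unfolding y1_def y2_def
          by (simp add: scaleR_left_distrib add_eq_0_iff)
      then have "\<theta>1 = 0" using N \<theta> by (auto simp: N_def)
      then show False using \<theta>(3) x(2) by simp
    qed
  qed
  then show ?thesis using Q(1) by (intro exI[of _ "Q/4"]) auto
qed

lemma side_local:
  "\<exists>\<delta>\<in>{-1,1}. tangential_sides \<sigma> \<delta> (g s0) (normal s0)"
proof -
  obtain a :: "real \<Rightarrow> int" where a: "\<And>\<kappa>. \<kappa> > 0 \<Longrightarrow> \<exists>r>0. \<forall>e\<in>{-1,1}. \<forall>y\<in>cone e \<kappa> r. y \<noteq> 0 \<and>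
      sgn y \<notin> range g \<and> \<sigma> (sgn y) = a e"
    using side_ex_local by blast
  obtain R where R: "R > 0" "\<And>e y. e \<in> {-1,1} \<Longrightarrow> y \<in> cone e 1 R \<Longrightarrow> \<sigma> (sgn y) = a e"
    using a[of 1] by auto
  obtain r where r: "r > 0" "\<And>x. dist x (g s0) < r \<Longrightarrow> sgn x \<notin> range g \<Longrightarrow>
      \<exists>e\<in>{-1,1}. \<exists>y\<in>cone e 1 R. \<sigma> (sgn x) = \<sigma> (sgn y)"
    using reach_cone[OF R(1) order_refl] by blast
  \<comment> \<open>Both signs occur arbitrarily close to \<open>g s0\<close> and can be carried
    into a cone, so the two halves of the cone have opposite signs.\<close>
  have two: "\<exists>e\<in>{-1,1}. a e = s" if s: "s \<in> {-1,1}" for s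
  proof -
    obtain x where x: "x \<in> sphere 0 1" "dist x (g s0) < r" "\<sigma> x = s"
      using side r(1) s unfolding side_function_def by blast
    have "sgn x = x" using x(1) by (simp add: sgn_div_norm)
    moreover have "\<sigma> x = 0 \<longleftrightarrow> x \<in> range g" using side unfolding side_function_def by blast
    then have "x \<notin> range g" using x(3) s by auto
    ultimately show ?thesis using r(2)[OF x(2)] R(2) x(3) by metis
  qed
  have aa: "a 1 \<in> {-1,1}" "a (-1) = - a 1" using two[of 1] two[of "-1"] by auto
  have ae: "real_of_int (a e) = of_int (a 1) * e" if "e \<in> {-1,1}" for e using that aa(2) by auto
  show ?thesis
    unfolding tangential_sides_def
  proof (intro bexI[OF _ aa(1)] allI impI)
    fix \<rho> :: "real \<Rightarrow> real ^ 3" and d t0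
    assume \<rho>: "\<rho> t0 = g s0" "(\<rho> has_vector_derivative d) (at t0)" and un: "\<forall>t. norm (\<rho> t) = 1"
        and nz: "d \<bullet> normal s0 \<noteq> 0"
    obtain \<kappa> where \<kappa>: "\<kappa> > 0" "\<And>r. r > 0 \<Longrightarrow> \<exists>\<epsilon>>0. \<forall>t. t \<noteq> t0 \<and> \<bar>t - t0\<bar> < \<epsilon> \<longrightarrow> dist (\<rho> t) (g s0) < r \<and>
       \<kappa> * \<bar>\<rho> t \<bullet> g' s0\<bar> < sgn ((t - t0) * (d \<bullet> normal s0)) * (\<rho> t \<bullet> normal s0)"
      using enter_cone[OF \<rho> orthogonal_deriv normal_inner(1) nz] by blast
    obtain q where q: "q > 0" "\<And>e y. e \<in> {-1,1} \<Longrightarrow> y \<in> cone e \<kappa> q \<Longrightarrow> \<sigma> (sgn y) = a e"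
      using a[OF \<kappa>(1)] by auto
    obtain \<epsilon> where \<epsilon>: "\<epsilon> > 0" "\<And>t. t \<noteq> t0 \<Longrightarrow> \<bar>t - t0\<bar> < \<epsilon> \<Longrightarrow>
        \<rho> t \<in> cone (sgn ((t - t0) * (d \<bullet> normal s0))) \<kappa> q"
      using \<kappa>(2)[OF q(1)] unfolding cone_def by blast
    have "real_of_int (\<sigma> (\<rho> t)) = of_int (a 1) * sgn ((t - t0) * (d \<bullet> normal s0))"
      if t: "t \<noteq> t0" "\<bar>t - t0\<bar> < \<epsilon>" for t
    proof -
      have e: "sgn ((t - t0) * (d \<bullet> normal s0)) \<in> {-1,1}" using t(1) nz by (auto simp: sgn_if)
      have "sgn (\<rho> t) = \<rho> t" using un by (simp add: sgn_div_norm)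
      then show ?thesis using q(2)[OF e \<epsilon>(2)[OF t]] ae[OF e] by simp
    qed
    then show "\<exists>\<epsilon>>0. \<forall>t. t \<noteq> t0 \<and> \<bar>t - t0\<bar> < \<epsilon> \<longrightarrow> real_of_int (\<sigma> (\<rho> t)) = of_int (a 1) * sgn ((t - t0) *
        (d \<bullet> normal s0))"
      using \<epsilon>(1) by blast
  qed
qed

end

end

section \<open>Lifting curves from the projective plane\<close>

lemma Rep_rp2_subspace: "subspace (Rep_rp2 p)" and Rep_rp2_dim: "dim (Rep_rp2 p) = 1"
  using Rep_rp2[of p] by auto

lemma Rep_rp2_span:
  assumes "x \<in> Rep_rp2 p" "x \<noteq> 0" shows "Rep_rp2 p = span {x}"
proof (rule sym, rule subspace_dim_equal)
  show "span {x} \<subseteq> Rep_rp2 p" using assms Rep_rp2_subspace by (simp add: span_minimal)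
  show "dim (Rep_rp2 p) \<le> dim (span {x})" using assms(2) by (simp add: Rep_rp2_dim)
qed (simp_all add: Rep_rp2_subspace)

lemma Rep_rp2_multiple:
  assumes "x \<in> Rep_rp2 p" "x \<noteq> 0" "y \<in> Rep_rp2 p" obtains a where "y = a *\<^sub>R x"
  using assms Rep_rp2_span[OF assms(1,2)] by (auto simp: span_singleton)

lemma Rep_rp2_unit:
  assumes "x \<in> Rep_rp2 p" "y \<in> Rep_rp2 p" "norm x = 1" "norm y = 1" shows "y = x \<or> y = - x"
proof -
  have "x \<noteq> 0" using assms by auto
  then obtain a where a: "y = a *\<^sub>R x" using Rep_rp2_multiple assms by blast
  then have "\<bar>a\<bar> = 1" using assms by simp
  then show ?thesis using a by (auto simp: abs_if split: if_splits)
qed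

lemma Rep_rp2_nonzero: obtains x where "x \<in> Rep_rp2 p" "x \<noteq> 0"
proof -
  have "\<not> Rep_rp2 p \<subseteq> {0}" using Rep_rp2_dim[of p] dim_eq_0[of "Rep_rp2 p"] by simp
  then show ?thesis using that by blast
qed

lemma Rep_rp2_eqI: "x \<in> Rep_rp2 p \<Longrightarrow> x \<in> Rep_rp2 q \<Longrightarrow> x \<noteq> 0 \<Longrightarrow> p = q"
  using Rep_rp2_span Rep_rp2_inject by metis

lemma chart_dom_cover: "\<exists>k. p \<in> chart_dom k"
proof -
  obtain x where x: "x \<in> Rep_rp2 p" "x \<noteq> 0" by (rule Rep_rp2_nonzero)
  then obtain k where "x $ k \<noteq> 0" by (metis vec_eq_iff zero_index)
  then show ?thesis using x by (auto simp: chart_dom_def)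
qed

lemma chart:
  assumes "p \<in> chart_dom k" shows "chart k p \<in> Rep_rp2 p" "chart k p $ k = 1"
proof -
  obtain x where x: "x \<in> Rep_rp2 p" "x $ k \<noteq> 0" using assms by (auto simp: chart_dom_def)
  then have x0: "x \<noteq> 0" by auto
  let ?y = "(1 / x $ k) *\<^sub>R x"
  have y: "?y \<in> Rep_rp2 p \<and> ?y $ k = 1" using x subspace_scale[OF Rep_rp2_subspace] by auto
  have "z = ?y" if z: "z \<in> Rep_rp2 p \<and> z $ k = 1" for z
  proof -
    obtain a where a: "z = a *\<^sub>R x" using Rep_rp2_multiple[OF x(1) x0] z by blast
    then have "a = 1 / x $ k" using z x(2) by (simp add: field_simps)
    then show ?thesis using a by simp
  qed
  then have "chart k p = ?y" unfolding chart_def using y by (intro the_equality) auto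
  then show "chart k p \<in> Rep_rp2 p" "chart k p $ k = 1" using y by auto
qed

lemma chart_nonzero: "p \<in> chart_dom k \<Longrightarrow> chart k p \<noteq> 0"
  using chart(2) by fastforce

lemma chart_derivative:
  assumes "smooth_map c"
  shows "c t \<in> chart_dom k \<Longrightarrow> ((\<lambda>s. chart k (c s)) has_vector_derivative velocity k c t) (at t)"
    and "continuous_on (c -` chart_dom k) (velocity k c)"
proof -
  let ?U = "c -` chart_dom k"
  have op: "open ?U" using assms by (simp add: smooth_map_def)
  obtain D where D: "\<And>t. t \<in> ?U \<Longrightarrow> D 0 t = chart k (c t)"
    "\<And>m t. t \<in> ?U \<Longrightarrow> (D m has_vector_derivative D (Suc m) t) (at t)"
    using assms unfolding smooth_map_def smooth_real_on_def by metis
  have d: "((\<lambda>s. chart k (c s)) has_vector_derivative D 1 t) (at t)" if "t \<in> ?U" for t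
    using has_vector_derivative_transform_within_open[OF D(2)[OF that, of 0] op that D(1)] by simp
  then have v: "velocity k c t = D 1 t" if "t \<in> ?U" for t
    unfolding velocity_def using that vector_derivative_at by blast
  show "c t \<in> chart_dom k \<Longrightarrow> ((\<lambda>s. chart k (c s)) has_vector_derivative velocity k c t) (at t)"
    using d v by simp
  have "continuous_on ?U (D 1)"
    using D(2)[of _ 1] by (meson continuous_at_imp_continuous_on has_vector_derivative_continuous)
  then show "continuous_on ?U (velocity k c)" by (rule continuous_on_eq) (use v in auto)
qed

lemma velocity_component:
  assumes "smooth_map c" "c t \<in> chart_dom k" shows "velocity k c t $ k = 0"
proof -
  have op: "open (c -` chart_dom k)" using assms by (simp add: smooth_map_def)
  have 1: "((\<lambda>s. chart k (c s) $ k) has_vector_derivative velocity k c t $ k) (at t)"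
    by (rule bounded_linear.has_vector_derivative[OF bounded_linear_vec_nth chart_derivative(1)[OF assms]])
  have "((\<lambda>s. chart k (c s) $ k) has_vector_derivative 0) (at t)"
    by (rule has_vector_derivative_transform_within_open[OF has_vector_derivative_const[of 1] op]) (use
        assms chart(2) in auto)
  then show ?thesis using 1 vector_derivative_unique_at by blast
qed

definition unit_lift_on :: "real set \<Rightarrow> (real \<Rightarrow> rp2) \<Rightarrow> (real \<Rightarrow> real ^ 3) \<Rightarrow> bool" where
  "unit_lift_on S c f \<longleftrightarrow> continuous_on S f \<and> (\<forall>t\<in>S. norm (f t) = 1 \<and> f t \<in> Rep_rp2 (c t))"

lemma unit_lift_neg: "unit_lift_on S c f \<Longrightarrow> unit_lift_on S c (\<lambda>t. - f t)"
  unfolding unit_lift_on_def using subspace_neg[OF Rep_rp2_subspace] by (auto intro: continuous_on_minus)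

lemma unit_lift_unique:
  assumes f: "unit_lift_on S c f" and g: "unit_lift_on S c g" and S: "connected S"
  shows "(\<forall>t\<in>S. g t = f t) \<or> (\<forall>t\<in>S. g t = - f t)"
proof -
  have v: "g t = f t \<and> g t \<bullet> f t = 1 \<or> g t = - f t \<and> g t \<bullet> f t = -1" if "t \<in> S" for t
  proof -
    have "g t = f t \<or> g t = - f t" using Rep_rp2_unit f g that unfolding unit_lift_on_def by blast
    moreover have "f t \<bullet> f t = 1" using f that by (simp add: unit_lift_on_def dot_square_norm)
    ultimately show ?thesis by auto
  qed
  have "(\<lambda>t. g t \<bullet> f t) constant_on S"
  proof (rule continuous_finite_range_constant[OF S])
    show "continuous_on S (\<lambda>t. g t \<bullet> f t)" using f g unfolding unit_lift_on_def
        by (intro continuous_intros) auto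
    show "finite ((\<lambda>t. g t \<bullet> f t) ` S)" by (rule finite_subset[of _ "{1, -1}"]) (use v in auto)
  qed
  then obtain k where "\<And>t. t \<in> S \<Longrightarrow> g t \<bullet> f t = k" unfolding constant_on_def by auto
  then show ?thesis using v by (metis one_neq_neg_one)
qed

lemma unit_lift_chart:
  assumes "smooth_map c" "S \<subseteq> c -` chart_dom k"
  shows "unit_lift_on S c (\<lambda>t. sgn (chart k (c t)))"
  unfolding unit_lift_on_def
proof (intro conjI ballI)
  have "continuous_on S (\<lambda>t. chart k (c t))"
    using chart_derivative(1)[OF assms(1)] assms(2)
    by (intro continuous_at_imp_continuous_on ballI) (auto intro: has_vector_derivative_continuous)
  then show "continuous_on S (\<lambda>t. sgn (chart k (c t)))"
    using assms(2) chart_nonzero by (intro continuous_on_sgn) auto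
  fix t assume "t \<in> S"
  then have t: "c t \<in> chart_dom k" using assms(2) by auto
  show "norm (sgn (chart k (c t))) = 1" using chart_nonzero[OF t] by (simp add: norm_sgn)
  show "sgn (chart k (c t)) \<in> Rep_rp2 (c t)"
    using chart(1)[OF t] subspace_scale[OF Rep_rp2_subspace] by (simp add: sgn_div_norm)
qed

text \<open>Locally a chart provides a lift, and lifts on adjacent intervals can be glued after a
  change of sign; bisection does the rest.\<close>

lemma unit_lift_interval:
  assumes c: "smooth_map c" and "a \<le> b"
  shows "\<exists>f. unit_lift_on {a..b} c f"
  using assms(2)
proof (induction rule: Bolzano)
  case (trans a b d)
  then obtain f g where f: "unit_lift_on {a..b} c f" and g: "unit_lift_on {b..d} c g" by blast
  obtain g' where g': "unit_lift_on {b..d} c g'" "g' b = f b"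
  proof -
    have "g b = f b \<or> - g b = f b"
      using Rep_rp2_unit[of "f b" "c b" "g b"] f g trans by (auto simp: unit_lift_on_def)
    then show thesis using that g unit_lift_neg[OF g] by blast
  qed
  have "unit_lift_on ({a..b} \<union> {b..d}) c (\<lambda>t. if t \<le> b then f t else g' t)"
    unfolding unit_lift_on_def
  proof
    show "continuous_on ({a..b} \<union> {b..d}) (\<lambda>t. if t \<le> b then f t else g' t)"
      by (rule continuous_on_cases) (use f g' in \<open>auto simp: unit_lift_on_def\<close>)
    show "\<forall>t\<in>{a..b} \<union> {b..d}. norm (if t \<le> b then f t else g' t) = 1 \<and>
        (if t \<le> b then f t else g' t) \<in> Rep_rp2 (c t)"
      using f g' by (auto simp: unit_lift_on_def)
  qed
  moreover have "{a..b} \<union> {b..d} = {a..d}" using trans by auto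
  ultimately show ?case by auto
next
  case (local x)
  obtain k where k: "c x \<in> chart_dom k" using chart_dom_cover by blast
  have "open (c -` chart_dom k)" using c by (simp add: smooth_map_def)
  then obtain d where d: "d > 0" "ball x d \<subseteq> c -` chart_dom k" using k open_contains_ball by blast
  have "unit_lift_on {a..b} c (\<lambda>t. sgn (chart k (c t)))" if "a \<le> x \<and> x \<le> b \<and> b - a < d" for a b
    by (rule unit_lift_chart[OF c]) (use that d in \<open>auto simp: subset_iff dist_real_def abs_if\<close>)
  then show ?case using d(1) by blast
qed

lemma unit_lift_ex:
  assumes c: "smooth_map c" shows "\<exists>f. unit_lift_on UNIV c f"
proof -
  obtain x0 where x0: "x0 \<in> Rep_rp2 (c 0)" "norm x0 = 1"
  proof -
    obtain x where x: "x \<in> Rep_rp2 (c 0)" "x \<noteq> 0" by (rule Rep_rp2_nonzero)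
    then have "sgn x \<in> Rep_rp2 (c 0)" using subspace_scale[OF Rep_rp2_subspace] by (simp add: sgn_div_norm)
    then show thesis using that x by (simp add: norm_sgn)
  qed
  \<comment> \<open>A common value \<open>x0\<close> at 0 removes the choice of sign, so the lifts
    on growing intervals extend each other.\<close>
  have "\<exists>f. unit_lift_on {- real N..real N} c f \<and> f 0 = x0" for N
  proof -
    obtain f where f: "unit_lift_on {- real N..real N} c f"
        using unit_lift_interval[OF c, of "- real N" "real N"] by auto
    have "f 0 = x0 \<or> - f 0 = x0" using Rep_rp2_unit[of x0 "c 0" "f 0"] f x0 by (auto simp: unit_lift_on_def)
    then show ?thesis using f unit_lift_neg[OF f] by blast
  qed
  then obtain F where F: "\<And>N. unit_lift_on {- real N..real N} c (F N)" "\<And>N. F N 0 = x0" by metis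
  have agree: "F M t = F N t" if "\<bar>t\<bar> \<le> real M" "M \<le> N" for M N t
  proof -
    have sub: "{- real M..real M} \<subseteq> {- real N..real N}" using that by auto
    have "unit_lift_on {- real M..real M} c (F N)"
      using F(1)[of N] continuous_on_subset[OF _ sub] sub unfolding unit_lift_on_def by blast
    then have "(\<forall>t\<in>{- real M..real M}. F N t = F M t) \<or> (\<forall>t\<in>{- real M..real M}. F N t = - F M t)"
      by (rule unit_lift_unique[OF F(1)]) simp
    moreover have "F N 0 \<noteq> - F M 0"
    proof
      assume "F N 0 = - F M 0"
      then have "x0 = - x0" using F(2) by simp
      then have "x0 \<bullet> x0 = - (x0 \<bullet> x0)" by (metis inner_minus_left)
      then show False using x0 by (simp add: dot_square_norm)
    qed
    moreover have "0 \<in> {- real M..real M}" "t \<in> {- real M..real M}" using that by auto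
    ultimately show ?thesis by metis
  qed
  define f where "f t = F (nat \<lceil>\<bar>t\<bar>\<rceil>) t" for t
  have f_eq: "f t = F N t" if "\<bar>t\<bar> \<le> real N" for t N
    unfolding f_def by (rule agree) (use that in linarith)+
  have "isCont f t" for t
  proof -
    define N where "N = nat \<lceil>\<bar>t\<bar>\<rceil> + 1"
    have t: "\<bar>t\<bar> < real N" unfolding N_def by linarith
    have "isCont (F N) t"
      using F(1)[of N] t unfolding unit_lift_on_def
      by (intro continuous_on_interior[of "{- real N..real N}"]) auto
    moreover have "\<forall>\<^sub>F s in nhds t. f s = F N s"
    proof (rule eventually_nhds_in_open[THEN eventually_mono])
      show "open {- real N<..<real N}" by simp
      show "t \<in> {- real N<..<real N}" using t by auto
      show "s \<in> {- real N<..<real N} \<Longrightarrow> f s = F N s" for s by (rule f_eq) auto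
    qed
    ultimately show ?thesis using isCont_cong by blast
  qed
  then have "continuous_on UNIV f" by (simp add: continuous_at_imp_continuous_on)
  moreover have "norm (f t) = 1 \<and> f t \<in> Rep_rp2 (c t)" for t
  proof -
    define N where "N = nat \<lceil>\<bar>t\<bar>\<rceil>"
    have "\<bar>t\<bar> \<le> real N" unfolding N_def by linarith
    then have "t \<in> {- real N..real N}" by auto
    then show ?thesis using F(1)[of N] unfolding unit_lift_on_def f_def N_def[symmetric] by blast
  qed
  ultimately show ?thesis unfolding unit_lift_on_def by blast
qed

text \<open>Locally \<open>f\<close> is the chart expression times \<open>m\<close>, which is plus
  or minus the inverse of its norm, and \<open>m'\<close> is the derivative of \<open>m\<close>. So
  the lift inherits a continuous derivative.\<close>

lemma unit_lift_local_derivative: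
  assumes c: "smooth_map c" and f: "unit_lift_on UNIV c f" and k: "c t0 \<in> chart_dom k"
  obtains d m m' where "d > 0" "ball t0 d \<subseteq> c -` chart_dom k"
    "\<And>t. t \<in> ball t0 d \<Longrightarrow> f t = m t *\<^sub>R chart k (c t) \<and> m t \<noteq> 0 \<and>
      (f has_vector_derivative (m t *\<^sub>R velocity k c t + m' t *\<^sub>R chart k (c t))) (at t)"
    "continuous_on (ball t0 d) (\<lambda>t. m t *\<^sub>R velocity k c t + m' t *\<^sub>R chart k (c t))"
proof -
  let ?g = "\<lambda>t. chart k (c t)" and ?g' = "velocity k c"
  have "open (c -` chart_dom k)" using c by (simp add: smooth_map_def)
  then obtain d where d: "d > 0" "ball t0 d \<subseteq> c -` chart_dom k" using k open_contains_ball by blast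
  let ?B = "ball t0 d"
  have "unit_lift_on ?B c f" using f continuous_on_subset unfolding unit_lift_on_def by blast
  then have "(\<forall>t\<in>?B. f t = sgn (?g t)) \<or> (\<forall>t\<in>?B. f t = - sgn (?g t))"
    by (rule unit_lift_unique[OF unit_lift_chart[OF c d(2)]]) simp
  then have "\<exists>e::real. e \<noteq> 0 \<and> (\<forall>t\<in>?B. f t = e *\<^sub>R sgn (?g t))"
  proof
    assume "\<forall>t\<in>?B. f t = sgn (?g t)" then show ?thesis by (intro exI[of _ 1]) auto
  next
    assume "\<forall>t\<in>?B. f t = - sgn (?g t)" then show ?thesis by (intro exI[of _ "-1"]) auto
  qed
  then obtain e :: real where e: "e \<noteq> 0" "\<And>t. t \<in> ?B \<Longrightarrow> f t = e *\<^sub>R sgn (?g t)" by blast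
  define m where "m t = e * inverse (sqrt (?g t \<bullet> ?g t))" for t
  define m' where "m' t = e * (- (?g t \<bullet> ?g' t) * inverse (sqrt (?g t \<bullet> ?g t)) ^ 3)" for t
  have B: "c t \<in> chart_dom k" if "t \<in> ?B" for t using that d by auto
  have fm: "f t = m t *\<^sub>R ?g t" if "t \<in> ?B" for t
    using e(2)[OF that] by (simp add: m_def sgn_div_norm norm_eq_sqrt_inner)
  have pos: "?g t \<bullet> ?g t > 0" if "t \<in> ?B" for t using chart_nonzero[OF B[OF that]] by simp
  have dg: "(?g has_vector_derivative ?g' t) (at t)" if "t \<in> ?B" for t
      by (rule chart_derivative(1)[OF c B[OF that]])
  have dm: "(m has_real_derivative m' t) (at t)" if t: "t \<in> ?B" for t
  proof -
    have "((\<lambda>t. ?g t \<bullet> ?g t) has_vector_derivative (?g t \<bullet> ?g' t + ?g' t \<bullet> ?g t)) (at t)"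
      by (rule bounded_bilinear.has_vector_derivative[OF bounded_bilinear_inner dg[OF t] dg[OF t]])
    then have q: "((\<lambda>t. ?g t \<bullet> ?g t) has_real_derivative (2 * (?g t \<bullet> ?g' t))) (at t)"
      by (simp add: has_real_derivative_iff_has_vector_derivative inner_commute)
    have "((\<lambda>t. sqrt (?g t \<bullet> ?g t)) has_real_derivative (inverse (sqrt (?g t \<bullet> ?g t)) / 2 * (2 * (?g t \<bullet>
        ?g' t)))) (at t)"
      by (rule DERIV_chain2[OF DERIV_real_sqrt[OF pos[OF t]] q])
    then have "((\<lambda>t. inverse (sqrt (?g t \<bullet> ?g t))) has_real_derivative
       - (inverse (sqrt (?g t \<bullet> ?g t)) * (inverse (sqrt (?g t \<bullet> ?g t)) / 2 * (2 * (?g t \<bullet> ?g' t))) *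
           inverse (sqrt (?g t \<bullet> ?g t)))) (at t)"
      by (rule DERIV_inverse') (use pos[OF t] in auto)
    then have "(m has_real_derivative e * - (inverse (sqrt (?g t \<bullet> ?g t)) * (inverse (sqrt (?g t \<bullet> ?g
        t)) / 2 * (2 * (?g t \<bullet> ?g' t))) * inverse (sqrt (?g t \<bullet> ?g t)))) (at t)"
      unfolding m_def by (rule DERIV_cmult)
    moreover have "e * - (inverse (sqrt (?g t \<bullet> ?g t)) * (inverse (sqrt (?g t \<bullet> ?g t)) / 2 * (2 * (?g t
        \<bullet> ?g' t))) * inverse (sqrt (?g t \<bullet> ?g t))) = m' t"
      by (simp add: m'_def power3_eq_cube)
    ultimately show ?thesis by simp
  qed
  have df: "(f has_vector_derivative (m t *\<^sub>R ?g' t + m' t *\<^sub>R ?g t)) (at t)" if t: "t \<in> ?B" for t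
    by (rule has_vector_derivative_transform_within_open[OF has_vector_derivative_scaleR[OF dm[OF t]
        dg[OF t]] open_ball t])
      (simp add: fm)
  have cg: "continuous_on ?B ?g"
    by (intro continuous_at_imp_continuous_on ballI) (use dg has_vector_derivative_continuous in blast)
  have cg': "continuous_on ?B ?g'" by (rule continuous_on_subset[OF chart_derivative(2)[OF c] d(2)])
  have "continuous_on ?B (\<lambda>t. m t *\<^sub>R ?g' t + m' t *\<^sub>R ?g t)"
    unfolding m_def m'_def using pos by (intro continuous_intros cg cg') force+
  moreover have "m t \<noteq> 0" if "t \<in> ?B" for t using pos[OF that] e(1) by (simp add: m_def)
  ultimately show ?thesis using that[of d m m'] d fm df by blast
qed

text \<open>Lift and chart expression are proportional, so modulo \<open>g t\<close> their
  derivatives are proportional too. This relation carries transversality from charts to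
  lifts.\<close>

lemma regular_lift_ex:
  assumes par: "parametrizes c C"
  obtains g g' where "regular_sphere_curve g g'" "\<And>t. g t \<in> Rep_rp2 (c t)"
    "\<And>k t. c t \<in> chart_dom k \<Longrightarrow> \<exists>a b. velocity k c t = a *\<^sub>R g' t + b *\<^sub>R g t"
proof -
  have c: "smooth_map c" and vel: "\<And>k t. c t \<in> chart_dom k \<Longrightarrow> velocity k c t \<noteq> 0"
    and inj: "\<And>s t. c s = c t \<longleftrightarrow> s - t \<in> \<int>" using par by (auto simp: parametrizes_def)
  obtain g where f: "unit_lift_on UNIV c g" using unit_lift_ex[OF c] by blast
  have unit: "norm (g t) = 1" and Rep: "g t \<in> Rep_rp2 (c t)" for t using f by (auto simp: unit_lift_on_def)
  define g' where "g' t = vector_derivative g (at t)" for t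
  have loc: "(g has_vector_derivative g' t) (at t) \<and> isCont g' t \<and>
      (\<exists>a b. a \<noteq> 0 \<and> velocity k c t = a *\<^sub>R g' t + b *\<^sub>R g t)" if k: "c t \<in> chart_dom k" for k t
  proof -
    obtain d m m' where d: "d > 0" "ball t d \<subseteq> c -` chart_dom k"
      "\<And>s. s \<in> ball t d \<Longrightarrow> g s = m s *\<^sub>R chart k (c s) \<and> m s \<noteq> 0 \<and>
        (g has_vector_derivative (m s *\<^sub>R velocity k c s + m' s *\<^sub>R chart k (c s))) (at s)"
      "continuous_on (ball t d) (\<lambda>s. m s *\<^sub>R velocity k c s + m' s *\<^sub>R chart k (c s))"
      by (rule unit_lift_local_derivative[OF c f k]) blast
    have tb: "t \<in> ball t d" using d(1) by simp
    have g': "g' s = m s *\<^sub>R velocity k c s + m' s *\<^sub>R chart k (c s)" if "s \<in> ball t d" for s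
      unfolding g'_def by (rule vector_derivative_at) (use d(3)[OF that] in blast)
    have "(g has_vector_derivative g' t) (at t)" using d(3)[OF tb] g'[OF tb] by simp
    moreover have "continuous_on (ball t d) g'" using d(4) by (rule continuous_on_eq) (simp add: g')
    then have "isCont g' t" using tb by (simp add: continuous_on_eq_continuous_at)
    moreover have "velocity k c t = (1 / m t) *\<^sub>R g' t + (- m' t / (m t * m t)) *\<^sub>R g t"
      using d(3)[OF tb] by (simp add: g'[OF tb] scaleR_add_right)
    moreover have "1 / m t \<noteq> 0" using d(3)[OF tb] by simp
    ultimately show ?thesis by blast
  qed
  have "regular_sphere_curve g g'"
  proof
    show "norm (g t) = 1" for t by (rule unit)
    show "(g has_vector_derivative g' t) (at t)" for t using loc chart_dom_cover by blast
    show "continuous_on UNIV g'" using loc chart_dom_cover by (intro continuous_at_imp_continuous_on) blast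
    show "g' t \<noteq> 0" for t
    proof
      assume 0: "g' t = 0"
      obtain k where k: "c t \<in> chart_dom k" using chart_dom_cover by blast
      then obtain a b where ab: "velocity k c t = a *\<^sub>R g' t + b *\<^sub>R g t" using loc by blast
      have "g t \<noteq> 0" using unit[of t] by auto
      then obtain q where q: "chart k (c t) = q *\<^sub>R g t"
          using Rep_rp2_multiple[OF Rep[of t]] chart(1)[OF k] by blast
      \<comment> \<open>If \<open>g' t\<close> vanished, the velocity would be a multiple of
        \<open>g t\<close>. Its component at \<open>k\<close> is 0 while that of \<open>g t\<close>
        is not, so the velocity itself would vanish.\<close>
      have "q * g t $ k = 1" using chart(2)[OF k] q by simp
      then have "g t $ k \<noteq> 0" by auto
      moreover have "b * g t $ k = 0" using velocity_component[OF c k] ab 0 by simp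
      ultimately show False using vel[OF k] ab 0 by simp
    qed
    show "g s = g t \<or> g s = - g t \<longleftrightarrow> s - t \<in> \<int>" for s t
    proof
      assume "g s = g t \<or> g s = - g t"
      then have "g s \<in> Rep_rp2 (c t)" using Rep[of t] subspace_neg[OF Rep_rp2_subspace] by auto
      moreover have "g s \<noteq> 0" using unit[of s] by auto
      ultimately have "c s = c t" using Rep_rp2_eqI Rep by blast
      then show "s - t \<in> \<int>" using inj by simp
    next
      assume "s - t \<in> \<int>"
      then have "c s = c t" using inj by simp
      then show "g s = g t \<or> g s = - g t" using Rep_rp2_unit[of "g t" "c t" "g s"] Rep[of s] Rep[of t]
          unit by simp
    qed
  qed
  then show ?thesis using that Rep loc by blast
qed

section \<open>From pseudolines to spherical arrangements\<close>

lemma parallel_in_tangent_plane: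
  fixes v u x :: "real ^ 3"
  assumes "norm v = 1" "u \<noteq> 0" "v \<bullet> u = 0" "v \<bullet> x = 0" "x \<bullet> cross3 v u = 0"
  obtains a where "x = a *\<^sub>R u"
proof -
  define z where "z = x - (x \<bullet> u / (u \<bullet> u)) *\<^sub>R u"
  have zu: "z \<bullet> u = 0" using assms(2) by (simp add: z_def inner_diff_left)
  have zv: "z \<bullet> v = 0" using assms(3,4) by (simp add: z_def inner_diff_left inner_diff_right inner_commute)
  have zw: "z \<bullet> cross3 v u = 0" using assms(5) by (simp add: z_def inner_diff_left dot_cross_self)
  have "cross3 z (cross3 v u) = 0" by (simp add: Lagrange zu zv)
  moreover have "cross3 v u \<noteq> 0"
    using norm_and_cross_eq_0[of v u] assms(1-3) by auto
  ultimately have "z = 0" using zw norm_and_cross_eq_0 by blast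
  then show ?thesis using that by (simp add: z_def)
qed

lemma regular_sphere_curve_neg:
  assumes "regular_sphere_curve g g'"
  shows "regular_sphere_curve (\<lambda>t. - g t) (\<lambda>t. - g' t)"
proof -
  interpret regular_sphere_curve g g' by fact
  show ?thesis
  proof
    show "- g s = - g t \<or> - g s = - (- g t) \<longleftrightarrow> s - t \<in> \<int>" for s t
      using simple[of s t] minus_equation_iff[of "g s" "g t"] by auto
  qed (use cont_deriv regular in \<open>auto intro!: has_vector_derivative_minus deriv continuous_on_minus\<close>)
qed

lemma tangent_parallel:
  assumes c1: "regular_sphere_curve g1 g1'" and c2: "regular_sphere_curve g2 g2'"
    and sub: "\<And>t. \<exists>s. g2 t = g1 s \<or> g2 t = - g1 s" and eq: "g2 t0 = g1 s0 \<or> g2 t0 = - g1 s0"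
  shows "\<exists>a. g2' t0 = a *\<^sub>R g1' s0"
proof -
  interpret c1: regular_sphere_curve g1 g1' by fact
  interpret c2: regular_sphere_curve g2 g2' by fact
  have "g2' t0 \<bullet> c1.normal s0 = 0"
    using eq
  proof
    assume "g2 t0 = g1 s0"
    then show ?thesis using tangent_unique[OF c1 c2 sub] by blast
  next
    assume "g2 t0 = - g1 s0"
    then have e: "- g2 t0 = g1 s0" by simp
    have sub': "\<exists>s. - g2 t = g1 s \<or> - g2 t = - g1 s" for t using sub[of t] by (metis minus_minus)
    have "(- g2' t0) \<bullet> c1.normal s0 = 0"
      by (rule tangent_unique[OF c1 regular_sphere_curve_neg[OF c2] sub' e])
    then show ?thesis by simp
  qed
  moreover have "g1 s0 \<bullet> g2' t0 = 0"
    using c2.orthogonal_deriv[of t0] eq by auto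
  ultimately show ?thesis
    using parallel_in_tangent_plane[of "g1 s0" "g1' s0" "g2' t0"] c1.regular c1.orthogonal_deriv c1.unit
        by metis
qed

text \<open>Both vectors lie in the coordinate plane where component \<open>k\<close> is 0, so their
  cross product points along axis \<open>k\<close>, in which \<open>v\<close> has a
  component.\<close>

lemma triple_product_nonzero:
  fixes v x y :: "real ^ 3"
  assumes "v $ k \<noteq> 0" "x $ k = 0" "y $ k = 0" "dim {x, y} = 2"
  shows "v \<bullet> cross3 x y \<noteq> 0"
proof
  assume 0: "v \<bullet> cross3 x y = 0"
  have "cross3 x y = 0"
    using exhaust_3[of k] assms(1-3) 0
    by (auto simp: vec_eq_iff forall_3 cross_components inner_vec_def sum_3)
  then have "collinear {0, x, y}" by (simp add: cross_eq_0)
  then obtain z where "{x, y} \<subseteq> span {z}"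
    unfolding collinear_lemma
    by (metis empty_subsetI insert_subset span_base span_scale span_zero singletonI)
  then have "dim {x, y} \<le> card {z}" by (intro dim_le_card) auto
  then show False using assms(4) by simp
qed

locale lifted_arrangement =
  fixes n :: nat and l :: "nat \<Rightarrow> rp2 set" and c :: "nat \<Rightarrow> real \<Rightarrow> rp2"
    and g g' :: "nat \<Rightarrow> real \<Rightarrow> real ^ 3" and \<sigma> :: "nat \<Rightarrow> real ^ 3 \<Rightarrow> int"
  assumes arr: "pseudoline_arrangement n l"
    and par: "\<And>i. i \<in> {1..n} \<Longrightarrow> parametrizes (c i) (l i)"
    and reg: "\<And>i. i \<in> {1..n} \<Longrightarrow> regular_sphere_curve (g i) (g' i)"
    and Rep: "\<And>i t. i \<in> {1..n} \<Longrightarrow> g i t \<in> Rep_rp2 (c i t)"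
    and side: "\<And>i. i \<in> {1..n} \<Longrightarrow> side_function (range (g i)) (\<sigma> i)"
    and side_range: "\<And>i x. \<sigma> i x \<in> {-1, 0, 1}"
begin

lemma n_ge: "n \<ge> 3" using arr by (simp add: pseudoline_arrangement_def)

lemma unit: "i \<in> {1..n} \<Longrightarrow> norm (g i t) = 1"
  using reg regular_sphere_curve.unit by blast

lemma l_eq: "i \<in> {1..n} \<Longrightarrow> l i = range (c i)"
  using par by (simp add: parametrizes_def)

lemma c_eq_iff: "i \<in> {1..n} \<Longrightarrow> c i s = c i t \<longleftrightarrow> s - t \<in> \<int>"
  using par by (simp add: parametrizes_def)

lemma on_line_iff:
  assumes i: "i \<in> {1..n}" and x: "x \<in> Rep_rp2 p" "norm x = 1"
  shows "p \<in> l i \<longleftrightarrow> (\<exists>t. x = g i t \<or> x = - g i t)"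
proof
  assume "p \<in> l i"
  then obtain t where "p = c i t" using l_eq[OF i] by blast
  then show "\<exists>t. x = g i t \<or> x = - g i t" using Rep_rp2_unit[OF Rep[OF i, of t]] x unit[OF i] by blast
next
  assume "\<exists>t. x = g i t \<or> x = - g i t"
  then obtain t where "x = g i t \<or> x = - g i t" by blast
  then have "x \<in> Rep_rp2 (c i t)" using Rep[OF i] subspace_neg[OF Rep_rp2_subspace] by auto
  moreover have "x \<noteq> 0" using x by auto
  ultimately have "p = c i t" using Rep_rp2_eqI x by blast
  then show "p \<in> l i" using l_eq[OF i] by blast
qed

lemma meet: "i \<in> {1..n} \<Longrightarrow> j \<in> {1..n} \<Longrightarrow> i \<noteq> j \<Longrightarrow> \<exists>p. l i \<inter> l j = {p} \<and> transversal_at p (l i) (l j)"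
  using arr unfolding pseudoline_arrangement_def by blast

lemma meet_param:
  assumes ij: "i \<in> {1..n}" "j \<in> {1..n}" "i \<noteq> j"
  obtains b where "\<And>t. (\<exists>s. g i t = g j s \<or> g i t = - g j s) \<longleftrightarrow> t - b \<in> \<int>"
proof -
  obtain p where p: "l i \<inter> l j = {p}" using meet[OF ij] by blast
  have "p \<in> range (c i)" unfolding l_eq[OF ij(1), symmetric] using p by blast
  then obtain b where b: "c i b = p" by (metis rangeE)
  have "c i t \<in> l i" for t using l_eq[OF ij(1)] by blast
  then have "c i t \<in> l j \<longleftrightarrow> c i t = c i b" for t using p b by (metis IntI IntD2 insertI1 singletonD)
  then have "(\<exists>s. g i t = g j s \<or> g i t = - g j s) \<longleftrightarrow> t - b \<in> \<int>" for t
    using on_line_iff[OF ij(2) Rep[OF ij(1)] unit[OF ij(1)]] c_eq_iff[OF ij(1)] by simp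
  then show ?thesis using that by blast
qed

text \<open>Transversality is granted in one chart and for one pair of parametrizations
  \<open>d1\<close>, \<open>d2\<close>. By \<open>tangent_parallel\<close> their velocities are
  combinations of the derivatives of the fixed lifts and of the point itself; the triple product
  with the point removes the latter part.\<close>

lemma transversal:
  assumes ij: "i \<in> {1..n}" "j \<in> {1..n}" "i \<noteq> j" and eq: "g i s = g j t \<or> g i s = - g j t"
  shows "g' i s \<bullet> cross3 (g j t) (g' j t) \<noteq> 0"
proof
  assume 0: "g' i s \<bullet> cross3 (g j t) (g' j t) = 0"
  interpret ci: regular_sphere_curve "g i" "g' i" by (rule reg[OF ij(1)])
  interpret cj: regular_sphere_curve "g j" "g' j" by (rule reg[OF ij(2)])
  let ?v = "g j t"
  obtain p where p: "l i \<inter> l j = {p}" "transversal_at p (l i) (l j)" using meet[OF ij] by blast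
  have "g i s \<in> Rep_rp2 (c j t)" using Rep[OF ij(2)] eq subspace_neg[OF Rep_rp2_subspace] by auto
  then have "c i s = c j t" using Rep_rp2_eqI[OF Rep[OF ij(1)]] ci.nonzero by blast
  then have pc: "c j t = p" "c i s = p" using p(1) l_eq[OF ij(1)] l_eq[OF ij(2)]
      by (metis IntI rangeI singletonD)+
  obtain d1 d2 s1 s2 k where d: "parametrizes d1 (l i)" "parametrizes d2 (l j)" "d1 s1 = p" "d2 s2 = p"
    "p \<in> chart_dom k" "dim {velocity k d1 s1, velocity k d2 s2} = 2"
    using p(2) unfolding transversal_at_def by blast
  have v: "?v \<in> Rep_rp2 p" "norm ?v = 1" using Rep[OF ij(2), of t] pc by auto
  have par_vel: "\<exists>a b. velocity k d s0 = a *\<^sub>R g' m r + b *\<^sub>R ?v"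
    if m: "m \<in> {1..n}" "parametrizes d (l m)" "d s0 = p" "c m r = p" for d s0 m r
  proof -
    obtain \<beta> \<beta>' where \<beta>: "regular_sphere_curve \<beta> \<beta>'" "\<And>t. \<beta> t \<in> Rep_rp2 (d t)"
      "\<And>k t. d t \<in> chart_dom k \<Longrightarrow> \<exists>a b. velocity k d t = a *\<^sub>R \<beta>' t + b *\<^sub>R \<beta> t"
      using regular_lift_ex[OF m(2)] by metis
    have \<beta>u: "norm (\<beta> t) = 1" for t using \<beta>(1) regular_sphere_curve.unit by blast
    have "d t \<in> l m" for t using m(2) by (auto simp: parametrizes_def)
    then have sub: "\<exists>s. \<beta> t = g m s \<or> \<beta> t = - g m s" for t
      using on_line_iff[OF m(1) \<beta>(2) \<beta>u] by blast
    have "\<beta> s0 = g m r \<or> \<beta> s0 = - g m r"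
      using Rep_rp2_unit[of "g m r" p "\<beta> s0"] Rep[OF m(1), of r] \<beta>(2)[of s0] m \<beta>u unit by simp
    then obtain a where a: "\<beta>' s0 = a *\<^sub>R g' m r" using tangent_parallel[OF reg[OF m(1)] \<beta>(1) sub] by blast
    have "\<beta> s0 = ?v \<or> \<beta> s0 = - ?v"
      using Rep_rp2_unit[of ?v p "\<beta> s0"] v \<beta>(2)[of s0] m \<beta>u by simp
    then obtain e :: real where "\<beta> s0 = e *\<^sub>R ?v" by (metis scaleR_minus1_left scaleR_one)
    moreover obtain a' b where "velocity k d s0 = a' *\<^sub>R \<beta>' s0 + b *\<^sub>R \<beta> s0" using \<beta>(3)[of s0 k] d(5) m
        by auto
    ultimately show ?thesis using a by (metis scaleR_scaleR)
  qed
  obtain a1 b1 where 1: "velocity k d1 s1 = a1 *\<^sub>R g' i s + b1 *\<^sub>R ?v"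
      using par_vel[OF ij(1) d(1,3) pc(2)] by blast
  obtain a2 b2 where 2: "velocity k d2 s2 = a2 *\<^sub>R g' j t + b2 *\<^sub>R ?v"
      using par_vel[OF ij(2) d(2,4) pc(1)] by blast
  have vk: "?v $ k \<noteq> 0"
  proof
    assume z: "?v $ k = 0"
    obtain a where "chart k p = a *\<^sub>R ?v" using Rep_rp2_multiple[OF v(1) cj.nonzero] chart(1)[OF d(5)]
        by blast
    then show False using chart(2)[OF d(5)] z by simp
  qed
  have "smooth_map d1" "smooth_map d2" using d by (auto simp: parametrizes_def)
  then have "?v \<bullet> cross3 (velocity k d1 s1) (velocity k d2 s2) \<noteq> 0"
    by (intro triple_product_nonzero[OF vk _ _ d(6)] velocity_component) (use d in auto)
  moreover have "?v \<bullet> cross3 (velocity k d1 s1) (velocity k d2 s2) = a1 * a2 * (?v \<bullet> cross3 (g' i s) (g'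
      j t))"
    unfolding 1 2 by (simp add: cross_add_left cross_add_right cross_mult_left cross_mult_right
        inner_add_right dot_cross_self)
  moreover have "?v \<bullet> cross3 (g' i s) (g' j t) = - (g' i s \<bullet> cross3 (g j t) (g' j t))"
    by (simp add: cross3_simps)
  ultimately show False using 0 by simp
qed

lemma side_zero: "i \<in> {1..n} \<Longrightarrow> \<sigma> i x = 0 \<longleftrightarrow> x \<in> range (g i)"
  using side unfolding side_function_def by blast

lemma side_along:
  fixes \<rho> :: "real \<Rightarrow> real ^ 3"
  assumes j: "j \<in> {1..n}" and \<rho>: "continuous_on UNIV \<rho>" "\<And>t. norm (\<rho> t) = 1"
    and ab: "\<And>t. t \<in> {min a b..max a b} \<Longrightarrow> \<rho> t \<notin> range (g j)"
  shows "\<sigma> j (\<rho> a) = \<sigma> j (\<rho> b)"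
proof -
  let ?I = "{min a b..max a b}"
  have "connected (\<rho> ` ?I)" by (intro connected_continuous_image continuous_on_subset[OF \<rho>(1)]) auto
  moreover have "\<rho> ` ?I \<subseteq> sphere 0 1 - range (g j)" 
  proof (rule image_subsetI)
    fix t assume "t \<in> ?I"
    then show "\<rho> t \<in> sphere 0 1 - range (g j)" using ab[of t] \<rho>(2)[of t] by simp
  qed
  ultimately have "\<sigma> j constant_on (\<rho> ` ?I)" using side[OF j] unfolding side_function_def by blast
  moreover have "a \<in> ?I" "b \<in> ?I" by auto
  ultimately show ?thesis unfolding constant_on_def by (metis imageI)
qed

text \<open>The antipodal lift \<open>- g i\<close> is allowed as it is not yet known to be a shift of \<open>g i\<close>.\<close>

lemma side_crossing:
  assumes ij: "i \<in> {1..n}" "j \<in> {1..n}" "i \<noteq> j" and \<rho>: "\<rho> = g i \<or> \<rho> = (\<lambda>t. - g i t)"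
      and b: "\<rho> b \<in> range (g j)"
    and d: "0 < d" "d < 1" "0 < e" "e < 1"
  shows "\<sigma> j (\<rho> (b + d)) = - \<sigma> j (\<rho> (b - e)) \<and> \<sigma> j (\<rho> (b + d)) \<noteq> 0"
proof -
  interpret ci: regular_sphere_curve "g i" "g' i" by (rule reg[OF ij(1)])
  interpret cj: regular_sphere_curve "g j" "g' j" by (rule reg[OF ij(2)])
  obtain \<rho>' where \<rho>': "regular_sphere_curve \<rho> \<rho>'" "\<rho>' = g' i \<or> \<rho>' = (\<lambda>t. - g' i t)"
    using \<rho> reg[OF ij(1)] regular_sphere_curve_neg by metis
  interpret cr: regular_sphere_curve \<rho> \<rho>' by (rule \<rho>')
  obtain s where s: "\<rho> b = g j s" using b by blast
  have "g' i b \<bullet> cj.normal s \<noteq> 0"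
  proof (rule transversal[OF ij])
    have "\<rho> b = g i b \<or> \<rho> b = - g i b" using \<rho> by auto
    then show "g i b = g j s \<or> g i b = - g j s" using s by (metis minus_minus)
  qed
  then have nz: "\<rho>' b \<bullet> cj.normal s \<noteq> 0" using \<rho>'(2) by auto
  obtain \<delta> where \<delta>: "\<delta> \<in> {-1,1}" "tangential_sides (\<sigma> j) \<delta> (g j s) (cj.normal s)"
    using cj.side_local[OF side[OF ij(2)], of s] by blast
  obtain \<epsilon> where \<epsilon>: "\<epsilon> > 0" "\<And>t. t \<noteq> b \<Longrightarrow> \<bar>t - b\<bar> < \<epsilon> \<Longrightarrow>
      real_of_int (\<sigma> j (\<rho> t)) = of_int \<delta> * sgn ((t - b) * (\<rho>' b \<bullet> cj.normal s))"
    using tangential_sidesD[OF \<delta>(2) s cr.deriv cr.unit nz] by auto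
  obtain b0 where b0: "\<And>t. (\<exists>s. g i t = g j s \<or> g i t = - g j s) \<longleftrightarrow> t - b0 \<in> \<int>" using meet_param[OF ij]
      by metis
  have \<rho>i: "g i t = \<rho> t \<or> g i t = - \<rho> t" for t using \<rho> by auto
  have hit: "t - b0 \<in> \<int>" if r: "\<rho> t \<in> range (g j)" for t
  proof -
    obtain s' where "\<rho> t = g j s'" using r by blast
    then have "g i t = g j s' \<or> g i t = - g j s'" using \<rho>i[of t] by simp
    then show ?thesis using b0[of t] by blast
  qed
  have bi: "b - b0 \<in> \<int>" by (rule hit[OF b])
  have away: "\<rho> t \<notin> range (g j)" if t: "t - b \<notin> \<int>" for t
  proof
    assume "\<rho> t \<in> range (g j)"
    then have "t - b0 \<in> \<int>" by (rule hit)
    then have "t - b \<in> \<int>" using bi Ints_diff[of "t - b0" "b - b0"] by simp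
    then show False using t by simp
  qed
  define h where "h = min (\<epsilon> / 2) (1 / 2)"
  have h: "0 < h" "h < \<epsilon>" "h < 1" using \<epsilon>(1) by (auto simp: h_def min_def)
  have p: "\<sigma> j (\<rho> (b + d)) = \<sigma> j (\<rho> (b + h))"
  proof (rule side_along[OF ij(2) cr.cont cr.unit], rule away)
    fix t assume "t \<in> {min (b + d) (b + h)..max (b + d) (b + h)}"
    then show "t - b \<notin> \<int>" using d h by (intro not_Ints_between(1)) auto
  qed
  have m: "\<sigma> j (\<rho> (b - e)) = \<sigma> j (\<rho> (b - h))"
  proof (rule side_along[OF ij(2) cr.cont cr.unit], rule away)
    fix t assume "t \<in> {min (b - e) (b - h)..max (b - e) (b - h)}"
    then have "0 < b - t" "b - t < 1" using d h by auto
    then show "t - b \<notin> \<int>" using not_Ints_between(2)[of "b - t"] by simp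
  qed
  have "real_of_int (\<sigma> j (\<rho> (b + h))) = of_int \<delta> * sgn (\<rho>' b \<bullet> cj.normal s)"
    using \<epsilon>(2)[of "b + h"] h by (simp add: sgn_mult)
  moreover have "real_of_int (\<sigma> j (\<rho> (b - h))) = - (of_int \<delta> * sgn (\<rho>' b \<bullet> cj.normal s))"
    using \<epsilon>(2)[of "b - h"] h by (simp add: sgn_mult)
  moreover have "of_int \<delta> * sgn (\<rho>' b \<bullet> cj.normal s) \<noteq> 0" using \<delta>(1) nz by (auto simp: sgn_if)
  ultimately show ?thesis unfolding p m by linarith
qed

text \<open>If the lift closed up after one unit, the points half a unit before and after a crossing
  with \<open>j\<close> would coincide, yet \<open>side_crossing\<close> puts them on different
  sides of \<open>j\<close>.\<close>

lemma antiperiodic: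
  assumes i: "i \<in> {1..n}" shows "g i (t + 1) = - g i t"
proof -
  interpret ci: regular_sphere_curve "g i" "g' i" by (rule reg[OF i])
  show ?thesis
  proof (rule ci.antiperiodic_cases)
    assume per: "\<And>t. g i (t + 1) = g i t"
    obtain j where j: "j \<in> {1..n}" "i \<noteq> j"
    proof -
      have "i \<noteq> 1 \<or> i \<noteq> 2" "1 \<in> {1..n}" "2 \<in> {1..n}" using n_ge by auto
      then show thesis using that by metis
    qed
    obtain b where "\<And>t. (\<exists>s. g i t = g j s \<or> g i t = - g j s) \<longleftrightarrow> t - b \<in> \<int>" using meet_param[OF i j] by metis
    then have "\<exists>s. g i b = g j s \<or> g i b = - g j s" by (metis Ints_0
        cancel_comm_monoid_add_class.diff_cancel)
    then obtain s where "g i b = g j s \<or> - g i b = g j s" by (metis minus_minus)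
    then obtain \<rho> where \<rho>: "\<rho> = g i \<or> \<rho> = (\<lambda>t. - g i t)" "\<rho> b \<in> range (g j)" by (metis rangeI)
    have "\<rho> (b - 1/2 + 1) = \<rho> (b - 1/2)" using \<rho>(1) per by metis
    then have "\<rho> (b + 1/2) = \<rho> (b - 1/2)" by (simp add: algebra_simps)
    then show ?thesis using side_crossing[OF i j \<rho>, of "1/2" "1/2"] by simp
  qed
qed

lemma on_line_iff_side:
  assumes i: "i \<in> {1..n}" and x: "x \<in> Rep_rp2 p" "norm x = 1"
  shows "p \<in> l i \<longleftrightarrow> \<sigma> i x = 0"
proof -
  have "- g i t \<in> range (g i)" for t using antiperiodic[OF i, of t] by (metis rangeI)
  then show ?thesis unfolding on_line_iff[OF assms] side_zero[OF i] by blast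
qed

lemma side_curve_zero:
  assumes i: "i \<in> {1..n}" "j \<in> {1..n}"
  shows "\<sigma> j (g i t) = 0 \<longleftrightarrow> (\<exists>s. g i t = g j s \<or> g i t = - g j s)"
  using on_line_iff[OF i(2) Rep[OF i(1)] unit[OF i(1)]] on_line_iff_side[OF i(2) Rep[OF i(1)] unit[OF
      i(1)]] by simp

lemma cont: "i \<in> {1..n} \<Longrightarrow> continuous_on UNIV (g i)"
  using reg regular_sphere_curve.cont by blast

end

lemma card_filter_sum: "finite A \<Longrightarrow> card {x \<in> A. P x} = (\<Sum>x\<in>A. if P x then 1 else 0)"
  by (simp only: card_eq_sum sum.inter_filter)

section \<open>The cyclic order of the curves around a vertex\<close>

context lifted_arrangement
begin

abbreviation csn :: "nat \<Rightarrow> nat \<Rightarrow> real ^ 3 \<Rightarrow> int" where "csn \<equiv> cross_sign g \<sigma>"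

lemma param_eq: "i \<in> {1..n} \<Longrightarrow> \<sigma> i x = 0 \<Longrightarrow> g i (param g i x) = x"
  unfolding param_def using side_zero[of i x] by (metis (mono_tags, lifting) rangeE someI)

text \<open>The sign \<open>\<delta>\<close> records which side of curve \<open>k\<close> counts as
  positive at \<open>x\<close>. It is common to all crossing curves \<open>i\<close>, so crossing
  signs reduce to orientations of tangent vectors.\<close>

lemma cross_sign_formula:
  assumes k: "k \<in> {1..n}" "\<sigma> k x = 0"
  obtains \<delta> :: int where "\<delta> \<in> {-1,1}" "\<And>i. i \<in> {1..n} \<Longrightarrow> i \<noteq> k \<Longrightarrow> \<sigma> i x = 0 \<Longrightarrow>
     real_of_int (csn k i x) = of_int \<delta> * sgn (g' i (param g i x) \<bullet> cross3 x (g' k (param g k x)))"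
proof -
  interpret ck: regular_sphere_curve "g k" "g' k" by (rule reg[OF k(1)])
  define s where "s = param g k x"
  have s: "g k s = x" using param_eq[OF k] by (simp add: s_def)
  obtain \<delta> where \<delta>: "\<delta> \<in> {-1,1}" "tangential_sides (\<sigma> k) \<delta> (g k s) (ck.normal s)"
    using ck.side_local[OF side[OF k(1)], of s] by blast
  have "real_of_int (csn k i x) = of_int \<delta> * sgn (g' i (param g i x) \<bullet> cross3 x (g' k (param g k x)))"
    if i: "i \<in> {1..n}" "i \<noteq> k" "\<sigma> i x = 0" for i
  proof -
    interpret ci: regular_sphere_curve "g i" "g' i" by (rule reg[OF i(1)])
    define t where "t = param g i x"
    have t: "g i t = x" using param_eq[OF i(1,3)] by (simp add: t_def)
    have nz: "g' i t \<bullet> ck.normal s \<noteq> 0" by (rule transversal[OF i(1) k(1) i(2)]) (simp add: s t)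
    have tk: "g i t = g k s" by (simp add: s t)
    obtain \<epsilon> where \<epsilon>: "\<epsilon> > 0" "\<And>r. r \<noteq> t \<Longrightarrow> \<bar>r - t\<bar> < \<epsilon> \<Longrightarrow>
        real_of_int (\<sigma> k (g i r)) = of_int \<delta> * sgn ((r - t) * (g' i t \<bullet> ck.normal s))"
      using tangential_sidesD[OF \<delta>(2) tk ci.deriv ci.unit nz] by auto
    define h where "h = min (\<epsilon> / 2) (1 / 2)"
    have h: "0 < h" "h < \<epsilon>" "h < 1" using \<epsilon>(1) by (auto simp: h_def min_def)
    have b: "g i t \<in> range (g k)" using tk by simp
    have "\<sigma> k (g i (t + 1/2)) = - \<sigma> k (g i (t - 1/2))" "\<sigma> k (g i (t + h)) = - \<sigma> k (g i (t - 1/2))"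
      using side_crossing[where \<rho> = "g i", OF i(1) k(1) i(2) disjI1[OF refl] b, of "1/2" "1/2"]
        side_crossing[where \<rho> = "g i", OF i(1) k(1) i(2) disjI1[OF refl] b, of h "1/2"] h by auto
    then have "csn k i x = \<sigma> k (g i (t + h))" by (simp add: cross_sign_def t_def)
    also have "real_of_int \<dots> = of_int \<delta> * sgn (g' i t \<bullet> ck.normal s)"
      using \<epsilon>(2)[of "t + h"] h by (simp add: sgn_mult)
    finally show ?thesis by (simp add: t_def s s_def[symmetric])
  qed
  then show ?thesis using that \<delta>(1) by blast
qed

text \<open>At a vertex \<open>x\<close>, the directions on the given side of the ray \<open>\<eta> u i\<close> are normalised to have
  the same normal component; the next one is then the one with the largest tangential component.\<close>

lemma sector_ex:
  assumes i: "i \<in> {1..n}" "\<sigma> i x = 0" and ex: "\<exists>j\<in>{1..n}. j \<noteq> i \<and> \<sigma> j x = 0"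
    and \<eta>: "\<eta> \<in> {-1, 1}" and s: "s \<in> {-1, 1}"
  shows "\<exists>j\<in>{1..n}. j \<noteq> i \<and> \<sigma> j x = 0 \<and> (\<exists>\<eta>'\<in>{-1,1}. \<eta>' * csn i j x = s \<and>
    (\<forall>k\<in>{1..n}. k \<noteq> i \<longrightarrow> k \<noteq> j \<longrightarrow> \<sigma> k x = 0 \<longrightarrow> \<eta>' * csn k j x = \<eta> * csn k i x))"
proof -
  define u where "u m = g' m (param g m x)" for m
  define W where "W k m = u m \<bullet> cross3 x (u k)" for k m
  define M where "M = {m \<in> {1..n}. m \<noteq> i \<and> \<sigma> m x = 0}"
  have x1: "norm x = 1" using param_eq[OF i] unit[OF i(1)] by metis
  have on: "m \<in> {1..n} \<and> \<sigma> m x = 0" if "m \<in> insert i M" for m using that i by (auto simp: M_def)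
  have u: "u m \<noteq> 0" "x \<bullet> u m = 0" if m: "m \<in> insert i M" for m
  proof -
    interpret cm: regular_sphere_curve "g m" "g' m" by (rule reg) (use on m in blast)
    show "u m \<noteq> 0" by (simp add: u_def cm.regular)
    have "g m (param g m x) = x" using param_eq on[OF m] by blast
    then show "x \<bullet> u m = 0" using cm.orthogonal_deriv[of "param g m x"] by (simp add: u_def)
  qed
  have Wnz: "W k m \<noteq> 0" if "k \<in> insert i M" "m \<in> insert i M" "k \<noteq> m" for k m
  proof -
    have "g m (param g m x) = x" "g k (param g k x) = x" using param_eq on that by blast+
    then show ?thesis
      using transversal[of m k "param g m x" "param g k x"] on[OF that(1)] on[OF that(2)] that(3)
          by (simp add: W_def u_def)
  qed
  obtain \<delta> :: "nat \<Rightarrow> int" where \<delta>: "\<And>k. k \<in> insert i M \<Longrightarrow> \<delta> k \<in> {-1,1} \<and>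
      (\<forall>m\<in>insert i M. m \<noteq> k \<longrightarrow> real_of_int (csn k m x) = of_int (\<delta> k) * sgn (W k m))"
  proof -
    have "\<exists>\<delta>::int. \<delta> \<in> {-1,1} \<and> (\<forall>m\<in>insert i M. m \<noteq> k \<longrightarrow> real_of_int (csn k m x) = of_int \<delta> * sgn (W k m))"
      if k: "k \<in> insert i M" for k
    proof -
      obtain d :: int where "d \<in> {-1,1}" "\<And>i. i \<in> {1..n} \<Longrightarrow> i \<noteq> k \<Longrightarrow> \<sigma> i x = 0 \<Longrightarrow>
         real_of_int (csn k i x) = of_int d * sgn (u i \<bullet> cross3 x (u k))"
        using cross_sign_formula[of k x] on[OF k] unfolding u_def by metis
      then show ?thesis using on unfolding W_def by blast
    qed
    then show thesis using that by metis
  qed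
  \<comment> \<open>The sign of the component across \<open>u i\<close> that belongs to side
    \<open>s\<close> of curve \<open>i\<close>. The vectors \<open>y m\<close> are the tangents
    rescaled to have exactly this component.\<close>
  define \<tau> :: real where "\<tau> = of_int (s * \<delta> i)"
  have \<tau>: "\<tau> \<in> {-1,1}" using s \<delta>[of i] by (auto simp: \<tau>_def)
  define y where "y m = (\<tau> / W i m) *\<^sub>R u m" for m
  have "finite M" "M \<noteq> {}" using ex by (auto simp: M_def)
  then obtain j where j: "j \<in> M" "\<And>m. m \<in> M \<Longrightarrow> \<eta> * (u i \<bullet> y m) \<le> \<eta> * (u i \<bullet> y j)"
  proof -
    let ?f = "\<lambda>m. real_of_int \<eta> * (u i \<bullet> y m)"
    have "Max (?f ` M) \<in> ?f ` M" using \<open>finite M\<close> \<open>M \<noteq> {}\<close> by (intro Max_in) auto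
    then obtain j where j: "j \<in> M" "Max (?f ` M) = ?f j" by auto
    have "?f m \<le> ?f j" if "m \<in> M" for m unfolding j(2)[symmetric] using \<open>finite M\<close> that
        by (intro Max_ge) auto
    then show thesis using that[OF j(1)] by blast
  qed
  have ij: "j \<noteq> i" "j \<in> {1..n}" "\<sigma> j x = 0" using j(1) by (auto simp: M_def)
  have sgnW: "sgn (W k m) \<in> {-1,1}" if "k \<in> insert i M" "m \<in> insert i M" "k \<noteq> m" for k m
    using Wnz[OF that] by (auto simp: sgn_if)
  \<comment> \<open>The direction on curve \<open>j\<close> for which \<open>\<eta>'\<close> times
    \<open>u j\<close> is a positive multiple of \<open>y j\<close>.\<close>
  define \<eta>' :: int where "\<eta>' = (if \<tau> * sgn (W i j) = 1 then 1 else -1)"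
  have \<eta>': "real_of_int \<eta>' = \<tau> * sgn (W i j)" "\<eta>' \<in> {-1,1}"
    using \<tau> sgnW[of i j] j(1) ij(1) by (auto simp: \<eta>'_def)
  have "real_of_int (\<eta>' * csn i j x) = of_int s"
  proof -
    have "real_of_int (csn i j x) = of_int (\<delta> i) * sgn (W i j)" using \<delta>[of i] j(1) ij(1) by blast
    then show ?thesis using \<eta>'(1) sgnW[of i j] j(1) ij(1) \<delta>[of i] by (auto simp: \<tau>_def)
  qed
  then have 1: "\<eta>' * csn i j x = s" by linarith
  have "\<eta>' * csn k j x = \<eta> * csn k i x" if k: "k \<in> {1..n}" "k \<noteq> i" "k \<noteq> j" "\<sigma> k x = 0" for k
  proof -
    have kM: "k \<in> M" using k by (simp add: M_def)
    have Wy: "u m \<bullet> cross3 x (y k) = \<tau> / W i k * W k m" for k m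
      by (simp add: y_def W_def cross_mult_right)
    have yW: "y m \<bullet> cross3 x (u i) = \<tau>" if "m \<in> M" for m
      using Wnz[of i m] that by (auto simp: y_def W_def M_def)
    have "(y j - y k) \<bullet> cross3 x (u i) = 0" using yW j(1) kM by (simp add: inner_diff_left)
    moreover have "x \<bullet> (y j - y k) = 0" using u(2) j(1) kM by (simp add: y_def inner_diff_right)
    ultimately obtain a where a: "y j - y k = a *\<^sub>R u i"
      using parallel_in_tangent_plane[OF x1, of "u i" "y j - y k"] u[of i] by auto
    \<comment> \<open>Since \<open>y k\<close> is tangent to curve \<open>k\<close>, the vectors
      \<open>y j\<close> and \<open>a *\<^sub>R u i\<close> have the same component across it.
      Maximality of \<open>j\<close> gives \<open>a\<close> the sign of \<open>\<eta>\<close>, hence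
      the darts of \<open>j\<close> and \<open>i\<close> lie on the same side of
      \<open>k\<close>.\<close>
    have ya: "y j = y k + a *\<^sub>R u i" using a by (simp add: algebra_simps)
    have e: "y j \<bullet> cross3 x (y k) = (\<tau> / W i j) * ((\<tau> / W i k) * W k j)"
      unfolding y_def by (simp add: W_def cross_mult_right)
    have "y j \<bullet> cross3 x (y k) = a * (\<tau> / W i k * W k i)"
      unfolding ya Wy[symmetric] by (simp add: inner_add_left dot_cross_self)
    then have "(\<tau> / W i k) * ((\<tau> / W i j) * W k j) = (\<tau> / W i k) * (a * W k i)" unfolding e
        by (simp add: algebra_simps)
    moreover have "\<tau> / W i k \<noteq> 0" using \<tau> Wnz[of i k] kM k by auto
    ultimately have eq: "(\<tau> / W i j) * W k j = a * W k i" by (metis mult_left_cancel)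
    have nz: "W k j \<noteq> 0" "W k i \<noteq> 0" "W i j \<noteq> 0" using Wnz kM j(1) k ij by auto
    have "a \<noteq> 0" using eq nz \<tau> by auto
    moreover have "\<eta> * a \<ge> 0"
    proof -
      have "0 \<le> \<eta> * (u i \<bullet> (y j - y k))" using j(2)[OF kM]
          by (simp add: inner_diff_right right_diff_distrib)
      also have "\<dots> = \<eta> * a * (u i \<bullet> u i)" by (simp add: a)
      finally have "0 \<le> \<eta> * a * (u i \<bullet> u i)" .
      moreover have "u i \<bullet> u i > 0" using u(1)[of i] by simp
      ultimately show ?thesis using zero_le_mult_iff[of "\<eta> * a" "u i \<bullet> u i"] by linarith
    qed
    ultimately have "\<eta> * a > 0" using \<eta> by auto
    then have "sgn a = \<eta>" using \<eta> by auto
    have "\<tau> * sgn (W i j) * sgn (W k j) = sgn ((\<tau> / W i j) * W k j)"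
    proof -
      have "sgn \<tau> = \<tau>" using \<tau> by auto
      then have "\<tau> * sgn (W i j) * sgn (W k j) = sgn ((\<tau> / W i j) * W k j * (W i j)\<^sup>2)"
        using nz by (simp add: power2_eq_square sgn_mult mult_ac)
      also have "\<dots> = sgn ((\<tau> / W i j) * W k j) * sgn ((W i j)\<^sup>2)" by (rule sgn_mult)
      also have "sgn ((W i j)\<^sup>2) = 1" using nz by (intro sgn_pos) simp
      finally show ?thesis by simp
    qed
    also have "\<dots> = \<eta> * sgn (W k i)" unfolding eq sgn_mult \<open>sgn a = \<eta>\<close> ..
    finally have "\<eta>' * sgn (W k j) = \<eta> * sgn (W k i)" unfolding \<eta>'(1) .
    moreover have "real_of_int (csn k j x) = of_int (\<delta> k) * sgn (W k j)" "real_of_int (csn k i x) =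
        of_int (\<delta> k) * sgn (W k i)"
      using \<delta>[of k] kM j(1) k by auto
    ultimately have "real_of_int (\<eta>' * csn k j x) = real_of_int (\<eta> * csn k i x)"
      by (simp add: algebra_simps)
    then show ?thesis by linarith
  qed
  then show ?thesis using 1 \<eta>'(2) ij by blast
qed

definition point :: "real ^ 3 \<Rightarrow> rp2" where "point x = (SOME p. x \<in> Rep_rp2 p)"

lemma point: "norm x = 1 \<Longrightarrow> x \<in> Rep_rp2 (point x)"
proof -
  assume "norm x = 1"
  then have "span {x} \<in> {L. subspace L \<and> dim L = 1}" by (auto simp: dim_span)
  then have "x \<in> Rep_rp2 (Abs_rp2 (span {x}))" by (simp add: Abs_rp2_inverse span_base)
  then show ?thesis unfolding point_def by (rule someI)
qed

sublocale spherical_arrangement n g \<sigma>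
proof
  show "g i s = g i t \<longleftrightarrow> (\<exists>m::int. s - t = 2 * of_int m)" if i: "i \<in> {1..n}" for i s t
    by (rule regular_sphere_curve.antiperiodic_eq_iff[OF reg[OF i] antiperiodic[OF i]])
  show "\<sigma> i x \<in> {-1, 0, 1}" for i x by (rule side_range)
  show "\<sigma> i x = 0 \<longleftrightarrow> x \<in> range (g i)" if "i \<in> {1..n}" for i x by (rule side_zero[OF that])
  show cr: "\<exists>b. \<forall>t. \<sigma> j (g i t) = 0 \<longleftrightarrow> t - b \<in> \<int>" if ij: "i \<in> {1..n}" "j \<in> {1..n}" "i \<noteq> j" for i j
  proof -
    obtain b where "\<And>t. (\<exists>s. g i t = g j s \<or> g i t = - g j s) \<longleftrightarrow> t - b \<in> \<int>" using meet_param[OF ij] by metis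
    then show ?thesis unfolding side_curve_zero[OF ij(1,2)] by blast
  qed
  show "\<sigma> j (g i (t + 1)) = - \<sigma> j (g i t)" if ij: "i \<in> {1..n}" "j \<in> {1..n}" for i j t
  proof (cases "i = j")
    case True
    have "\<sigma> i (g i s) = 0" for s using side_zero[OF ij(1)] by blast
    then show ?thesis using True by simp
  next
    case False
    obtain b where b: "\<And>t. \<sigma> j (g i t) = 0 \<longleftrightarrow> t - b \<in> \<int>" using cr[OF ij False] by blast
    show ?thesis
    proof (cases "t - b \<in> \<int>")
      case True
      then have "t + 1 - b \<in> \<int>" by (metis Ints_1 Ints_add add_diff_eq diff_add_eq add.commute)
      then have "\<sigma> j (g i (t + 1)) = 0" "\<sigma> j (g i t) = 0" using b True by blast+
      then show ?thesis by simp
    next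
      case False
      \<comment> \<open>The first crossing with \<open>j\<close> after \<open>t\<close>. It lies
        strictly between \<open>t\<close> and \<open>t + 1\<close> and is the only one
        there.\<close>
      define b' where "b' = b + of_int (\<lfloor>t - b\<rfloor> + 1)"
      have e: "0 < b' - t" "b' - t < 1"
      proof -
        have "t - b \<noteq> of_int \<lfloor>t - b\<rfloor>" using False by (metis Ints_of_int)
        then show "0 < b' - t" "b' - t < 1" unfolding b'_def by linarith+
      qed
      have "\<sigma> j (g i b') = 0" using b by (simp add: b'_def)
      then have "g i b' \<in> range (g j)" using side_zero[OF ij(2)] by blast
      then have "\<sigma> j (g i (b' + (1 - (b' - t)))) = - \<sigma> j (g i (b' - (b' - t)))"
        using side_crossing[where \<rho> = "g i" and b = b', OF ij \<open>i \<noteq> j\<close> disjI1[OF refl], of "1 - (b' - t)"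
            "b' - t"] e by simp
      then show ?thesis by (simp add: algebra_simps)
    qed
  qed
  show "\<sigma> j (g i a) = \<sigma> j (g i b)"
    if ij: "i \<in> {1..n}" "j \<in> {1..n}" and ab: "a \<le> b" and nz: "\<forall>t\<in>{a..b}. \<sigma> j (g i t) \<noteq> 0" for i j a b
    by (rule side_along[OF ij(2) cont[OF ij(1)] unit[OF ij(1)]])
      (use ab nz side_zero[OF ij(2)] in \<open>auto simp: min_def max_def\<close>)
  show "\<exists>i\<in>{1..n}. \<sigma> i x \<noteq> 0" for x
  proof (rule ccontr)
    assume "\<not> ?thesis"
    then have z: "\<And>i. i \<in> {1..n} \<Longrightarrow> \<sigma> i x = 0" by blast
    have "1 \<in> {1..n}" using n_ge by auto
    then have u: "norm x = 1" using param_eq[of 1 x] unit[of 1] z by metis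
    have "point x \<in> l i" if "i \<in> {1..n}" for i using on_line_iff_side[OF that point[OF u] u] z[OF that]
        by blast
    then have "point x \<in> (\<Inter>i \<in> {1..n}. l i)" by blast
    then show False using arr unfolding pseudoline_arrangement_def by blast
  qed
qed (rule sector_ex)

section \<open>From the sphere back to points of the projective plane\<close>

lemma vertex_unit: "x \<in> vertices \<Longrightarrow> norm x = 1"
  using vertexD[of x] param_eq unit by metis

lemma lines_at_eq:
  assumes "x \<in> Rep_rp2 p" "norm x = 1" shows "lines_at x = lines_through n l p"
  using on_line_iff_side[OF _ assms] by (auto simp: lines_at_def lines_through_def)

definition points :: "rp2 set" where "points = {p. weight n l p \<ge> 2}"

lemma vertices_eq: "vertices = (\<Union>p\<in>points. {x \<in> Rep_rp2 p. norm x = 1})"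
proof (intro set_eqI iffI)
  fix x assume x: "x \<in> vertices"
  then have u: "norm x = 1" by (rule vertex_unit)
  then have "point x \<in> points" using x lines_at_eq[OF point[OF u] u]
      by (simp add: points_def weight_def vertices_def)
  then show "x \<in> (\<Union>p\<in>points. {x \<in> Rep_rp2 p. norm x = 1})" using point[OF u] u by blast
next
  fix x assume "x \<in> (\<Union>p\<in>points. {x \<in> Rep_rp2 p. norm x = 1})"
  then show "x \<in> vertices" using lines_at_eq by (auto simp: points_def weight_def vertices_def)
qed

lemma unit_vectors_of_point: "\<exists>x. {x \<in> Rep_rp2 p. norm x = 1} = {x, - x} \<and> x \<noteq> - x"
proof -
  obtain y where y: "y \<in> Rep_rp2 p" "y \<noteq> 0" by (rule Rep_rp2_nonzero)
  define x where "x = sgn y"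
  have x: "x \<in> Rep_rp2 p" "norm x = 1"
    using y subspace_scale[OF Rep_rp2_subspace] by (auto simp: x_def sgn_div_norm)
  have "{x \<in> Rep_rp2 p. norm x = 1} = {x, - x}"
    using x Rep_rp2_unit[OF x(1) _ x(2)] subspace_neg[OF Rep_rp2_subspace] by auto
  moreover have "x \<noteq> - x"
  proof
    assume "x = - x"
    then have "x \<bullet> x = - (x \<bullet> x)" by (metis inner_minus_left)
    then show False using x(2) by (simp add: dot_square_norm)
  qed
  ultimately show ?thesis by blast
qed

lemma finite_points: "finite points"
proof -
  have "points \<subseteq> point ` vertices"
  proof
    fix p assume p: "p \<in> points"
    obtain x where "{x \<in> Rep_rp2 p. norm x = 1} = {x, - x}" using unit_vectors_of_point by blast
    then have x: "x \<in> Rep_rp2 p" "norm x = 1" by auto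
    then have "x \<in> vertices" using p vertices_eq by blast
    moreover have "x \<noteq> 0" using x by auto
    then have "point x = p" using Rep_rp2_eqI[OF point[OF x(2)] x(1)] by blast
    ultimately show "p \<in> point ` vertices" by blast
  qed
  then show ?thesis using finite_vertices finite_surj by blast
qed

text \<open>A point is represented by two antipodal unit vectors, which lie on the same
  curves.\<close>

lemma sum_vertices:
  fixes f :: "nat \<Rightarrow> nat"
  shows "(\<Sum>x\<in>vertices. f (card (lines_at x))) = 2 * (\<Sum>p\<in>points. f (weight n l p))"
proof -
  have fin: "finite {x \<in> Rep_rp2 p. norm x = 1}" for p
    using unit_vectors_of_point[of p] by (metis finite.emptyI finite.insertI)
  have "(\<Sum>x\<in>vertices. f (card (lines_at x))) = (\<Sum>p\<in>points. \<Sum>x\<in>{x \<in> Rep_rp2 p. norm x = 1}. f (card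
      (lines_at x)))"
    unfolding vertices_eq
  proof (rule sum.UNION_disjoint[OF finite_points], use fin in blast, intro ballI impI)
    fix p q assume "p \<in> points" "q \<in> points" "p \<noteq> q"
    then show "{x \<in> Rep_rp2 p. norm x = 1} \<inter> {x \<in> Rep_rp2 q. norm x = 1} = {}"
      using Rep_rp2_eqI by fastforce
  qed
  also have "\<dots> = (\<Sum>p\<in>points. 2 * f (weight n l p))"
  proof (rule sum.cong[OF refl])
    fix p
    obtain x where x: "{x \<in> Rep_rp2 p. norm x = 1} = {x, - x}" "x \<noteq> - x" using unit_vectors_of_point
        by blast
    have "(\<Sum>x\<in>{x \<in> Rep_rp2 p. norm x = 1}. f (card (lines_at x))) = (\<Sum>x\<in>{x \<in> Rep_rp2 p. norm x = 1}. f
        (weight n l p))"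
      using lines_at_eq by (intro sum.cong) (auto simp: weight_def)
    also have "\<dots> = 2 * f (weight n l p)" unfolding x(1) using x(2) by simp
    finally show "(\<Sum>x\<in>{x \<in> Rep_rp2 p. norm x = 1}. f (card (lines_at x))) = 2 * f (weight n l p)" .
  qed
  finally show ?thesis by (simp add: sum_distrib_left)
qed

text \<open>Here 3 F \<le> 2 E meets the lower bound for F, halved by the passage to the projective
  plane. Collected by weights, the sum of (w - 3) t_w is at most -3.\<close>

lemma melchior:
  "3 + 3 * (\<Sum>p\<in>points. weight n l p - 1) \<le> 2 * (\<Sum>p\<in>points. weight n l p)"
proof -
  have "6 * (2 + (\<Sum>x\<in>vertices. card (lines_at x) - 1)) \<le> 4 * (\<Sum>x\<in>vertices. card (lines_at x))"
  proof -
    have "6 * (2 + (\<Sum>x\<in>vertices. card (lines_at x) - 1)) \<le> 6 * card topes"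
      by (intro mult_left_mono card_topes_ge) simp
    then show ?thesis using melchior_topes card_slots by simp
  qed
  then show ?thesis using sum_vertices[of "\<lambda>k. k - 1"] sum_vertices[of "\<lambda>k. k"] by simp
qed

text \<open>A point of weight w contributes 16 (w - 1) - 11 w = 5 w - 16, raised by 2 if w = 2.
  These are -4, -1, 4, 9 for the weights 2 to 5, which gives 4 t_2 + t_3 \<ge> 16 + 4 t_4 + 9 t_5 if
  there are no larger weights.\<close>

lemma double_points_bound:
  assumes "\<And>p. weight n l p + 2 \<le> n"
  shows "2 * card {p \<in> points. weight n l p = 2} + 16 + 16 * (\<Sum>p\<in>points. weight n l p - 1)
    \<le> 11 * (\<Sum>p\<in>points. weight n l p)"
proof -
  have "card (lines_at x) + 2 \<le> n" for x
  proof (cases "norm x = 1")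
    case True
    then show ?thesis using lines_at_eq[OF point] assms by (simp add: weight_def)
  next
    case False
    then have "lines_at x = {}" using param_eq unit unfolding lines_at_def
        by (metis (mono_tags, lifting) empty_Collect_eq)
    then show ?thesis using n_ge by simp
  qed
  then have "8 * card {x \<in> vertices. card (lines_at x) = 2} + 64 * card topes \<le> 11 * card slots"
    by (rule simple_vertex_bound)
  moreover have **: "card {x \<in> vertices. card (lines_at x) = 2} = 2 * card {p \<in> points. weight n l p = 2}"
    unfolding card_filter_sum[OF finite_vertices] card_filter_sum[OF finite_points]
    by (rule sum_vertices)
  ultimately have *: "16 * card {p \<in> points. weight n l p = 2} + 64 * card topes \<le> 11 * card slots" by simp
  have "16 * card {p \<in> points. weight n l p = 2} + 64 * (2 + (\<Sum>x\<in>vertices. card (lines_at x) - 1))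
     \<le> 44 * (\<Sum>x\<in>vertices. card (lines_at x))"
  proof -
    have "64 * (2 + (\<Sum>x\<in>vertices. card (lines_at x) - 1)) \<le> 64 * card topes"
      by (intro mult_left_mono card_topes_ge) simp
    with * show ?thesis using card_slots by simp
  qed
  then show ?thesis using sum_vertices[of "\<lambda>k. k - 1"] sum_vertices[of "\<lambda>k. k"] by simp
qed

end

lemma lifted_arrangement_ex:
  assumes arr: "pseudoline_arrangement n l"
  shows "\<exists>c g g' \<sigma>. lifted_arrangement n l c g g' \<sigma>"
proof -
  have "\<forall>i\<in>{1..n}. \<exists>c. parametrizes c (l i)"
    using arr unfolding pseudoline_arrangement_def smooth_simple_closed_curve_def by blast
  then obtain c where c: "\<forall>i\<in>{1..n}. parametrizes (c i) (l i)" by (rule bchoice[THEN exE])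
  have "\<exists>g. i \<in> {1..n} \<longrightarrow> regular_sphere_curve (fst g) (snd g) \<and> (\<forall>t. fst g t \<in> Rep_rp2 (c i t))" for i
  proof (cases "i \<in> {1..n}")
    case True
    show ?thesis
    proof (rule regular_lift_ex[OF c[rule_format, OF True]])
      fix g g' assume "regular_sphere_curve g g'" "\<And>t. g t \<in> Rep_rp2 (c i t)"
      then show ?thesis by (intro exI[of _ "(g, g')"]) simp
    qed
  qed auto
  then have "\<exists>g. \<forall>i. i \<in> {1..n} \<longrightarrow> regular_sphere_curve (fst (g i)) (snd (g i)) \<and>
      (\<forall>t. fst (g i) t \<in> Rep_rp2 (c i t))"
    by (intro choice allI)
  then obtain g0 where g0: "\<forall>i. i \<in> {1..n} \<longrightarrow> regular_sphere_curve (fst (g0 i)) (snd (g0 i)) \<and>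
      (\<forall>t. fst (g0 i) t \<in> Rep_rp2 (c i t))"
    by (elim exE)
  define g where "g i = fst (g0 i)" for i
  define g' where "g' i = snd (g0 i)" for i
  have g: "\<And>i. i \<in> {1..n} \<Longrightarrow> regular_sphere_curve (g i) (g' i) \<and> (\<forall>t. g i t \<in> Rep_rp2 (c i t))"
    using g0 by (simp add: g_def g'_def)
  have side: "\<exists>\<sigma>. (i \<in> {1..n} \<longrightarrow> side_function (range (g i)) \<sigma>) \<and> range \<sigma> \<subseteq> {-1, 0, 1}" for i
  proof (cases "i \<in> {1..n}")
    case True
    then have "regular_sphere_curve (g i) (g' i)" using g by blast
    then obtain \<sigma> where "side_function (range (g i)) \<sigma>" using regular_sphere_curve.side_ex by blast
    then show ?thesis unfolding side_function_def by blast
  next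
    case False
    then show ?thesis by (intro exI[of _ "\<lambda>_. 0"]) auto
  qed
  have "\<exists>\<sigma>. \<forall>i. (i \<in> {1..n} \<longrightarrow> side_function (range (g i)) (\<sigma> i)) \<and> range (\<sigma> i) \<subseteq> {-1, 0, 1}"
    by (intro choice allI side)
  then obtain \<sigma> where s: "\<forall>i. (i \<in> {1..n} \<longrightarrow> side_function (range (g i)) (\<sigma> i)) \<and> range (\<sigma> i) \<subseteq> {-1, 0, 1}"
    by (elim exE)
  have "lifted_arrangement n l c g g' \<sigma>"
  proof (rule lifted_arrangement.intro)
    show "\<sigma> i x \<in> {-1, 0, 1}" for i x
    proof -
      have "range (\<sigma> i) \<subseteq> {-1, 0, 1}" using s by blast
      then show ?thesis by (rule subsetD) simp
    qed
    show "side_function (range (g i)) (\<sigma> i)" if "i \<in> {1..n}" for i using s that by blast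
    show "g i t \<in> Rep_rp2 (c i t)" if "i \<in> {1..n}" for i t using g[OF that] by blast
    show "regular_sphere_curve (g i) (g' i)" if "i \<in> {1..n}" for i using g[OF that] by blast
    show "parametrizes (c i) (l i)" if "i \<in> {1..n}" for i using c that by blast
  qed (rule arr)
  then show ?thesis by blast
qed

section \<open>The characteristic polynomial\<close>

lemma nonreal_root:
  fixes p :: "int poly" and a b :: int
  assumes p: "p = [:-1, 1:] * [:b, - a, 1:]" and disc: "a\<^sup>2 < 4 * b"
  shows "\<not> only_real_roots p"
proof
  assume real: "only_real_roots p"
  define r where "r = sqrt (real_of_int (4 * b - a\<^sup>2))"
  have "real_of_int (4 * b - a\<^sup>2) > 0" unfolding of_int_0_less_iff using disc by simp
  then have r: "r > 0" "r\<^sup>2 = real_of_int (4 * b - a\<^sup>2)" unfolding r_def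
      by (simp_all del: of_int_diff of_int_mult of_int_power)
  define z where "z = Complex (real_of_int a / 2) (r / 2)"
  have z: "z * z - of_int a * z + of_int b = 0"
    using r(2) by (simp add: z_def complex_eq_iff power2_eq_square algebra_simps)
  have "p = [:- b, a + b, - a - 1, 1:]" unfolding p by simp
  then have "poly (map_poly of_int p) z = (z - 1) * (z * z - of_int a * z + of_int b)"
    by (simp add: map_poly_pCons algebra_simps)
  then have "poly (map_poly of_int p) z = 0" using z by simp
  then have "z \<in> \<real>" using real unfolding only_real_roots_def by blast
  then show False using r(1) by (simp add: z_def complex_is_Real_iff)
qed

lemma moebius_self [simp]: "moebius L X X = 1"
  by (subst moebius.simps) simp

lemma moebius_less:
  "X \<subset> Y \<Longrightarrow> finite Y \<Longrightarrow> moebius L X Y = - (\<Sum>Z \<in> {Z \<in> L. X \<subseteq> Z \<and> Z \<subset> Y}. moebius L X Z)"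
  by (subst moebius.simps) auto

context
  fixes n :: nat and l :: "nat \<Rightarrow> rp2 set"
  assumes arr: "pseudoline_arrangement n l"
begin

lemma n_ge3: "n \<ge> 3" using arr by (simp add: pseudoline_arrangement_def)

lemma lines_through_sub: "lines_through n l v \<subseteq> {1..n}" by (auto simp: lines_through_def)

lemma lines_through_finite [simp]: "finite (lines_through n l v)"
  using lines_through_sub finite_subset by blast

lemma lines_through_unique:
  assumes "i \<in> lines_through n l v" "j \<in> lines_through n l v" "i \<noteq> j"
    "i \<in> lines_through n l w" "j \<in> lines_through n l w"
  shows "v = w"
  using assms arr unfolding pseudoline_arrangement_def lines_through_def
  by (metis (no_types, lifting) IntI mem_Collect_eq singletonD)

lemma two_lines:
  assumes "card (X :: nat set) \<ge> 2" obtains i j where "i \<in> X" "j \<in> X" "i \<noteq> j"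
  using assms by (metis card_2_iff' card_le_Suc0_iff_eq card.infinite not_numeral_le_zero numeral_2_eq_2
      not_less_eq_eq)

lemma lines_through_ne_all: "lines_through n l v \<noteq> {1..n}"
proof
  assume "lines_through n l v = {1..n}"
  then have "v \<in> (\<Inter>i \<in> {1..n}. l i)" by (auto simp: lines_through_def)
  then show False using arr unfolding pseudoline_arrangement_def by blast
qed

definition flats :: "nat set set" where
  "flats = {lines_through n l v | v. card (lines_through n l v) \<ge> 2}"

lemma lattice_eq: "intersection_lattice n l = insert {} ((\<lambda>i. {i}) ` {1..n} \<union> flats \<union> {{1..n}})"
  by (auto simp: intersection_lattice_def flats_def)

lemma finite_flats [simp]: "finite flats"
  by (rule finite_subset[of _ "Pow {1..n}"]) (use lines_through_sub in \<open>auto simp: flats_def\<close>)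

lemma flatsD: assumes "X \<in> flats" shows "card X \<ge> 2" "X \<subset> {1..n}" "finite X"
  using assms lines_through_sub lines_through_ne_all lines_through_finite unfolding flats_def by blast+

lemma flats_incomparable:
  assumes "X \<in> flats" "Y \<in> flats" "X \<subseteq> Y" shows "X = Y"
proof -
  obtain v w where v: "X = lines_through n l v" "card X \<ge> 2" and w: "Y = lines_through n l w"
      using assms by (auto simp: flats_def)
  obtain i j where "i \<in> X" "j \<in> X" "i \<noteq> j" using two_lines v(2) by blast
  then have "v = w" using lines_through_unique[of i v j w] assms(3) v w by auto
  then show ?thesis using v w by simp
qed

abbreviation lat where "lat \<equiv> intersection_lattice n l"

lemma moebius_singleton: "i \<in> {1..n} \<Longrightarrow> moebius lat {} {i} = -1"
proof -
  assume i: "i \<in> {1..n}"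
  have "{Z \<in> lat. {} \<subseteq> Z \<and> Z \<subset> {i}} = {{}}" by (auto simp: lattice_eq)
  then show ?thesis by (subst moebius_less) auto
qed

text \<open>Strictly below a flat there are only the empty set and the singletons of its elements,
  since two curves determine their common point.\<close>

lemma moebius_flat:
  assumes X: "X \<in> flats" shows "moebius lat {} X = int (card X) - 1"
proof -
  note D = flatsD[OF X]
  have "{Z \<in> lat. {} \<subseteq> Z \<and> Z \<subset> X} = insert {} ((\<lambda>i. {i}) ` X)"
  proof (intro set_eqI iffI)
    fix Z assume Z: "Z \<in> {Z \<in> lat. {} \<subseteq> Z \<and> Z \<subset> X}"
    then have "Z \<notin> flats" using flats_incomparable[OF _ X] by blast
    moreover have "Z \<noteq> {1..n}" using Z D by blast
    ultimately show "Z \<in> insert {} ((\<lambda>i. {i}) ` X)" using Z by (auto simp: lattice_eq)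
  next
    fix Z assume "Z \<in> insert {} ((\<lambda>i. {i}) ` X)"
    then consider "Z = {}" | i where "i \<in> X" "Z = {i}" by auto
    then show "Z \<in> {Z \<in> lat. {} \<subseteq> Z \<and> Z \<subset> X}"
    proof cases
      case 1 then show ?thesis using D by (auto simp: lattice_eq)
    next
      case 2
      then have "Z \<noteq> X" using D by auto
      then show ?thesis using 2 D by (auto simp: lattice_eq)
    qed
  qed
  moreover have "{} \<subset> X" using D by auto
  ultimately have "moebius lat {} X = - (\<Sum>Z \<in> insert {} ((\<lambda>i. {i}) ` X). moebius lat {} Z)"
    using D(3) by (simp add: moebius_less)
  also have "\<dots> = - (1 + (\<Sum>Z \<in> (\<lambda>i. {i}) ` X. moebius lat {} Z))"
    using D(3) by (subst sum.insert) auto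
  also have "(\<Sum>Z \<in> (\<lambda>i. {i}) ` X. moebius lat {} Z) = (\<Sum>i\<in>X. moebius lat {} {i})"
    by (subst sum.reindex) (auto simp: inj_on_def)
  also have "\<dots> = (\<Sum>i\<in>X. -1)" using moebius_singleton D(2) by (intro sum.cong) auto
  finally show ?thesis by simp
qed

text \<open>The linear coefficient of the characteristic polynomial; \<open>flats_sum\<close>
  rewrites it as a sum over points.\<close>

definition flat_sum where "flat_sum = (\<Sum>X\<in>flats. int (card X) - 1)"

lemma sum_lattice_below:
  fixes g :: "nat set \<Rightarrow> 'b :: comm_monoid_add"
  shows "(\<Sum>Z \<in> insert {} ((\<lambda>i. {i}) ` {1..n} \<union> flats). g Z) = g {} + ((\<Sum>i\<in>{1..n}. g {i}) + (\<Sum>X\<in>flats. g X))"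
proof -
  have d: "(\<lambda>i. {i}) ` {1..n} \<inter> flats = {}" using flatsD(1) by fastforce
  have e: "{} \<notin> (\<lambda>i. {i}) ` {1..n} \<union> flats" using flatsD(1) by fastforce
  have "(\<Sum>Z \<in> (\<lambda>i. {i}) ` {1..n}. g Z) = (\<Sum>i\<in>{1..n}. g {i})"
    by (subst sum.reindex) (auto simp: inj_on_def)
  then show ?thesis using d e by (simp add: sum.union_disjoint)
qed

lemma moebius_top: "moebius lat {} {1..n} = int n - 1 - flat_sum"
proof -
  have "{Z \<in> lat. {} \<subseteq> Z \<and> Z \<subset> {1..n}} = insert {} ((\<lambda>i. {i}) ` {1..n} \<union> flats)"
  proof (intro set_eqI iffI)
    fix Z assume "Z \<in> {Z \<in> lat. {} \<subseteq> Z \<and> Z \<subset> {1..n}}"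
    then show "Z \<in> insert {} ((\<lambda>i. {i}) ` {1..n} \<union> flats)" by (auto simp: lattice_eq)
  next
    fix Z assume Z: "Z \<in> insert {} ((\<lambda>i. {i}) ` {1..n} \<union> flats)"
    have "{i} \<noteq> {1..n}" for i :: nat
    proof
      assume "{i} = {1..n}"
      then have "card {i} = card {1..n}" by simp
      then show False using n_ge3 by simp
    qed
    moreover have "{} \<noteq> {1..n}" using n_ge3 by auto
    ultimately show "Z \<in> {Z \<in> lat. {} \<subseteq> Z \<and> Z \<subset> {1..n}}" using Z flatsD(2) unfolding lattice_eq by blast
  qed
  moreover have "{} \<subset> {1..n}" using n_ge3 by auto
  ultimately have "moebius lat {} {1..n} = - (\<Sum>Z \<in> insert {} ((\<lambda>i. {i}) ` {1..n} \<union> flats). moebius lat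
      {} Z)"
    by (simp only: moebius_less finite_atLeastAtMost)
  also have "\<dots> = - (1 + ((\<Sum>i\<in>{1..n}. moebius lat {} {i}) + (\<Sum>X\<in>flats. moebius lat {} X)))"
    unfolding sum_lattice_below by simp
  also have "(\<Sum>i\<in>{1..n}. moebius lat {} {i}) = (\<Sum>i\<in>{1..n}. -1)" using moebius_singleton
      by (intro sum.cong) auto
  also have "(\<Sum>X\<in>flats. moebius lat {} X) = flat_sum" unfolding flat_sum_def using moebius_flat
      by (intro sum.cong) auto
  finally show ?thesis by simp
qed

text \<open>The root 1 reflects that the Moebius values from the bottom add up to 0 over the whole
  lattice.\<close>

lemma characteristic_poly_eq:
  "characteristic_poly n l = [:-1, 1:] * [:flat_sum - (int n - 1), - (int n - 1), 1:]"
proof -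
  let ?m = "\<lambda>X. monom (moebius lat {} X) (3 - lattice_rank n X)"
  have top: "{1..n} \<notin> insert {} ((\<lambda>i. {i}) ` {1..n} \<union> flats)"
  proof
    assume "{1..n} \<in> insert {} ((\<lambda>i. {i}) ` {1..n} \<union> flats)"
    moreover have "{1..n} \<noteq> {}" "{1..n} \<notin> flats" using n_ge3 flatsD(2) by auto
    ultimately obtain i where "{1..n} = {i}" by auto
    then have "card {1..n} = card {i}" by simp
    then show False using n_ge3 by simp
  qed
  have fin: "finite (insert {} ((\<lambda>i. {i}) ` {1..n} \<union> flats))" by simp
  have "lat = insert {1..n} (insert {} ((\<lambda>i. {i}) ` {1..n} \<union> flats))" by (auto simp: lattice_eq)
  then have "characteristic_poly n l = ?m {1..n} + (\<Sum>Z \<in> insert {} ((\<lambda>i. {i}) ` {1..n} \<union> flats). ?m Z)"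
    unfolding characteristic_poly_def using sum.insert[OF fin top, of ?m] by simp
  also have "\<dots> = ?m {1..n} + (?m {} + ((\<Sum>i\<in>{1..n}. ?m {i}) + (\<Sum>X\<in>flats. ?m X)))"
    unfolding sum_lattice_below ..
  also have "(\<Sum>i\<in>{1..n}. ?m {i}) = (\<Sum>i\<in>{1..n}. monom (-1) 2)"
    using moebius_singleton by (intro sum.cong) (auto simp: lattice_rank_def)
  also have "\<dots> = monom (- int n) 2" by (simp add: of_nat_poly smult_monom smult_conv_map_poly[symmetric]
      poly_eq_iff)
  also have "(\<Sum>X\<in>flats. ?m X) = (\<Sum>X\<in>flats. monom (int (card X) - 1) 1)"
  proof (rule sum.cong[OF refl])
    fix X assume X: "X \<in> flats"
    then have "lattice_rank n X = 2" using flatsD[OF X] by (auto simp: lattice_rank_def)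
    then show "?m X = monom (int (card X) - 1) 1" using moebius_flat[OF X] by simp
  qed
  also have "\<dots> = monom flat_sum 1" unfolding flat_sum_def by (rule monom_sum[symmetric])
  also have "?m {1..n} = monom (int n - 1 - flat_sum) 0"
    using moebius_top n_ge3 by (simp add: lattice_rank_def)
  also have "?m {} = monom 1 3" by (simp add: lattice_rank_def)
  finally show ?thesis
    by (simp add: monom_altdef power2_eq_square power3_eq_cube algebra_simps)
qed

lemma flats_sum:
  fixes g :: "nat \<Rightarrow> 'b :: comm_monoid_add"
  shows "(\<Sum>X\<in>flats. g (card X)) = (\<Sum>p\<in>{p. weight n l p \<ge> 2}. g (weight n l p))"
proof -
  have "inj_on (lines_through n l) {p. weight n l p \<ge> 2}"
  proof (rule inj_onI)
    fix p q assume p: "p \<in> {p. weight n l p \<ge> 2}" and eq: "lines_through n l p = lines_through n l q"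
    obtain i j where "i \<in> lines_through n l p" "j \<in> lines_through n l p" "i \<noteq> j" using two_lines p
        by (auto simp: weight_def)
    then show "p = q" using lines_through_unique eq by metis
  qed
  moreover have "flats = lines_through n l ` {p. weight n l p \<ge> 2}" by (auto simp: flats_def weight_def)
  ultimately show ?thesis by (simp add: sum.reindex weight_def)
qed

text \<open>The discriminant of the quadratic factor must not be negative: (n - 1)^2 \<ge> 4 (b - (n
  - 1)), with b the sum on the left.\<close>

lemma real_roots_imp:
  assumes "only_real_roots (characteristic_poly n l)"
  shows "4 * (\<Sum>p\<in>{p. weight n l p \<ge> 2}. int (weight n l p) - 1) \<le> int n * int n + 2 * int n - 3"
proof -
  have "\<not> (int n - 1)\<^sup>2 < 4 * (flat_sum - (int n - 1))"
      using nonreal_root[OF characteristic_poly_eq] assms by blast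
  moreover have "flat_sum = (\<Sum>p\<in>{p. weight n l p \<ge> 2}. int (weight n l p) - 1)"
    unfolding flat_sum_def using flats_sum[of "\<lambda>k. int k - 1"] by simp
  ultimately show ?thesis by (simp add: power2_eq_square algebra_simps)
qed

text \<open>Ordered pairs of distinct curves are sorted by their unique common point.\<close>

lemma count_pairs:
  assumes fin: "finite {p. weight n l p \<ge> 2}"
  shows "(\<Sum>p\<in>{p. weight n l p \<ge> 2}. weight n l p * (weight n l p - 1)) = n * (n - 1)"
proof -
  define D where "D A = {(i, j). i \<in> A \<and> j \<in> A \<and> i \<noteq> j}" for A :: "nat set"
  have D: "finite (D A)" "card (D A) = card A * (card A - 1)" if "finite A" for A
  proof -
    have eq: "D A = (SIGMA i:A. A - {i})" by (auto simp: D_def)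
    show "finite (D A)" unfolding eq using that by auto
    have "card (D A) = (\<Sum>i\<in>A. card (A - {i}))" unfolding eq using that by (subst card_SigmaI) auto
    also have "\<dots> = (\<Sum>i\<in>A. card A - 1)" using that by (intro sum.cong) auto
    finally show "card (D A) = card A * (card A - 1)" by simp
  qed
  have "D {1..n} = (\<Union>p\<in>{p. weight n l p \<ge> 2}. D (lines_through n l p))"
  proof (intro set_eqI iffI)
    fix z assume "z \<in> D {1..n}"
    then obtain i j where z: "z = (i, j)" "i \<in> {1..n}" "j \<in> {1..n}" "i \<noteq> j" by (auto simp: D_def)
    then obtain p where "l i \<inter> l j = {p}" using arr unfolding pseudoline_arrangement_def by blast
    then have ij: "i \<in> lines_through n l p" "j \<in> lines_through n l p" using z
        by (auto simp: lines_through_def)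
    then have "card {i, j} \<le> weight n l p" unfolding weight_def by (intro card_mono) auto
    then have "2 \<le> weight n l p" using z by simp
    then show "z \<in> (\<Union>p\<in>{p. weight n l p \<ge> 2}. D (lines_through n l p))" 
      using ij z unfolding D_def by blast
  next
    fix z assume "z \<in> (\<Union>p\<in>{p. weight n l p \<ge> 2}. D (lines_through n l p))"
    then show "z \<in> D {1..n}" using lines_through_sub by (fastforce simp: D_def)
  qed
  then have "card (D {1..n}) = (\<Sum>p\<in>{p. weight n l p \<ge> 2}. card (D (lines_through n l p)))"
  proof (simp only:, intro card_UN_disjoint[OF fin] ballI impI)
    fix p q :: rp2 assume "p \<noteq> q"
    then show "D (lines_through n l p) \<inter> D (lines_through n l q) = {}"
      using lines_through_unique by (fastforce simp: D_def)
  qed (simp add: D)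
  then show ?thesis using D[of "{1..n}"] D(2) by (simp add: weight_def)
qed

text \<open>\<open>t_num\<close> is a cardinality and so would be 0 for an infinite set; finiteness
  of the set of points of weight at least 2 makes it positive here. The set under \<open>Max\<close>
  is finite because weights are at most \<open>n\<close>.\<close>

lemma weight_le_multiplicity:
  assumes fin: "finite {p. weight n l p \<ge> 2}" and p: "weight n l p \<ge> 2"
  shows "weight n l p \<le> arr_multiplicity n l"
proof -
  have "{j. t_num n l j > 0} \<subseteq> {..n}"
  proof
    fix j assume "j \<in> {j. t_num n l j > 0}"
    then have "{v. weight n l v = j} \<noteq> {}" unfolding t_num_def
        by (metis card.empty less_irrefl mem_Collect_eq)
    then obtain v where "weight n l v = j" by blast
    then show "j \<in> {..n}" using card_mono[OF _ lines_through_sub[of v]] by (auto simp: weight_def)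
  qed
  then have "finite {j. t_num n l j > 0}" using finite_subset by blast
  moreover have "{v. weight n l v = weight n l p} \<noteq> {}" "finite {v. weight n l v = weight n l p}"
    using p by (auto intro: finite_subset[OF _ fin])
  then have "t_num n l (weight n l p) > 0" unfolding t_num_def using card_gt_0_iff by blast
  ultimately show ?thesis unfolding arr_multiplicity_def by (intro Max_ge) auto
qed

end

theorem theorem4p4:
  fixes n :: nat and l :: "nat \<Rightarrow> rp2 set"
  assumes "pseudoline_arrangement n l"
    and "only_real_roots (characteristic_poly n l)"
  shows "(arr_multiplicity n l \<le> 4 \<longrightarrow> n \<le> 19) \<and>
         (arr_multiplicity n l \<le> 5 \<longrightarrow> n \<le> 185)"
proof -
  obtain c g g' \<sigma> where "lifted_arrangement n l c g g' \<sigma>" using lifted_arrangement_ex[OF assms(1)] by blast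
  then interpret lifted_arrangement n l c g g' \<sigma> .
  let ?w = "weight n l"
  have fin: "finite {p. ?w p \<ge> 2}" using finite_points by (simp add: points_def)
  have w2: "?w p \<ge> 2" if "p \<in> points" for p using that by (simp add: points_def)
  have int_w: "int (?w p - 1) = int (?w p) - 1" if "p \<in> points" for p using w2[OF that] by simp
  have roots: "4 * (\<Sum>p\<in>points. int (?w p) - 1) \<le> int n * int n + 2 * int n - 3"
    using real_roots_imp[OF assms] by (simp add: points_def)
  have pairs: "(\<Sum>p\<in>points. int (?w p) * (int (?w p) - 1)) = int n * (int n - 1)"
  proof -
    have "int (\<Sum>p\<in>points. ?w p * (?w p - 1)) = int (n * (n - 1))"
      using count_pairs[OF assms(1) fin] by (simp add: points_def)
    moreover have "int (\<Sum>p\<in>points. ?w p * (?w p - 1)) = (\<Sum>p\<in>points. int (?w p) * (int (?w p) - 1))"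
      unfolding of_nat_sum by (intro sum.cong refl) (simp only: of_nat_mult int_w)
    ultimately show ?thesis using n_ge by (simp add: of_nat_diff)
  qed
  have b_int: "int (\<Sum>p\<in>points. ?w p - 1) = (\<Sum>p\<in>points. int (?w p) - 1)"
    unfolding of_nat_sum by (intro sum.cong refl) (simp only: int_w)
  have le_mult: "?w p \<le> arr_multiplicity n l" if "p \<in> points" for p
    using weight_le_multiplicity[OF assms(1) fin] w2[OF that] by simp
  show ?thesis
  proof (intro conjI impI)
    assume m: "arr_multiplicity n l \<le> 4"
    have "int (3 + 3 * (\<Sum>p\<in>points. ?w p - 1)) \<le> int (2 * (\<Sum>p\<in>points. ?w p))"
      using melchior by (simp only: of_nat_le_iff)
    then have M: "3 + 3 * (\<Sum>p\<in>points. int (?w p) - 1) \<le> 2 * (\<Sum>p\<in>points. int (?w p))"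
      by (simp add: b_int[symmetric])
    \<comment> \<open>The coefficients give equality for the weights 2 and 4, matching the extremal
      mixture of Melchior's inequality, about as many double points as points of weight 4.\<close>
    have "(\<Sum>p\<in>points. 2 * (int (?w p) * (int (?w p) - 1)) + 6 * int (?w p))
        \<le> (\<Sum>p\<in>points. 16 * (int (?w p) - 1))"
    proof (rule sum_mono)
      fix p assume p: "p \<in> points"
      have "?w p \<in> {2, 3, 4}" using w2[OF p] le_mult[OF p] m by auto
      then show "2 * (int (?w p) * (int (?w p) - 1)) + 6 * int (?w p) \<le> 16 * (int (?w p) - 1)" by auto
    qed
    then have E: "2 * (int n * (int n - 1)) + 6 * (\<Sum>p\<in>points. int (?w p)) \<le> 16 * (\<Sum>p\<in>points. int (?w p)
        - 1)"
      by (simp only: sum.distrib sum_distrib_left[symmetric] pairs)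
    have "8 * (int n * (int n - 1)) + 36 \<le> 7 * (int n * int n + 2 * int n - 3)"
    proof -
      \<comment> \<open>Four times the first inequality, twelve times the second and seven times the
        third.\<close>
      have "8 * P + 36 \<le> 7 * R" if "2 * P + 6 * S \<le> 16 * B" "3 + 3 * B \<le> 2 * S" "4 * B \<le> R" for P S B R
          :: int
        using that by linarith
      then show ?thesis using E M roots by blast
    qed
    then have "(int n - 3) * (int n - 19) \<le> 0" by (simp add: algebra_simps)
    then show "n \<le> 19" using n_ge by (auto simp: mult_le_0_iff)
  next
    assume m: "arr_multiplicity n l \<le> 5"
    show "n \<le> 185"
    proof (rule ccontr)
      assume n: "\<not> n \<le> 185"
      \<comment> \<open>Weights are at most 5 and \<open>n\<close> is large, so the exceptional case
        of all curves but one being concurrent is excluded.\<close>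
      have "?w p + 2 \<le> n" for p
      proof (cases "p \<in> points")
        case True
        then show ?thesis using le_mult m n by fastforce
      next
        case False
        then show ?thesis using n by (simp add: points_def)
      qed
      then have "int (2 * card {p \<in> points. ?w p = 2} + 16 + 16 * (\<Sum>p\<in>points. ?w p - 1)) \<le> int (11 *
          (\<Sum>p\<in>points. ?w p))"
        using double_points_bound by (simp only: of_nat_le_iff)
      then have N: "2 * (\<Sum>p\<in>points. if ?w p = 2 then 1 else 0) + 16 + 16 * (\<Sum>p\<in>points. int (?w p) - 1)
          \<le> 11 * (\<Sum>p\<in>points. int (?w p))"
        by (simp add: b_int[symmetric] card_filter_sum[OF finite_points] if_distrib cong: if_cong)
      \<comment> \<open>Equality for the weights 2 and 5: the mixture that is extremal for
        \<open>N\<close> has nine double points to four points of weight 5.\<close>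
      have "(\<Sum>p\<in>points. 25 * (int (?w p) * (int (?w p) - 1)) + 132 * int (?w p))
        \<le> (\<Sum>p\<in>points. 290 * (int (?w p) - 1) + 24 * (if ?w p = 2 then 1 else 0))"
      proof (rule sum_mono)
        fix p assume p: "p \<in> points"
        have "?w p \<in> {2, 3, 4, 5}" using w2[OF p] le_mult[OF p] m by auto
        then show "25 * (int (?w p) * (int (?w p) - 1)) + 132 * int (?w p)
          \<le> 290 * (int (?w p) - 1) + 24 * (if ?w p = 2 then 1 else 0)" by auto
      qed
      then have E: "25 * (int n * (int n - 1)) + 132 * (\<Sum>p\<in>points. int (?w p))
          \<le> 290 * (\<Sum>p\<in>points. int (?w p) - 1) + 24 * (\<Sum>p\<in>points. if ?w p = 2 then 1 else 0)"
        by (simp only: sum.distrib sum_distrib_left[symmetric] pairs)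
      have "50 * (int n * (int n - 1)) + 384 \<le> 49 * (int n * int n + 2 * int n - 3)"
      proof -
        \<comment> \<open>Twice the first inequality, 24 times the second and 49 times the
          third.\<close>
        have "50 * P + 384 \<le> 49 * R" if "25 * P + 132 * S \<le> 290 * B + 24 * T"
          "2 * T + 16 + 16 * B \<le> 11 * S" "4 * B \<le> R" for P S T B R :: int
          using that by linarith
        then show ?thesis using E N roots by blast
      qed
      \<comment> \<open>The left side is positive already from n = 148 on, so the bound 185 is
        reached with room to spare.\<close>
      then have "int n * (int n - 148) + 531 \<le> 0" by (simp add: algebra_simps)
      moreover have "int n * (int n - 148) \<ge> 0" using n by simp
      ultimately show False by linarith
    qed
  qed
qed

end
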